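(* Let $v$ be a viscosity solution of $H(x,c+v_x(x))=h(c)$ on $\mathbb{T}^n$. Then: (i) For each $x\in\mathbb{T}^n$ there exists $\xi\in\mathbb{R}^n$ such that every accumulation point of $\{\phi^s_L(x,\xi)\}_{s\le0}$ as $s\to-\infty$ belongs to $\tilde{\mathcal{M}}_\alpha(v;c)$; if $v$ is differentiable at $x$, one can take $\xi=H_p(x,c+v_x(x))$. (ii) $\phi^s_L(\tilde{\mathcal{M}}_\alpha(v;c))=\tilde{\mathcal{M}}_\alpha(v;c)$ for all $s\in\mathbb{R}$. (iii) For each $x\in\mathbb{T}^n$ there exists $p\in\mathbb{R}^n$ such that $\phi^s_H(x,p)\in\mathrm{graph}(c+v_x)$ for all $s<0$ and every accumulation point of $\{\phi^s_H(x,p)\}_{s\le0}$ as $s\to-\infty$ belongs to $\tilde{\mathcal{M}}^\ast_\alpha(v;c)$; if $v$ is differentiable at $x$, one can take $p=c+v_x(x)$. (iv) $\tilde{\mathcal{M}}^\ast_\alpha(v;c)\subset\mathrm{graph}(c+v_x)$ and $\phi^s_H(\tilde{\mathcal{M}}^\ast_\alpha(v;c))=\tilde{\mathcal{M}}^\ast_\alpha(v;c)$ for all $s\in\mathbb{R}$.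
   Context: $H:\mathbb{T}^n\times\mathbb{R}^n\to\mathbb{R}$ is $C^2$, $H_{pp}$ is positive definite, and $H(x,p)/|p|\to+\infty$ as $|p|\to\infty$ uniformly in $x$; $L(x,\xi)=\sup_p\{\xi\cdot p-H(x,p)\}$. $c\in\mathbb{R}^n$ is fixed and $h(c)$ is the unique constant for which $H(x,c+v_x)=h(c)$ has a viscosity solution on $\mathbb{T}^n$. $\phi^s_L$ is the flow on $\mathbb{T}^n\times\mathbb{R}^n$ of the Euler–Lagrange equation $\frac{d}{ds}L_\xi(x,x')=L_x(x,x')$, $\phi^s_L(x(0),x'(0))=(x(s),x'(s))$; $\phi^s_H$ is the flow of $x'=H_p(x,p)$, $p'=-H_x(x,p)$. Every viscosity solution $v$ is Lipschitz and satisfies $v(x)=\inf\{\int_{-T}^0(L(\gamma,\gamma')-c\cdot\gamma'+h(c))\,ds+v(\gamma(-T))\}$ over absolutely continuous $\gamma:[-T,0]\to\mathbb{T}^n$ with $\gamma(0)=x$, for all $T>0$. A minimizing curve for $v(x)$ is $\gamma^\ast:(-\infty,0]\to\mathbb{T}^n$, $\gamma^\ast(0)=x$, whose restriction to every $[-T,0]$ attains this infimum. $\mathcal{M}_\alpha(v;c)$ is the closure of the set of all $\alpha$-limit points (limits of $\gamma^\ast(\tau_j)$ with $\tau_j\to-\infty$) of all minimizing curves for $v(x)$, $x\in\mathbb{T}^n$. The function $v$ is differentiable at each point of $\mathcal{M}_\alpha(v;c)$, and $\tilde{\mathcal{M}}_\alpha(v;c):=\{(x,H_p(x,c+v_x(x))):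 x\in\mathcal{M}_\alpha(v;c)\}$, $\tilde{\mathcal{M}}^\ast_\alpha(v;c):=\{(x,c+v_x(x)):x\in\mathcal{M}_\alpha(v;c)\}$. $\mathrm{graph}(c+v_x):=\{(x,c+v_x(x)): x\in\mathbb{T}^n,\ v \text{ differentiable at } x\}$. *)

theory Defs
  imports "HOL-Analysis.Analysis"
begin

text \<open>The torus T^n is represented by its universal cover R^n = real^'n;
  all objects are Z^n-periodic and limits on T^n are taken modulo Z^n.\<close>

definition lattice :: "(real^'n) set" where
  "lattice = {k. \<forall>i. k $ i \<in> \<int>}"

text \<open>Gradient of a real function on R^n (meaningful where it is differentiable).\<close>
definition grad :: "(real^'n \<Rightarrow> real) \<Rightarrow> real^'n \<Rightarrow> real^'n" where
  "grad f x = (SOME g. (f has_derivative (\<lambda>w. g \<bullet> w)) (at x))"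

definition C2 :: "('a::euclidean_space \<Rightarrow> real) \<Rightarrow> bool" where
  "C2 f \<longleftrightarrow> (\<exists>D1 D2. (\<forall>z. (f has_derivative blinfun_apply (D1 z)) (at z)) \<and>
                      (\<forall>z. (D1 has_derivative blinfun_apply (D2 z)) (at z)) \<and>
                      continuous_on UNIV D2)"

definition tonelli :: "(real^'n \<Rightarrow> real^'n \<Rightarrow> real) \<Rightarrow> bool" where
  "tonelli H \<longleftrightarrow>
     (\<forall>x p k. k \<in> lattice \<longrightarrow> H (x + k) p = H x p) \<and>
     C2 (\<lambda>z. H (fst z) (snd z)) \<and>
     (\<forall>x p w. w \<noteq> 0 \<longrightarrow> frechet_derivative (grad (H x)) (at p) w \<bullet> w > 0) \<and>
     (\<forall>M. \<exists>R. \<forall>x p. R \<le> norm p \<longrightarrow> M * norm p \<le> H x p)"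

definition Lag :: "(real^'n \<Rightarrow> real^'n \<Rightarrow> real) \<Rightarrow> real^'n \<Rightarrow> real^'n \<Rightarrow> real" where
  "Lag H x \<xi> = (SUP p. \<xi> \<bullet> p - H x p)"

definition C1_fun :: "(real^'n \<Rightarrow> real) \<Rightarrow> bool" where
  "C1_fun \<phi> \<longleftrightarrow> (\<exists>g. continuous_on UNIV g \<and> (\<forall>y. (\<phi> has_derivative (\<lambda>w. g y \<bullet> w)) (at y)))"

definition viscosity_solution ::
  "(real^'n \<Rightarrow> real^'n \<Rightarrow> real) \<Rightarrow> real^'n \<Rightarrow> real \<Rightarrow> (real^'n \<Rightarrow> real) \<Rightarrow> bool" where
  "viscosity_solution H c a v \<longleftrightarrow>
     continuous_on UNIV v \<and> (\<forall>x k. k \<in> lattice \<longrightarrow> v (x + k) = v x) \<and>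
     (\<forall>\<phi> x. C1_fun \<phi> \<and> (\<forall>\<^sub>F y in at x. v y - \<phi> y \<le> v x - \<phi> x)
         \<longrightarrow> H x (c + grad \<phi> x) \<le> a) \<and>
     (\<forall>\<phi> x. C1_fun \<phi> \<and> (\<forall>\<^sub>F y in at x. v y - \<phi> y \<ge> v x - \<phi> x)
         \<longrightarrow> H x (c + grad \<phi> x) \<ge> a)"

definition crit_value :: "(real^'n \<Rightarrow> real^'n \<Rightarrow> real) \<Rightarrow> real^'n \<Rightarrow> real" where
  "crit_value H c = (THE a. \<exists>v. viscosity_solution H c a v)"

definition abs_cont_on :: "real \<Rightarrow> real \<Rightarrow> (real \<Rightarrow> 'a::real_normed_vector) \<Rightarrow> bool" where
  "abs_cont_on a b f \<longleftrightarrow>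
     (\<forall>\<epsilon>>0. \<exists>\<delta>>0. \<forall>D. finite D \<and> (\<forall>(s,t)\<in>D. a \<le> s \<and> s \<le> t \<and> t \<le> b) \<and>
        disjoint_family_on (\<lambda>(s,t). {s<..<t}) D \<and> (\<Sum>(s,t)\<in>D. t - s) < \<delta>
        \<longrightarrow> (\<Sum>(s,t)\<in>D. norm (f t - f s)) < \<epsilon>)"

definition admissible :: "(real^'n \<Rightarrow> real^'n \<Rightarrow> real) \<Rightarrow> real \<Rightarrow> (real \<Rightarrow> real^'n) \<Rightarrow> bool" where
  "admissible H T \<gamma> \<longleftrightarrow> abs_cont_on (-T) 0 \<gamma> \<and>
     (\<lambda>s. Lag H (\<gamma> s) (vector_derivative \<gamma> (at s))) integrable_on {-T..0}"

definition action ::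
  "(real^'n \<Rightarrow> real^'n \<Rightarrow> real) \<Rightarrow> real^'n \<Rightarrow> real \<Rightarrow> (real \<Rightarrow> real^'n) \<Rightarrow> real" where
  "action H c T \<gamma> = integral {-T..0}
     (\<lambda>s. Lag H (\<gamma> s) (vector_derivative \<gamma> (at s)) - c \<bullet> vector_derivative \<gamma> (at s)
          + crit_value H c)"

definition minimizing_curve ::
  "(real^'n \<Rightarrow> real^'n \<Rightarrow> real) \<Rightarrow> real^'n \<Rightarrow> (real^'n \<Rightarrow> real) \<Rightarrow> real^'n \<Rightarrow> (real \<Rightarrow> real^'n) \<Rightarrow> bool" where
  "minimizing_curve H c v x \<gamma> \<longleftrightarrow> \<gamma> 0 = x \<and>
     (\<forall>T>0. admissible H T \<gamma> \<and>
        (\<forall>\<eta>. admissible H T \<eta> \<and> \<eta> 0 = x \<longrightarrow>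
              action H c T \<gamma> + v (\<gamma> (-T)) \<le> action H c T \<eta> + v (\<eta> (-T))))"

definition torus_alpha_limits :: "(real \<Rightarrow> real^'n) \<Rightarrow> (real^'n) set" where
  "torus_alpha_limits \<gamma> = {y. \<exists>\<tau> k. filterlim \<tau> at_bot sequentially \<and> (\<forall>j. k j \<in> lattice) \<and>
       (\<lambda>j. \<gamma> (\<tau> j) + k j) \<longlonglongrightarrow> y}"

definition phase_alpha_limits :: "(real \<Rightarrow> (real^'n) \<times> (real^'n)) \<Rightarrow> ((real^'n) \<times> (real^'n)) set" where
  "phase_alpha_limits f = {z. \<exists>\<tau> k. filterlim \<tau> at_bot sequentially \<and> (\<forall>j. k j \<in> lattice) \<and>
       (\<lambda>j. (fst (f (\<tau> j)) + k j, snd (f (\<tau> j)))) \<longlonglongrightarrow> z}"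

definition M_alpha :: "(real^'n \<Rightarrow> real^'n \<Rightarrow> real) \<Rightarrow> real^'n \<Rightarrow> (real^'n \<Rightarrow> real) \<Rightarrow> (real^'n) set" where
  "M_alpha H c v = closure (\<Union> {torus_alpha_limits \<gamma> | \<gamma> x. minimizing_curve H c v x \<gamma>})"

definition Mt_alpha :: "(real^'n \<Rightarrow> real^'n \<Rightarrow> real) \<Rightarrow> real^'n \<Rightarrow> (real^'n \<Rightarrow> real) \<Rightarrow> ((real^'n) \<times> (real^'n)) set" where
  "Mt_alpha H c v = {(x, grad (H x) (c + grad v x)) | x. x \<in> M_alpha H c v}"

definition Mstar_alpha :: "(real^'n \<Rightarrow> real^'n \<Rightarrow> real) \<Rightarrow> real^'n \<Rightarrow> (real^'n \<Rightarrow> real) \<Rightarrow> ((real^'n) \<times> (real^'n)) set" where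
  "Mstar_alpha H c v = {(x, c + grad v x) | x. x \<in> M_alpha H c v}"

definition graph_grad :: "real^'n \<Rightarrow> (real^'n \<Rightarrow> real) \<Rightarrow> ((real^'n) \<times> (real^'n)) set" where
  "graph_grad c v = {(x, c + grad v x) | x. v differentiable (at x)}"

definition EL_solution :: "(real^'n \<Rightarrow> real^'n \<Rightarrow> real) \<Rightarrow> (real \<Rightarrow> real^'n) \<Rightarrow> (real \<Rightarrow> real^'n) \<Rightarrow> bool" where
  "EL_solution H \<gamma> d\<gamma> \<longleftrightarrow> (\<forall>s. (\<gamma> has_vector_derivative d\<gamma> s) (at s)) \<and>
     (\<forall>s. ((\<lambda>t. grad (Lag H (\<gamma> t)) (d\<gamma> t)) has_vector_derivative
            grad (\<lambda>y. Lag H y (d\<gamma> s)) (\<gamma> s)) (at s))"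

definition phiL :: "(real^'n \<Rightarrow> real^'n \<Rightarrow> real) \<Rightarrow> real \<Rightarrow> (real^'n) \<times> (real^'n) \<Rightarrow> (real^'n) \<times> (real^'n)" where
  "phiL H s z = (THE w. \<exists>\<gamma> d\<gamma>. EL_solution H \<gamma> d\<gamma> \<and> \<gamma> 0 = fst z \<and> d\<gamma> 0 = snd z \<and> w = (\<gamma> s, d\<gamma> s))"

definition Ham_solution :: "(real^'n \<Rightarrow> real^'n \<Rightarrow> real) \<Rightarrow> (real \<Rightarrow> real^'n) \<Rightarrow> (real \<Rightarrow> real^'n) \<Rightarrow> bool" where
  "Ham_solution H X P \<longleftrightarrow>
     (\<forall>s. (X has_vector_derivative grad (H (X s)) (P s)) (at s) \<and>
          (P has_vector_derivative - grad (\<lambda>y. H y (P s)) (X s)) (at s))"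

definition phiH :: "(real^'n \<Rightarrow> real^'n \<Rightarrow> real) \<Rightarrow> real \<Rightarrow> (real^'n) \<times> (real^'n) \<Rightarrow> (real^'n) \<times> (real^'n)" where
  "phiH H s z = (THE w. \<exists>X P. Ham_solution H X P \<and> X 0 = fst z \<and> P 0 = snd z \<and> w = (X s, P s))"

end

theory Submission
  imports Defs "HOL-Complex_Analysis.Great_Picard"
begin

text \<open>
  Freeze the base point of the Lagrangian and compare \<open>v\<close> with \<open>v y + t * ell y ((x - y) / t)\<close>,
  where \<open>ell x \<xi> = Lag H x \<xi> - c \<bullet> \<xi> + a\<close> and \<open>a\<close> is the critical value. The \<open>t\<close>-derivative of this
  expression is \<open>a - H\<close> at the Legendre dual momentum, so the viscosity inequalities bound the extrema in
  \<open>x\<close>, respectively \<open>y\<close>, up to \<open>O(t\<^sup>2)\<close>. The upper bound shows that \<open>v\<close> grows along any absolutely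
  continuous curve by at most its action; by the lower bound, chains of optimal steps exist, and their limits
  are calibrated curves, along which equality holds.

  Perturbing a calibrated curve with one or the other endpoint held fixed gives first-order upper and lower
  supports of \<open>v\<close> at interior points. Hence \<open>v\<close> is differentiable there and the curve follows the
  Hamiltonian flow through \<open>(x, c + grad v x)\<close>. Calibration passes to limits of flow orbits, so every phase
  \<open>\<alpha>\<close>-limit point lies on an orbit calibrated for all times, and the closure defining \<open>M_alpha\<close> inherits this.
\<close>

section \<open>Absolutely continuous functions\<close>

text \<open>The viscosity inequalities are all that is given about \<open>v\<close>: Lipschitz
  continuity, the variational formula and differentiability on the limit sets must be extracted from
  them. The quadratic error is harmless: it vanishes after division by the step in a derivative
  along a curve, and over a chain with step h it sums to order h.

  The other obstacle is regularity. Competitors are merely absolutely continuous and the action is a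
  gauge integral of a pointwise derivative, so differentiability almost everywhere and the
  fundamental theorem come first. Calibrated curves start from the same low regularity, but once
  they are known to be projections of Hamiltonian orbits, only orbits are handled. For an orbit,
  calibration is an equation between continuous functions of the initial point; energy at most
  \<open>a\<close> confines momenta to a ball, and positions are compact modulo the lattice. This is
  the compactness behind the limits of orbits.\<close>

lemma abs_cont_onD:
  assumes "abs_cont_on a b f" "\<epsilon> > 0"
  obtains \<delta> where "\<delta> > 0"
    "\<And>D. finite D \<Longrightarrow> (\<And>s t. (s,t) \<in> D \<Longrightarrow> a \<le> s \<and> s \<le> t \<and> t \<le> b) \<Longrightarrow>
       disjoint_family_on (\<lambda>(s,t). {s<..<t}) D \<Longrightarrow> (\<Sum>(s,t)\<in>D. t - s) < \<delta> \<Longrightarrow>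
       (\<Sum>(s,t)\<in>D. norm (f t - f s)) < \<epsilon>"
proof -
  obtain \<delta> where "\<delta> > 0" and \<delta>: "\<forall>D. finite D \<and> (\<forall>(s,t)\<in>D. a \<le> s \<and> s \<le> t \<and> t \<le> b) \<and>
        disjoint_family_on (\<lambda>(s,t). {s<..<t}) D \<and> (\<Sum>(s,t)\<in>D. t - s) < \<delta>
        \<longrightarrow> (\<Sum>(s,t)\<in>D. norm (f t - f s)) < \<epsilon>"
    using assms unfolding abs_cont_on_def by blast
  show ?thesis
    by (rule that[OF \<open>\<delta> > 0\<close>]) (use \<delta> in auto)
qed

lemma abs_cont_on_subinterval:
  assumes "abs_cont_on a b f" "a \<le> a'" "b' \<le> b"
  shows "abs_cont_on a' b' f"
  unfolding abs_cont_on_def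
proof (intro allI impI)
  fix \<epsilon> :: real assume "\<epsilon> > 0"
  then obtain \<delta> where "\<delta> > 0" and \<delta>: "\<And>D. finite D \<Longrightarrow> (\<And>s t. (s,t) \<in> D \<Longrightarrow> a \<le> s \<and> s \<le> t \<and> t \<le> b) \<Longrightarrow>
       disjoint_family_on (\<lambda>(s,t). {s<..<t}) D \<Longrightarrow> (\<Sum>(s,t)\<in>D. t - s) < \<delta> \<Longrightarrow>
       (\<Sum>(s,t)\<in>D. norm (f t - f s)) < \<epsilon>"
    using abs_cont_onD[OF assms(1)] by metis
  then show "\<exists>\<delta>>0. \<forall>D. finite D \<and> (\<forall>(s,t)\<in>D. a' \<le> s \<and> s \<le> t \<and> t \<le> b') \<and>
        disjoint_family_on (\<lambda>(s,t). {s<..<t}) D \<and> (\<Sum>(s,t)\<in>D. t - s) < \<delta>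
        \<longrightarrow> (\<Sum>(s,t)\<in>D. norm (f t - f s)) < \<epsilon>"
    using assms by (intro exI[of _ \<delta>] conjI allI impI \<delta> \<open>\<delta> > 0\<close>) fastforce+
qed

text \<open>The mixed bound covers all closure properties used later: Lipschitz functions
  (\<open>K = 0\<close>), Lipschitz images (\<open>M = 0\<close>), and the addition of an affine
  multiple of a fixed vector in \<open>calibrated_variation\<close>.\<close>

lemma abs_cont_on_dominated:
  assumes "abs_cont_on a b f"
    and "\<And>s t. a \<le> s \<Longrightarrow> s \<le> t \<Longrightarrow> t \<le> b \<Longrightarrow> norm (g t - g s) \<le> K * norm (f t - f s) + M * (t - s)"
    and "K \<ge> 0" "M \<ge> 0"
  shows "abs_cont_on a b g"
  unfolding abs_cont_on_def
proof (intro allI impI)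
  fix \<epsilon> :: real assume "\<epsilon> > 0"
  then have "\<epsilon> / (2 * (K + 1)) > 0" using \<open>K \<ge> 0\<close> by simp
  then obtain \<delta> where "\<delta> > 0" and \<delta>: "\<And>D. finite D \<Longrightarrow> (\<And>s t. (s,t) \<in> D \<Longrightarrow> a \<le> s \<and> s \<le> t \<and> t \<le> b) \<Longrightarrow>
       disjoint_family_on (\<lambda>(s,t). {s<..<t}) D \<Longrightarrow> (\<Sum>(s,t)\<in>D. t - s) < \<delta> \<Longrightarrow>
       (\<Sum>(s,t)\<in>D. norm (f t - f s)) < \<epsilon> / (2 * (K + 1))"
    using abs_cont_onD[OF assms(1)] by metis
  define \<delta>' where "\<delta>' = min \<delta> (\<epsilon> / (2 * (M + 1)))"
  have "\<delta>' > 0" using \<open>\<delta> > 0\<close> \<open>\<epsilon> > 0\<close> \<open>M \<ge> 0\<close> by (simp add: \<delta>'_def)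
  have "(\<Sum>(s,t)\<in>D. norm (g t - g s)) < \<epsilon>"
    if D: "finite D" "\<forall>(s,t)\<in>D. a \<le> s \<and> s \<le> t \<and> t \<le> b"
      "disjoint_family_on (\<lambda>(s,t). {s<..<t}) D" "(\<Sum>(s,t)\<in>D. t - s) < \<delta>'" for D
  proof -
    have 1: "(\<Sum>(s,t)\<in>D. norm (f t - f s)) < \<epsilon> / (2 * (K + 1))"
      by (rule \<delta>) (use D in \<open>auto simp: \<delta>'_def\<close>)
    have "(\<Sum>(s,t)\<in>D. norm (g t - g s)) \<le> (\<Sum>(s,t)\<in>D. K * norm (f t - f s) + M * (t - s))"
      by (rule sum_mono) (use D assms(2) in auto)
    also have "\<dots> = K * (\<Sum>(s,t)\<in>D. norm (f t - f s)) + M * (\<Sum>(s,t)\<in>D. t - s)"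
      by (simp add: sum_distrib_left sum.distrib case_prod_beta)
    also have "\<dots> \<le> K * (\<epsilon> / (2 * (K + 1))) + M * (\<epsilon> / (2 * (M + 1)))"
      using 1 D(4) assms(3,4) by (intro add_mono mult_left_mono) (auto simp: \<delta>'_def)
    also have "\<dots> < (K + 1) * (\<epsilon> / (2 * (K + 1))) + (M + 1) * (\<epsilon> / (2 * (M + 1)))"
      using \<open>\<epsilon> > 0\<close> assms(3,4) by (intro add_strict_mono mult_strict_right_mono) auto
    also have "\<dots> = \<epsilon> / 2 + \<epsilon> / 2" using assms(3,4) by (intro arg_cong2[where f = "(+)"]) (simp_all add: field_simps)
    also have "\<dots> = \<epsilon>" by simp
    finally show ?thesis .
  qed
  then show "\<exists>\<delta>>0. \<forall>D. finite D \<and> (\<forall>(s,t)\<in>D. a \<le> s \<and> s \<le> t \<and> t \<le> b) \<and>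
        disjoint_family_on (\<lambda>(s,t). {s<..<t}) D \<and> (\<Sum>(s,t)\<in>D. t - s) < \<delta>
        \<longrightarrow> (\<Sum>(s,t)\<in>D. norm (g t - g s)) < \<epsilon>"
    using \<open>\<delta>' > 0\<close> by blast
qed

lemma abs_cont_on_const: "abs_cont_on a b (\<lambda>t. k)"
  unfolding abs_cont_on_def by (auto simp: case_prod_beta intro: exI[of _ 1])

lemma abs_cont_on_lipschitz:
  assumes "\<And>s t. a \<le> s \<Longrightarrow> s \<le> t \<Longrightarrow> t \<le> b \<Longrightarrow> norm (g t - g s) \<le> M * (t - s)" "M \<ge> 0"
  shows "abs_cont_on a b g"
  by (rule abs_cont_on_dominated[OF abs_cont_on_const[of a b "0::real"], of _ 0 M]) (use assms in auto)

lemma abs_cont_on_compose_lipschitz: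
  assumes "abs_cont_on a b f" "K-lipschitz_on UNIV g"
  shows "abs_cont_on a b (\<lambda>t. g (f t))"
  by (rule abs_cont_on_dominated[OF assms(1), of _ K 0])
     (use assms lipschitz_on_normD[OF assms(2)] lipschitz_on_nonneg[OF assms(2)] in auto)

lemma abs_cont_on_continuous:
  assumes "abs_cont_on a b f"
  shows "continuous_on {a..b} f"
proof (subst continuous_on_iff, intro ballI allI impI)
  fix x e :: real assume x: "x \<in> {a..b}" and "e > 0"
  then obtain \<delta> where "\<delta> > 0" and \<delta>: "\<And>D. finite D \<Longrightarrow> (\<And>s t. (s,t) \<in> D \<Longrightarrow> a \<le> s \<and> s \<le> t \<and> t \<le> b) \<Longrightarrow>
       disjoint_family_on (\<lambda>(s,t). {s<..<t}) D \<Longrightarrow> (\<Sum>(s,t)\<in>D. t - s) < \<delta> \<Longrightarrow>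
       (\<Sum>(s,t)\<in>D. norm (f t - f s)) < e"
    using abs_cont_onD[OF assms] by metis
  have "dist (f y) (f x) < e" if y: "y \<in> {a..b}" "dist y x < \<delta>" for y
  proof (cases "x \<le> y")
    case True
    have "(\<Sum>(s,t)\<in>{(x,y)}. norm (f t - f s)) < e"
      by (rule \<delta>) (use x y True in \<open>auto simp: disjoint_family_on_def dist_real_def\<close>)
    then show ?thesis by (simp add: dist_norm)
  next
    case False
    have "(\<Sum>(s,t)\<in>{(y,x)}. norm (f t - f s)) < e"
      by (rule \<delta>) (use x y False in \<open>auto simp: disjoint_family_on_def dist_real_def\<close>)
    then show ?thesis by (simp add: dist_norm norm_minus_commute)
  qed
  then show "\<exists>d>0. \<forall>x'\<in>{a..b}. dist x' x < d \<longrightarrow> dist (f x') (f x) < e"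
    using \<open>\<delta> > 0\<close> by blast
qed

text \<open>The gaps are collected by splitting off the leftmost interval. Gaps at the two ends may
  be degenerate, hence only \<open>s \<le> t\<close> in \<open>Q\<close>. The sum telescopes for
  every \<open>g\<close>, and the quantifier over \<open>g\<close> stands inside, so that the same
  \<open>Q\<close> serves for increments of \<open>f\<close> and for lengths.\<close>

lemma complement_of_disjoint_intervals:
  fixes D :: "(real \<times> real) set"
  assumes "finite D" "u \<le> w" "\<And>s t. (s,t) \<in> D \<Longrightarrow> u \<le> s \<and> s < t \<and> t \<le> w"
    and "disjoint_family_on (\<lambda>(s,t). {s..t}) D"
  shows "\<exists>Q. finite Q \<and> (\<forall>(s,t)\<in>Q. u \<le> s \<and> s \<le> t \<and> t \<le> w) \<and>
     disjoint_family_on (\<lambda>(s,t). {s<..<t}) Q \<and>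
     (\<forall>g::real \<Rightarrow> real. g w - g u = (\<Sum>(s,t)\<in>D. g t - g s) + (\<Sum>(s,t)\<in>Q. g t - g s))"
  using assms
proof (induction "card D" arbitrary: D u)
  case 0
  then have "D = {}" by simp
  then show ?case
    using 0 by (intro exI[of _ "{(u,w)}"]) (auto simp: disjoint_family_on_def)
next
  case (Suc n)
  then have "D \<noteq> {}" "finite (fst ` D)" by auto
  then have "Min (fst ` D) \<in> fst ` D" by (intro Min_in) auto
  then obtain s t where st: "(s,t) \<in> D" "s = Min (fst ` D)" by auto
  have smin: "s \<le> s'" if "(s',t') \<in> D" for s' t'
    using st \<open>finite (fst ` D)\<close> that by (auto intro!: Min_le) force
  have ust: "u \<le> s" "s < t" "t \<le> w" using Suc.prems(3)[OF st(1)] by auto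
  define E where "E = D - {(s,t)}"
  have E: "t \<le> s' \<and> s' < t' \<and> t' \<le> w" if "(s',t') \<in> E" for s' t'
  proof -
    have "{s'..t'} \<inter> {s..t} = {}"
      using Suc.prems(4) st(1) that unfolding disjoint_family_on_def E_def by fastforce
    moreover have "s \<le> s'" "s' < t'" "t' \<le> w" using smin Suc.prems(3) that unfolding E_def by blast+
    ultimately show ?thesis by auto
  qed
  have "disjoint_family_on (\<lambda>(s,t). {s..t}) E"
    using Suc.prems(4) by (auto simp: disjoint_family_on_def E_def)
  moreover have "n = card E" "finite E" using Suc.hyps(2) Suc.prems(1) st by (auto simp: E_def)
  ultimately obtain Q where Q: "finite Q" "\<forall>(s,t')\<in>Q. t \<le> s \<and> s \<le> t' \<and> t' \<le> w"
    "disjoint_family_on (\<lambda>(s,t). {s<..<t}) Q"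
    "\<forall>g::real \<Rightarrow> real. g w - g t = (\<Sum>(s,t)\<in>E. g t - g s) + (\<Sum>(s,t)\<in>Q. g t - g s)"
    using Suc.hyps(1)[of E t] E ust by blast
  have notin: "(u,s) \<notin> Q" using Q(2) ust by auto
  have "disjoint_family_on (\<lambda>(s,t). {s<..<t}) (insert (u,s) Q)"
    using Q(2,3) ust unfolding disjoint_family_on_def by fastforce
  moreover have "g w - g u = (\<Sum>(s,t)\<in>D. g t - g s) + (\<Sum>(s,t)\<in>insert (u,s) Q. g t - g s)" for g :: "real \<Rightarrow> real"
  proof -
    have "(\<Sum>(s,t)\<in>D. g t - g s) = (g t - g s) + (\<Sum>(s,t)\<in>E. g t - g s)"
      unfolding E_def using st Suc.prems(1) by (subst sum.remove[of _ "(s,t)"]) auto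
    then show ?thesis using Q(4)[rule_format, of g] Q(1) notin by simp
  qed
  moreover have "finite (insert (u,s) Q)" "\<forall>(s,t)\<in>insert (u,s) Q. u \<le> s \<and> s \<le> t \<and> t \<le> w"
    using Q(1,2) ust by auto
  ultimately show ?case by blast
qed

text \<open>The Vitali theorem gives countably many disjoint closed intervals that exhaust
  \<open>E\<close> up to a null set; finitely many of them miss only measure
  \<open>\<epsilon>\<close>. The conclusion can use open intervals because finitely many endpoints
  are null.\<close>

lemma Vitali_intervals_finite:
  fixes E W :: "real set" and \<K> :: "(real \<times> real) set"
  assumes E: "E \<in> lmeasurable" and W: "open W" "E \<subseteq> W" and "\<epsilon> > 0"
    and lt: "\<And>u w. (u,w) \<in> \<K> \<Longrightarrow> u < w"
    and fine: "\<And>x d. x \<in> E \<Longrightarrow> d > 0 \<Longrightarrow> \<exists>u w. (u,w) \<in> \<K> \<and> u < x \<and> x < w \<and> w - u < d"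
  obtains D where "finite D" "D \<subseteq> \<K>" "disjoint_family_on (\<lambda>(s,t). {s..t}) D"
    "\<And>s t. (s,t) \<in> D \<Longrightarrow> {s..t} \<subseteq> W" "measure lebesgue E \<le> (\<Sum>(s,t)\<in>D. measure lebesgue (E \<inter> {s<..<t})) + \<epsilon>"
proof -
  define K where "K = {(u,w) \<in> \<K>. {u..w} \<subseteq> W}"
  define ce where "ce = (\<lambda>(u::real,w). (u + w) / 2)"
  define r where "r = (\<lambda>(u::real,w). (w - u) / 2)"
  have cb: "cball (ce i) (r i) = (case i of (s,t) \<Rightarrow> {s..t})" if "i \<in> K" for i
    using that lt by (auto simp: K_def ce_def r_def cball_eq_atLeastAtMost field_simps)
  have fineK: "\<exists>i. i \<in> K \<and> x \<in> cball (ce i) (r i) \<and> r i < d" if "x \<in> E" "d > 0" for x d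
  proof -
    obtain e where e: "e > 0" "ball x e \<subseteq> W" using W \<open>x \<in> E\<close> by (meson openE subsetD)
    obtain u w where uw: "(u,w) \<in> \<K>" "u < x" "x < w" "w - u < min d e"
      using fine[of x "min d e"] \<open>x \<in> E\<close> \<open>d > 0\<close> e by auto
    have "{u..w} \<subseteq> ball x e" using uw by (auto simp: dist_real_def)
    then have "(u,w) \<in> K" using uw e by (auto simp: K_def)
    then show ?thesis using uw cb[of "(u,w)"] by (intro exI[of _ "(u,w)"]) (auto simp: r_def)
  qed
  have rpos: "0 < r i" if "i \<in> K" for i using that lt by (auto simp: K_def r_def)
  obtain C where C: "countable C" "C \<subseteq> K"
     "pairwise (\<lambda>i j. disjnt (cball (ce i) (r i)) (cball (ce j) (r j))) C"
     "negligible (E - (\<Union>i \<in> C. cball (ce i) (r i)))"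
    by (rule Vitali_covering_theorem_cballs[of K r E ce, OF rpos fineK])
  define I where "I = (\<lambda>(s::real,t). {s..t})"
  have neg: "negligible (E - (\<Union>i\<in>C. I i))"
  proof -
    have "(\<Union>i \<in> C. cball (ce i) (r i)) = (\<Union>i\<in>C. I i)"
      using cb C(2) by (auto simp: I_def subset_iff)
    then show ?thesis using C(4) by simp
  qed
  have disj: "disjoint_family_on I C"
    using C(2,3) cb unfolding disjoint_family_on_def pairwise_def disjnt_def I_def by (metis subsetD)
  have meas: "I i \<in> lmeasurable" for i by (cases i) (simp add: I_def)
  have "\<exists>D. finite D \<and> D \<subseteq> C \<and> measure lebesgue (E - (\<Union>i\<in>D. I i)) < \<epsilon>"
  proof (cases "C = {}")
    case True
    then show ?thesis using neg \<open>\<epsilon> > 0\<close> by (auto intro!: exI[of _ "{}"] simp: negligible_imp_measure0)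
  next
    case False
    \<comment> \<open>What remains of \<open>E\<close> after the first \<open>n\<close> intervals.
      These sets decrease to a null set and have finite measure, so their measures tend to
      zero.\<close>
    define A where "A n = E - (\<Union>i\<in>from_nat_into C ` {..<n}. I i)" for n :: nat
    have Am: "A n \<in> lmeasurable" for n
      unfolding A_def using E meas by (intro fmeasurable.Diff fmeasurable.finite_UN) auto
    have "decseq A" by (auto simp: A_def decseq_def)
    moreover have "range A \<subseteq> sets lebesgue" using Am by (auto dest: fmeasurableD)
    ultimately have "(\<lambda>n. measure lebesgue (A n)) \<longlonglongrightarrow> measure lebesgue (\<Inter>n. A n)"
      using fmeasurableD2[OF Am] by (intro Lim_measure_decseq) (auto simp del: emeasure_completion)
    moreover have "(\<Inter>n. A n) \<subseteq> E - (\<Union>i\<in>C. I i)"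
    proof
      fix x assume x: "x \<in> (\<Inter>n. A n)"
      have "x \<notin> I i" if "i \<in> C" for i
      proof -
        obtain n where "i = from_nat_into C n" using from_nat_into_surj[OF C(1) \<open>i \<in> C\<close>] by metis
        moreover have "x \<in> A (Suc n)" using x by auto
        ultimately show ?thesis by (auto simp: A_def)
      qed
      moreover have "x \<in> E" using x by (auto simp: A_def)
      ultimately show "x \<in> E - (\<Union>i\<in>C. I i)" by auto
    qed
    then have "measure lebesgue (\<Inter>n. A n) = 0"
      using neg negligible_subset negligible_imp_measure0 by blast
    ultimately have "\<forall>\<^sub>F n in sequentially. measure lebesgue (A n) < \<epsilon>"
      using \<open>\<epsilon> > 0\<close> by (simp add: order_tendstoD(2))
    then obtain n where "measure lebesgue (A n) < \<epsilon>" by (auto simp: eventually_sequentially)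
    then show ?thesis
      using from_nat_into[OF False] by (intro exI[of _ "from_nat_into C ` {..<n}"]) (auto simp: A_def image_subset_iff)
  qed
  then obtain D where D: "finite D" "D \<subseteq> C" "measure lebesgue (E - (\<Union>i\<in>D. I i)) < \<epsilon>" by auto
  have dD: "disjoint_family_on I D" by (rule disjoint_family_on_mono[OF D(2) disj])
  define J where "J = (\<lambda>(s::real,t). E \<inter> {s<..<t})"
  have J: "J i \<in> lmeasurable" for i by (cases i) (auto simp: J_def intro: E fmeasurable.Int)
  \<comment> \<open>The endpoints, which are lost when closed intervals are replaced by open
    ones.\<close>
  define P where "P = fst ` D \<union> snd ` D"
  have P: "negligible P" using D(1) by (intro negligible_finite) (auto simp: P_def)
  have ED: "E - (\<Union>i\<in>D. I i) \<in> lmeasurable"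
    using E D(1) meas by (intro fmeasurable.Diff fmeasurable.finite_UN) auto
  have U: "(\<Union>i\<in>D. J i) \<in> lmeasurable" using D(1) J by (intro fmeasurable.finite_UN) auto
  have Pm: "P \<in> lmeasurable" "measure lebesgue P = 0"
    using P negligible_imp_measurable negligible_imp_measure0 by auto
  have "measure lebesgue E \<le> measure lebesgue ((\<Union>i\<in>D. J i) \<union> (E - (\<Union>i\<in>D. I i)) \<union> P)"
  proof (rule measure_mono_fmeasurable)
    show "E \<subseteq> (\<Union>i\<in>D. J i) \<union> (E - (\<Union>i\<in>D. I i)) \<union> P"
      by (force simp: J_def I_def P_def less_le image_iff)
  qed (use E U ED Pm in \<open>auto dest: fmeasurableD\<close>)
  also have "\<dots> \<le> measure lebesgue ((\<Union>i\<in>D. J i) \<union> (E - (\<Union>i\<in>D. I i))) + measure lebesgue P"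
    by (intro measure_Un_le) (use U ED Pm in \<open>auto dest: fmeasurableD\<close>)
  also have "\<dots> \<le> measure lebesgue (\<Union>i\<in>D. J i) + measure lebesgue (E - (\<Union>i\<in>D. I i)) + measure lebesgue P"
    by (intro add_right_mono measure_Un_le) (use U ED in \<open>auto dest: fmeasurableD\<close>)
  also have "measure lebesgue (\<Union>i\<in>D. J i) \<le> (\<Sum>i\<in>D. measure lebesgue (J i))"
    by (intro measure_UNION_le) (use D(1) J in \<open>auto dest: fmeasurableD\<close>)
  finally have "measure lebesgue E \<le> (\<Sum>i\<in>D. measure lebesgue (J i)) + \<epsilon>" using D(3) Pm by simp
  then have "measure lebesgue E \<le> (\<Sum>(s,t)\<in>D. measure lebesgue (E \<inter> {s<..<t})) + \<epsilon>"
    by (simp add: J_def case_prod_beta)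
  then show ?thesis
    using D(1,2) C(2) dD by (intro that[of D]) (auto simp: K_def I_def)
qed

section \<open>Null sets from incompatible or unbounded slopes\<close>

lemma measure_Int_interval_le:
  fixes s t :: real
  assumes "s \<le> t" "E \<in> sets lebesgue"
  shows "measure lebesgue (E \<inter> {s<..<t}) \<le> t - s"
proof -
  have "measure lebesgue (E \<inter> {s<..<t}) \<le> measure lebesgue {s<..<t}"
    by (rule measure_mono_fmeasurable) (use assms in auto)
  then show ?thesis using assms by simp
qed

lemma sum_disjoint_intervals_le:
  fixes D :: "(real \<times> real) set"
  assumes "finite D" "\<And>s t. (s,t) \<in> D \<Longrightarrow> s \<le> t \<and> {s<..<t} \<subseteq> W" "W \<in> lmeasurable"
    "disjoint_family_on (\<lambda>(s,t). {s<..<t}) D"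
  shows "(\<Sum>(s,t)\<in>D. t - s) \<le> measure lebesgue W"
proof -
  define I where "I = (\<lambda>(s::real,t). {s<..<t})"
  have meas: "I i \<in> lmeasurable" for i by (cases i) (simp add: I_def)
  have "(\<Sum>(s,t)\<in>D. t - s) = (\<Sum>i\<in>D. measure lebesgue (I i))"
    by (rule sum.cong) (use assms in \<open>auto simp: I_def\<close>)
  also have "\<dots> = measure lebesgue (\<Union>i\<in>D. I i)"
    using assms(1,4) meas fmeasurableD2[OF meas]
    by (intro measure_finite_Union[symmetric]) (auto simp: I_def fmeasurableD simp del: emeasure_completion)
  also have "\<dots> \<le> measure lebesgue W"
  proof (rule measure_mono_fmeasurable)
    show "(\<Union>i\<in>D. I i) \<subseteq> W" using assms(2) by (fastforce simp: I_def)
    show "(\<Union>i\<in>D. I i) \<in> sets lebesgue"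
      using assms(1) meas by (intro sets.finite_UN) (auto dest: fmeasurableD)
  qed fact
  finally show ?thesis .
qed

text \<open>
  Vitali covers of \<open>E\<close> by intervals of slope at most \<open>p\<close> and of slope at least \<open>q\<close> both exhaust \<open>E\<close>; absolute
  continuity makes the increments over what is left small, which is incompatible with \<open>p < q\<close> unless
  \<open>E\<close> is null.
\<close>

lemma abs_cont_slope_gap_negligible:
  fixes f :: "real \<Rightarrow> real"
  assumes ac: "abs_cont_on a b f" and "p < q" and E: "E \<in> sets lebesgue" "E \<subseteq> {a<..<b}"
    and hi: "\<And>x d. x \<in> E \<Longrightarrow> d > 0 \<Longrightarrow>
       \<exists>u w. a \<le> u \<and> w \<le> b \<and> u < x \<and> x < w \<and> w - u < d \<and> q * (w - u) \<le> f w - f u"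
    and lo: "\<And>x d. x \<in> E \<Longrightarrow> d > 0 \<Longrightarrow>
       \<exists>u w. a \<le> u \<and> w \<le> b \<and> u < x \<and> x < w \<and> w - u < d \<and> f w - f u \<le> p * (w - u)"
  shows "negligible E"
proof -
  define \<mu> where "\<mu> = measure lebesgue E"
  have Em: "E \<in> lmeasurable" using E lmeasurable_interval(2)[of a b] by (metis fmeasurableI2)
  \<comment> \<open>Steep intervals are packed inside shallow ones. Both families have total length
    close to \<open>\<mu>\<close>, so the increment of \<open>f\<close> is at most about
    \<open>p * \<mu>\<close> on the one hand and at least about \<open>q * \<mu>\<close> on the
    other, up to the gaps between them.\<close>
  have bound: "(q - p) * \<mu> \<le> \<epsilon> * (1 + \<bar>p\<bar> + (q - p))" if "\<epsilon> > 0" for \<epsilon>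
  proof -
    obtain \<delta>0 where "\<delta>0 > 0" and \<delta>0: "\<And>D. finite D \<Longrightarrow> (\<And>s t. (s,t) \<in> D \<Longrightarrow> a \<le> s \<and> s \<le> t \<and> t \<le> b) \<Longrightarrow>
       disjoint_family_on (\<lambda>(s,t). {s<..<t}) D \<Longrightarrow> (\<Sum>(s,t)\<in>D. t - s) < \<delta>0 \<Longrightarrow>
       (\<Sum>(s,t)\<in>D. norm (f t - f s)) < \<epsilon>"
      using abs_cont_onD[OF ac \<open>\<epsilon> > 0\<close>] by metis
    define \<delta> where "\<delta> = min \<delta>0 \<epsilon>"
    have "\<delta> > 0" "\<delta> \<le> \<delta>0" "\<delta> \<le> \<epsilon>" using \<open>\<delta>0 > 0\<close> that by (auto simp: \<delta>_def)
    obtain W0 where W0: "open W0" "E \<subseteq> W0" "W0 - E \<in> lmeasurable" "emeasure lebesgue (W0 - E) < ennreal (\<delta> / 2)"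
      using sets_lebesgue_outer_open[OF E(1), of "\<delta> / 2"] \<open>\<delta> > 0\<close> by auto
    define W where "W = W0 \<inter> {a<..<b}"
    have W: "open W" "E \<subseteq> W" "W \<subseteq> {a<..<b}" using W0 E by (auto simp: W_def)
    have Wm: "W \<in> lmeasurable"
      using W(1,3) lmeasurable_interval(2)[of a b] by (metis fmeasurableI2 borel_open sets_completionI_sets sets_lborel)
    have "measure lebesgue (W - E) \<le> measure lebesgue (W0 - E)"
      using W0 Wm Em by (intro measure_mono_fmeasurable) (auto simp: W_def dest: fmeasurableD)
    also have "\<dots> < \<delta> / 2"
      using W0(3,4) \<open>\<delta> > 0\<close> by (metis emeasure_eq_measure2 ennreal_less_iff measure_nonneg)
    finally have Wle: "measure lebesgue W < \<mu> + \<delta> / 2"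
      using measurable_measure_Diff[OF Wm fmeasurableD[OF Em] W(2)] by (simp add: \<mu>_def)
    define Klo where "Klo = {(u,w). a \<le> u \<and> w \<le> b \<and> u < w \<and> f w - f u \<le> p * (w - u)}"
    define Khi where "Khi = {(u,w). a \<le> u \<and> w \<le> b \<and> u < w \<and> q * (w - u) \<le> f w - f u}"
    obtain D where D: "finite D" "D \<subseteq> Klo" "disjoint_family_on (\<lambda>(s,t). {s..t}) D"
      "\<And>s t. (s,t) \<in> D \<Longrightarrow> {s..t} \<subseteq> W"
      "\<mu> \<le> (\<Sum>(s,t)\<in>D. measure lebesgue (E \<inter> {s<..<t})) + \<delta> / 4"
    proof (rule Vitali_intervals_finite[OF Em W(1,2), of "\<delta> / 4" Klo])
      show "\<exists>u w. (u, w) \<in> Klo \<and> u < x \<and> x < w \<and> w - u < d" if "x \<in> E" "0 < d" for x d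
        using lo[OF that] unfolding Klo_def by fastforce
    qed (use \<open>\<delta> > 0\<close> in \<open>auto simp: Klo_def \<mu>_def\<close>)
    \<comment> \<open>The tolerance \<open>\<delta> / 4\<close> shared among the intervals of
      \<open>D\<close>; the added 1 keeps the denominator positive when \<open>D\<close> is
      empty.\<close>
    define e where "e = \<delta> / (4 * (real (card D) + 1))"
    have "e > 0" using \<open>\<delta> > 0\<close> by (simp add: e_def)
    have "real (card D) * e \<le> (real (card D) + 1) * e" using \<open>e > 0\<close> by simp
    also have "\<dots> = \<delta> / 4" by (simp add: e_def field_simps)
    finally have ce: "real (card D) * e \<le> \<delta> / 4" .
    \<comment> \<open>\<open>D1\<close> holds the steep intervals chosen inside the shallow interval
      \<open>j\<close>, and \<open>Q\<close> the gaps they leave there. One predicate for all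
      conditions permits a simultaneous choice over \<open>j\<close>.\<close>
    define R where "R = (\<lambda>j D1 Q. finite D1 \<and> finite Q \<and> D1 \<subseteq> Khi \<and>
        measure lebesgue (E \<inter> {fst j<..<snd j}) \<le> (\<Sum>(s,t)\<in>D1. t - s) + e \<and>
        (\<forall>(s,t)\<in>Q. fst j \<le> s \<and> s \<le> t \<and> t \<le> snd j) \<and> disjoint_family_on (\<lambda>(s,t). {s<..<t}) Q \<and>
        (\<forall>g::real\<Rightarrow>real. g (snd j) - g (fst j) = (\<Sum>(s,t)\<in>D1. g t - g s) + (\<Sum>(s,t)\<in>Q. g t - g s)))"
    have "\<exists>D1 Q. R j D1 Q" if "j \<in> D" for j
    proof -
      obtain s t where j: "j = (s,t)" by (cases j)
      have "s < t" using that D(2) j by (auto simp: Klo_def)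
      obtain D1 where D1: "finite D1" "D1 \<subseteq> Khi" "disjoint_family_on (\<lambda>(s,t). {s..t}) D1"
        "\<And>s' t'. (s',t') \<in> D1 \<Longrightarrow> {s'..t'} \<subseteq> {s<..<t}"
        "measure lebesgue (E \<inter> {s<..<t}) \<le> (\<Sum>(s',t')\<in>D1. measure lebesgue (E \<inter> {s<..<t} \<inter> {s'<..<t'})) + e"
      proof (rule Vitali_intervals_finite[of "E \<inter> {s<..<t}" "{s<..<t}" e Khi])
        show "\<exists>u w. (u, w) \<in> Khi \<and> u < x \<and> x < w \<and> w - u < d" if "x \<in> E \<inter> {s<..<t}" "0 < d" for x d
          using hi[of x d] that unfolding Khi_def by fastforce
      qed (use \<open>e > 0\<close> Em in \<open>auto simp: Khi_def\<close>)
      have lt: "s' < t'" if "(s',t') \<in> D1" for s' t' using D1(2) that by (auto simp: Khi_def)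
      have "(\<Sum>(s',t')\<in>D1. measure lebesgue (E \<inter> {s<..<t} \<inter> {s'<..<t'})) \<le> (\<Sum>(s',t')\<in>D1. t' - s')"
      proof (rule sum_mono)
        fix i assume "i \<in> D1"
        then show "(case i of (s',t') \<Rightarrow> measure lebesgue (E \<inter> {s<..<t} \<inter> {s'<..<t'})) \<le> (case i of (s',t') \<Rightarrow> t' - s')"
          using lt[of "fst i" "snd i"] fmeasurableD[OF Em]
          by (auto simp: case_prod_beta intro!: measure_Int_interval_le)
      qed
      then have m: "measure lebesgue (E \<inter> {s<..<t}) \<le> (\<Sum>(s',t')\<in>D1. t' - s') + e"
        using D1(5) by linarith
      have "s \<le> s' \<and> s' < t' \<and> t' \<le> t" if "(s',t') \<in> D1" for s' t'
        using subsetD[OF D1(4)[OF that], of s'] subsetD[OF D1(4)[OF that], of t'] lt[OF that] by auto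
      from complement_of_disjoint_intervals[OF D1(1) less_imp_le[OF \<open>s < t\<close>] this D1(3)] obtain Q where
        "finite Q \<and> (\<forall>(s',t')\<in>Q. s \<le> s' \<and> s' \<le> t' \<and> t' \<le> t) \<and> disjoint_family_on (\<lambda>(s,t). {s<..<t}) Q \<and>
        (\<forall>g::real\<Rightarrow>real. g t - g s = (\<Sum>(s,t)\<in>D1. g t - g s) + (\<Sum>(s,t)\<in>Q. g t - g s))" by auto
      with m D1(1,2) have "R (s,t) D1 Q" unfolding R_def fst_conv snd_conv by blast
      then show ?thesis unfolding j by blast
    qed
    then have "\<forall>j\<in>D. \<exists>D1 Q. R j D1 Q" by blast
    then obtain D1 Q where "\<forall>j\<in>D. R j (D1 j) (Q j)" by metis
    then have Q: "R j (D1 j) (Q j)" if "j \<in> D" for j using that by blast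
    have DQ: "finite (D1 j) \<and> finite (Q j) \<and> D1 j \<subseteq> Khi \<and>
        measure lebesgue (E \<inter> {fst j<..<snd j}) \<le> (\<Sum>(s,t)\<in>D1 j. t - s) + e \<and>
        (\<forall>(s,t)\<in>Q j. fst j \<le> s \<and> s \<le> t \<and> t \<le> snd j) \<and> disjoint_family_on (\<lambda>(s,t). {s<..<t}) (Q j)"
      if "j \<in> D" for j
      using Q[OF that] unfolding R_def by blast
    have DQg: "g (snd j) - g (fst j) = (\<Sum>(s,t)\<in>D1 j. g t - g s) + (\<Sum>(s,t)\<in>Q j. g t - g s)"
      if "j \<in> D" for j and g :: "real \<Rightarrow> real"
      using Q[OF that] unfolding R_def by blast
    define S1 where "S1 = (\<Sum>j\<in>D. \<Sum>(s,t)\<in>D1 j. t - s)"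
    define S2 where "S2 = (\<Sum>(s,t)\<in>D. t - s)"
    have Dlt: "s < t" if "(s,t) \<in> D" for s t using D(2) that by (auto simp: Klo_def)
    have "S2 \<le> measure lebesgue W" unfolding S2_def
    proof (rule sum_disjoint_intervals_le)
      show "s \<le> t \<and> {s<..<t} \<subseteq> W" if "(s,t) \<in> D" for s t
        using Dlt[OF that] D(4)[OF that] by auto
      show "disjoint_family_on (\<lambda>(s,t). {s<..<t}) D"
        using D(3) unfolding disjoint_family_on_def by fastforce
    qed (use D Wm in auto)
    then have S2: "S2 < \<mu> + \<delta> / 2" using Wle by simp
    have "\<mu> - \<delta> / 4 \<le> (\<Sum>j\<in>D. measure lebesgue (E \<inter> {fst j<..<snd j}))"
      using D(5) by (simp add: case_prod_beta)
    also have "\<dots> \<le> (\<Sum>j\<in>D. (\<Sum>(s,t)\<in>D1 j. t - s) + e)"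
      by (rule sum_mono) (use DQ in blast)
    also have "\<dots> = S1 + real (card D) * e" by (simp add: sum.distrib S1_def)
    finally have S1: "\<mu> - \<delta> / 2 \<le> S1" using ce by simp
    \<comment> \<open>The increment identity for the identity function computes the total gap
      length. It is below \<open>\<delta>\<close>, since \<open>S2\<close> is less than
      \<open>\<mu> + \<delta> / 2\<close> and \<open>S1\<close> is at least
      \<open>\<mu> - \<delta> / 2\<close>.\<close>
    have SQ: "(\<Sum>j\<in>D. \<Sum>(s,t)\<in>Q j. t - s) = S2 - S1"
    proof -
      have "S2 = (\<Sum>j\<in>D. (\<Sum>(s,t)\<in>D1 j. t - s) + (\<Sum>(s,t)\<in>Q j. t - s))"
        unfolding S2_def case_prod_beta
        by (intro sum.cong refl DQg[of _ "\<lambda>x. x", unfolded case_prod_beta])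
      then show ?thesis by (simp add: sum.distrib S1_def)
    qed
    have Qin: "s \<in> {fst j..snd j}" "t \<in> {fst j..snd j}" "s \<le> t" if "j \<in> D" "(s,t) \<in> Q j" for j s t
      using DQ[OF that(1)] that(2) by fastforce+
    have Ddisj: "{fst i..snd i} \<inter> {fst j..snd j} = {}" if "i \<in> D" "j \<in> D" "i \<noteq> j" for i j
      using D(3) that unfolding disjoint_family_on_def case_prod_beta by blast
    have Qdisj: "Q i \<inter> Q j = {}" if "i \<in> D" "j \<in> D" "i \<noteq> j" for i j
      using Ddisj[OF that] Qin[OF that(1)] Qin[OF that(2)] by fastforce
    have sumQ: "(\<Sum>(s,t)\<in>(\<Union>j\<in>D. Q j). h s t) = (\<Sum>j\<in>D. \<Sum>(s,t)\<in>Q j. h s t)" for h :: "real \<Rightarrow> real \<Rightarrow> real"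
      by (rule sum.UNION_disjoint) (use D(1) DQ Qdisj in auto)
    have Qsmall: "(\<Sum>(s,t)\<in>(\<Union>j\<in>D. Q j). norm (f t - f s)) < \<epsilon>"
    proof (rule \<delta>0)
      show "finite (\<Union>j\<in>D. Q j)" using D(1) DQ by auto
      show "a \<le> s \<and> s \<le> t \<and> t \<le> b" if st: "(s,t) \<in> (\<Union>j\<in>D. Q j)" for s t
      proof -
        obtain j where j: "j \<in> D" "(s,t) \<in> Q j" using st by auto
        then have "{fst j..snd j} \<subseteq> {a<..<b}" using D(4)[of "fst j" "snd j"] W(3) by auto
        with Qin[OF j] show ?thesis by (metis greaterThanLessThan_iff less_imp_le subsetD)
      qed
      show "disjoint_family_on (\<lambda>(s,t). {s<..<t}) (\<Union>j\<in>D. Q j)"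
        unfolding disjoint_family_on_def
      proof (intro ballI impI)
        fix m n assume mn: "m \<in> (\<Union>j\<in>D. Q j)" "n \<in> (\<Union>j\<in>D. Q j)" "m \<noteq> n"
        then obtain i j where ij: "i \<in> D" "m \<in> Q i" "j \<in> D" "n \<in> Q j" by auto
        show "(case m of (s,t) \<Rightarrow> {s<..<t}) \<inter> (case n of (s,t) \<Rightarrow> {s<..<t}) = {}"
        proof (cases "i = j")
          case True
          then show ?thesis using DQ[OF ij(1)] ij mn(3) unfolding disjoint_family_on_def by blast
        next
          case False
          obtain s t s' t' where [simp]: "m = (s,t)" "n = (s',t')" by (cases m, cases n)
          have "{s<..<t} \<subseteq> {fst i..snd i}" "{s'<..<t'} \<subseteq> {fst j..snd j}"
            using Qin[of i s t] Qin[of j s' t'] ij by auto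
          then have "{s<..<t} \<inter> {s'<..<t'} = {}" using Ddisj[OF ij(1,3) False] by blast
          then show ?thesis by simp
        qed
      qed
      show "(\<Sum>(s,t)\<in>(\<Union>j\<in>D. Q j). t - s) < \<delta>0"
        unfolding sumQ SQ using S1 S2 \<open>\<delta> \<le> \<delta>0\<close> by simp
    qed
    have nonnegQ: "0 \<le> S2 - S1" unfolding SQ[symmetric]
      by (intro sum_nonneg) (use Qin in force)
    have "(\<Sum>j\<in>D. f (snd j) - f (fst j)) = (\<Sum>j\<in>D. \<Sum>(s,t)\<in>D1 j. f t - f s) + (\<Sum>j\<in>D. \<Sum>(s,t)\<in>Q j. f t - f s)"
      unfolding sum.distrib[symmetric] by (intro sum.cong refl DQg)
    moreover have "\<bar>\<Sum>j\<in>D. \<Sum>(s,t)\<in>Q j. f t - f s\<bar> \<le> \<epsilon>"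
    proof -
      have "\<bar>\<Sum>(s,t)\<in>(\<Union>j\<in>D. Q j). f t - f s\<bar> \<le> (\<Sum>(s,t)\<in>(\<Union>j\<in>D. Q j). norm (f t - f s))"
        unfolding case_prod_beta real_norm_def by (rule sum_abs)
      then show ?thesis using Qsmall unfolding sumQ by simp
    qed
    moreover have "(\<Sum>j\<in>D. f (snd j) - f (fst j)) \<le> p * S2"
      unfolding S2_def sum_distrib_left using D(2) by (intro sum_mono) (auto simp: Klo_def)
    moreover have "q * S1 \<le> (\<Sum>j\<in>D. \<Sum>(s,t)\<in>D1 j. f t - f s)"
      unfolding S1_def sum_distrib_left using DQ by (intro sum_mono) (fastforce simp: Khi_def)
    \<comment> \<open>Rearranged, \<open>(q - p) * S1\<close> is at most
      \<open>p * (S2 - S1) + \<epsilon>\<close>, where \<open>S2 - S1\<close> lies between 0 and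
      \<open>\<epsilon>\<close>.\<close>
    ultimately have "q * S1 - \<epsilon> \<le> p * S2" by simp
    moreover have "p * (S2 - S1) \<le> \<bar>p\<bar> * \<epsilon>"
    proof -
      have "p * (S2 - S1) \<le> \<bar>p\<bar> * (S2 - S1)" using nonnegQ by (intro mult_right_mono) auto
      also have "\<dots> \<le> \<bar>p\<bar> * \<epsilon>" using S1 S2 \<open>\<delta> \<le> \<epsilon>\<close> by (intro mult_left_mono) auto
      finally show ?thesis .
    qed
    moreover have "(q - p) * (\<mu> - \<epsilon>) \<le> (q - p) * S1"
      using S1 \<open>p < q\<close> \<open>\<delta> \<le> \<epsilon>\<close> \<open>\<epsilon> > 0\<close> by (intro mult_left_mono) auto
    ultimately show ?thesis by (simp add: algebra_simps)
  qed
  have "(q - p) * \<mu> \<le> 0"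
  proof (rule field_le_epsilon)
    fix e :: real assume "e > 0"
    define k where "k = 1 + \<bar>p\<bar> + (q - p)"
    have "k > 0" using \<open>p < q\<close> by (simp add: k_def)
    then show "(q - p) * \<mu> \<le> 0 + e"
      using bound[of "e / k"] \<open>e > 0\<close> unfolding k_def[symmetric] by simp
  qed
  then have "\<mu> \<le> 0" using \<open>p < q\<close> by (simp add: mult_le_0_iff)
  then have "measure lebesgue E = 0" using measure_nonneg[of lebesgue E] unfolding \<mu>_def by linarith
  then show ?thesis using Em by (simp add: negligible_iff_measure)
qed

text \<open>In a window of length \<open>\<delta> / 2\<close> a disjoint family has total length
  below \<open>\<delta>\<close>, so the increments of \<open>f\<close> over it sum to less than 1.
  If all its slopes are at least \<open>1 / \<epsilon>\<close> in absolute value, its total length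
  is below \<open>\<epsilon>\<close>. Windows starting at rational points cover the line.\<close>

lemma abs_cont_infinite_slope_negligible:
  fixes f :: "real \<Rightarrow> real"
  assumes ac: "abs_cont_on a b f" and E: "E \<in> sets lebesgue" "E \<subseteq> {a<..<b}"
    and hi: "\<And>x d M. x \<in> E \<Longrightarrow> d > 0 \<Longrightarrow>
       \<exists>u w. a \<le> u \<and> w \<le> b \<and> u < x \<and> x < w \<and> w - u < d \<and> M * (w - u) \<le> \<bar>f w - f u\<bar>"
  shows "negligible E"
proof -
  obtain \<delta> where "\<delta> > 0" and \<delta>: "\<And>D. finite D \<Longrightarrow> (\<And>s t. (s,t) \<in> D \<Longrightarrow> a \<le> s \<and> s \<le> t \<and> t \<le> b) \<Longrightarrow>
     disjoint_family_on (\<lambda>(s,t). {s<..<t}) D \<Longrightarrow> (\<Sum>(s,t)\<in>D. t - s) < \<delta> \<Longrightarrow>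
     (\<Sum>(s,t)\<in>D. norm (f t - f s)) < 1"
    using abs_cont_onD[OF ac zero_less_one] by metis
  have local: "negligible (E \<inter> {c<..<c + \<delta> / 2})" for c
  proof -
    define W where "W = {c<..<c + \<delta> / 2}"
    define F where "F = E \<inter> W"
    have F: "F \<in> lmeasurable" unfolding F_def W_def using E(1) by (metis fmeasurableI2[OF lmeasurable_interval(2)] inf_le2 lmeasurable_interval(2) fmeasurableD sets.Int)
    have W: "W \<in> lmeasurable" "measure lebesgue W = \<delta> / 2" using \<open>\<delta> > 0\<close> by (auto simp: W_def)
    have bound: "measure lebesgue F \<le> 2 * \<epsilon>" if "\<epsilon> > 0" for \<epsilon>
    proof -
      define K where "K = {(u,w). a \<le> u \<and> w \<le> b \<and> u < w \<and> (1 / \<epsilon>) * (w - u) \<le> \<bar>f w - f u\<bar>}"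
      obtain D where D: "finite D" "D \<subseteq> K" "disjoint_family_on (\<lambda>(s,t). {s..t}) D"
        "\<And>s t. (s,t) \<in> D \<Longrightarrow> {s..t} \<subseteq> W"
        "measure lebesgue F \<le> (\<Sum>(s,t)\<in>D. measure lebesgue (F \<inter> {s<..<t})) + \<epsilon>"
      proof (rule Vitali_intervals_finite[OF F, of W \<epsilon> K])
        show "\<exists>u w. (u, w) \<in> K \<and> u < x \<and> x < w \<and> w - u < d" if "x \<in> F" "0 < d" for x d
          using hi[of x d "1 / \<epsilon>"] that unfolding K_def F_def by fastforce
      qed (use \<open>\<epsilon> > 0\<close> in \<open>auto simp: K_def F_def W_def\<close>)
      have dD: "disjoint_family_on (\<lambda>(s,t). {s<..<t}) D"
        using D(3) unfolding disjoint_family_on_def by fastforce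
      have "(\<Sum>(s,t)\<in>D. t - s) \<le> measure lebesgue W"
        by (rule sum_disjoint_intervals_le[OF D(1) _ W(1) dD]) (use D(2,4) in \<open>fastforce simp: K_def\<close>)
      then have "(\<Sum>(s,t)\<in>D. t - s) < \<delta>" using W(2) \<open>\<delta> > 0\<close> by simp
      then have 1: "(\<Sum>(s,t)\<in>D. norm (f t - f s)) < 1"
        using D(1,2) by (intro \<delta>) (auto simp: K_def dD)
      have "measure lebesgue F \<le> (\<Sum>(s,t)\<in>D. t - s) + \<epsilon>"
      proof -
        have "(\<Sum>(s,t)\<in>D. measure lebesgue (F \<inter> {s<..<t})) \<le> (\<Sum>(s,t)\<in>D. t - s)"
        proof (rule sum_mono)
          fix i assume "i \<in> D"
          then show "(case i of (s,t) \<Rightarrow> measure lebesgue (F \<inter> {s<..<t})) \<le> (case i of (s,t) \<Rightarrow> t - s)"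
            using D(2) fmeasurableD[OF F] by (auto simp: K_def intro!: measure_Int_interval_le)
        qed
        then show ?thesis using D(5) by linarith
      qed
      also have "(\<Sum>(s,t)\<in>D. t - s) \<le> (\<Sum>(s,t)\<in>D. \<epsilon> * norm (f t - f s))"
        using D(2) that by (intro sum_mono) (auto simp: K_def field_simps)
      also have "\<dots> = \<epsilon> * (\<Sum>(s,t)\<in>D. norm (f t - f s))" by (simp add: sum_distrib_left case_prod_beta)
      also have "\<dots> \<le> \<epsilon> * 1" using 1 that by (intro mult_left_mono) auto
      finally show ?thesis by simp
    qed
    have "measure lebesgue F \<le> 0"
      by (rule field_le_epsilon) (use bound[of "e / 2" for e] in auto)
    then have "measure lebesgue F = 0" using measure_nonneg[of lebesgue F] by linarith
    then show ?thesis using F unfolding F_def W_def by (simp add: negligible_iff_measure)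
  qed
  have "E \<subseteq> (\<Union>r\<in>\<rat>. E \<inter> {r<..<r + \<delta> / 2})"
  proof
    fix x assume "x \<in> E"
    obtain r where "r \<in> \<rat>" "x - \<delta> / 2 < r" "r < x" using \<open>\<delta> > 0\<close> Rats_dense_in_real[of "x - \<delta> / 2" x] by auto
    then show "x \<in> (\<Union>r\<in>\<rat>. E \<inter> {r<..<r + \<delta> / 2})" using \<open>x \<in> E\<close> by auto
  qed
  moreover have "negligible (\<Union>r\<in>\<rat>. E \<inter> {r<..<r + \<delta> / 2})"
    using local countable_rat by (intro negligible_countable_Union) auto
  ultimately show ?thesis by (rule negligible_subset[rotated])
qed

text \<open>Using intervals around the point instead of one-sided difference quotients makes these sets
  \<open>G\<^sub>\<delta>\<close> for arbitrary \<open>P\<close>.\<close>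

definition straddle :: "real \<Rightarrow> real \<Rightarrow> (real \<Rightarrow> real \<Rightarrow> bool) \<Rightarrow> real set" where
  "straddle a b P = {x \<in> {a<..<b}. \<forall>d>0. \<exists>u w. a \<le> u \<and> w \<le> b \<and> u < x \<and> x < w \<and> w - u < d \<and> P u w}"

lemma straddle_measurable: "straddle a b P \<in> sets lebesgue"
proof -
  define U where "U d = \<Union>{{u<..<w} | u w. a \<le> u \<and> w \<le> b \<and> w - u < d \<and> P u w}" for d
  have "straddle a b P = {a<..<b} \<inter> (\<Inter>n. U (1 / real (Suc n)))"
  proof safe
    fix x n assume "x \<in> straddle a b P"
    then show "x \<in> U (1 / real (Suc n))"
      unfolding straddle_def U_def by simp (metis greaterThanLessThan_iff zero_less_Suc of_nat_0_less_iff of_nat_Suc add.commute zero_less_divide_1_iff)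
  next
    fix x assume x: "x \<in> (\<Inter>n. U (1 / real (Suc n)))" "x \<in> {a<..<b}"
    have "\<exists>u w. a \<le> u \<and> w \<le> b \<and> u < x \<and> x < w \<and> w - u < d \<and> P u w" if "d > 0" for d
    proof -
      obtain n where n: "1 / real (Suc n) < d" using \<open>d > 0\<close> by (metis nat_approx_posE)
      have "x \<in> U (1 / real (Suc n))" using x by blast
      then show ?thesis using n unfolding U_def by fastforce
    qed
    then show "x \<in> straddle a b P" using x(2) by (simp add: straddle_def)
  qed (auto simp: straddle_def)
  moreover have "open (U d)" for d unfolding U_def by (intro open_Union) auto
  then have "U d \<in> sets borel" for d by (rule borel_open)
  then have "{a<..<b} \<inter> (\<Inter>n. U (1 / real (Suc n))) \<in> sets borel" by auto
  ultimately show ?thesis by (metis sets_completionI_sets sets_lborel)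
qed

text \<open>The estimate speaks only of intervals with \<open>x\<close> in the interior. Sending one
  endpoint to \<open>x\<close> and using continuity of \<open>f\<close> there gives the one-sided
  estimates with the same constant.\<close>

lemma differentiable_of_straddle_slopes:
  fixes f :: "real \<Rightarrow> real"
  assumes cont: "continuous_on {a..b} f" and x: "a < x" "x < b"
    and lim: "\<And>e. e > 0 \<Longrightarrow> \<exists>d>0. \<forall>u w. a \<le> u \<and> w \<le> b \<and> u < x \<and> x < w \<and> w - u < d \<longrightarrow>
        \<bar>f w - f u - l * (w - u)\<bar> \<le> e * (w - u)"
  shows "(f has_real_derivative l) (at x)"
proof -
  have cx: "isCont f x" using cont x by (simp add: continuous_on_interior)
  show ?thesis
    unfolding has_field_derivative_def has_derivative_within_alt
  proof (intro conjI allI impI)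
    show "bounded_linear ((*) l)" by (rule bounded_linear_mult_right)
    fix e :: real assume "e > 0"
    then obtain d where d: "d > 0" "\<And>u w. a \<le> u \<Longrightarrow> w \<le> b \<Longrightarrow> u < x \<Longrightarrow> x < w \<Longrightarrow> w - u < d \<Longrightarrow>
        \<bar>f w - f u - l * (w - u)\<bar> \<le> e * (w - u)" using lim by meson
    define r where "r = min (d / 2) (min (x - a) (b - x))"
    have r: "r > 0" "r \<le> d / 2" "r \<le> x - a" "r \<le> b - x" unfolding r_def using d(1) x by linarith+
    have key: "\<bar>f y - f x - l * (y - x)\<bar> \<le> e * \<bar>y - x\<bar>" if y: "\<bar>y - x\<bar> < r" for y
    proof -
      consider "y = x" | "y > x" | "y < x" by linarith
      then show ?thesis
      proof cases
        case 2
        have "((\<lambda>u. \<bar>f y - f u - l * (y - u)\<bar>) \<longlongrightarrow> \<bar>f y - f x - l * (y - x)\<bar>) (at_left x)"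
          using cx by (intro tendsto_intros) (auto simp: isCont_def filterlim_at_split)
        moreover have "((\<lambda>u. e * (y - u)) \<longlongrightarrow> e * (y - x)) (at_left x)" by (intro tendsto_intros)
        moreover have "\<forall>\<^sub>F u in at_left x. \<bar>f y - f u - l * (y - u)\<bar> \<le> e * (y - u)"
          unfolding eventually_at_left_field
          by (rule exI[of _ "x - r"]) (use r y 2 in \<open>auto intro!: d(2)\<close>)
        ultimately have "\<bar>f y - f x - l * (y - x)\<bar> \<le> e * (y - x)"
          by (intro tendsto_le[OF trivial_limit_at_left_real]) auto
        then show ?thesis using 2 by simp
      next
        case 3
        have "((\<lambda>u. \<bar>f u - f y - l * (u - y)\<bar>) \<longlongrightarrow> \<bar>f x - f y - l * (x - y)\<bar>) (at_right x)"
          using cx by (intro tendsto_intros) (auto simp: isCont_def filterlim_at_split)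
        moreover have "((\<lambda>u. e * (u - y)) \<longlongrightarrow> e * (x - y)) (at_right x)" by (intro tendsto_intros)
        moreover have "\<forall>\<^sub>F u in at_right x. \<bar>f u - f y - l * (u - y)\<bar> \<le> e * (u - y)"
          unfolding eventually_at_right_field
          by (rule exI[of _ "x + r"]) (use r y 3 in \<open>auto intro!: d(2)\<close>)
        ultimately have "\<bar>f x - f y - l * (x - y)\<bar> \<le> e * (x - y)"
          by (intro tendsto_le[OF trivial_limit_at_right_real]) auto
        moreover have "f y - f x - l * (y - x) = - (f x - f y - l * (x - y))" by (simp add: algebra_simps)
        ultimately show ?thesis using 3 by simp
      qed simp
    qed
    show "\<exists>d>0. \<forall>y\<in>UNIV. norm (y - x) < d \<longrightarrow> norm (f y - f x - l * (y - x)) \<le> e * norm (y - x)"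
      by (rule exI[of _ r]) (use r(1) key in auto)
  qed
qed

text \<open>Countably many null sets are removed: the points of unbounded slope and, for rational
  \<open>p < q\<close>, the points where slopes below \<open>p\<close> and above \<open>q\<close>
  both occur at arbitrarily small scales. Elsewhere the slopes of shrinking intervals around the
  point converge.\<close>

lemma abs_cont_real_differentiable_ae:
  fixes f :: "real \<Rightarrow> real"
  assumes ac: "abs_cont_on a b f"
  shows "negligible {x \<in> {a..b}. \<not> f differentiable (at x)}"
proof -
  define Inf_set where "Inf_set = {x \<in> {a<..<b}. \<forall>M::nat. x \<in> straddle a b (\<lambda>u w. real M * (w - u) \<le> \<bar>f w - f u\<bar>)}"
  define G where "G p q = straddle a b (\<lambda>u w. q * (w - u) \<le> f w - f u) \<inter> straddle a b (\<lambda>u w. f w - f u \<le> p * (w - u))" for p q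
  have I: "negligible Inf_set"
  proof (rule abs_cont_infinite_slope_negligible[OF ac])
    have "Inf_set = {a<..<b} \<inter> (\<Inter>M::nat. straddle a b (\<lambda>u w. real M * (w - u) \<le> \<bar>f w - f u\<bar>))"
      by (auto simp: Inf_set_def)
    moreover have "\<dots> \<in> sets lebesgue" by (intro sets.Int sets.countable_INT) (auto intro: straddle_measurable)
    ultimately show "Inf_set \<in> sets lebesgue" by simp
    show "Inf_set \<subseteq> {a<..<b}" by (auto simp: Inf_set_def)
    fix x d M :: real assume x: "x \<in> Inf_set" "d > 0"
    obtain N :: nat where "M \<le> real N" using real_arch_simple by blast
    moreover obtain u w where "a \<le> u \<and> w \<le> b \<and> u < x \<and> x < w \<and> w - u < d \<and> real N * (w - u) \<le> \<bar>f w - f u\<bar>"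
      using x unfolding Inf_set_def straddle_def by blast
    ultimately show "\<exists>u w. a \<le> u \<and> w \<le> b \<and> u < x \<and> x < w \<and> w - u < d \<and> M * (w - u) \<le> \<bar>f w - f u\<bar>"
      by (smt (verit) mult_right_mono)
  qed
  have Gneg: "negligible (G p q)" if "p < q" for p q
  proof (rule abs_cont_slope_gap_negligible[OF ac that])
    show "G p q \<in> sets lebesgue" unfolding G_def by (intro sets.Int straddle_measurable)
  qed (auto simp: G_def straddle_def)
  have "negligible (\<Union>p\<in>\<rat>. \<Union>q\<in>{q\<in>\<rat>. p < q}. G p q)"
  proof (rule negligible_countable_Union)
    show "countable ((\<lambda>p. \<Union>q\<in>{q\<in>\<rat>. p < q}. G p q) ` \<rat>)" using countable_rat by blast
    show "negligible S" if "S \<in> (\<lambda>p. \<Union>q\<in>{q\<in>\<rat>. p < q}. G p q) ` \<rat>" for S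
      using that Gneg countable_subset[OF _ countable_rat, of "{q\<in>\<rat>. p < q}" for p]
      by (auto intro!: negligible_countable_Union)
  qed
  with I have neg: "negligible (Inf_set \<union> (\<Union>p\<in>\<rat>. \<Union>q\<in>{q\<in>\<rat>. p < q}. G p q) \<union> {a,b})" by simp
  have diff: "f differentiable (at x)" if x: "x \<in> {a<..<b}" "x \<notin> Inf_set" "\<And>p q. p \<in> \<rat> \<Longrightarrow> q \<in> \<rat> \<Longrightarrow> p < q \<Longrightarrow> x \<notin> G p q" for x
  proof -
    \<comment> \<open>"For all sufficiently short intervals around \<open>x\<close>", the negation
      of membership in a \<open>straddle\<close> set. The three facts after
      \<open>not_straddle\<close> let it be used like a proper filter.\<close>
    define ev where "ev P \<longleftrightarrow> (\<exists>d>0. \<forall>u w. a \<le> u \<and> w \<le> b \<and> u < x \<and> x < w \<and> w - u < d \<longrightarrow> P u w)" for P :: "real \<Rightarrow> real \<Rightarrow> bool"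
    have not_straddle: "ev (\<lambda>u w. \<not> P u w)" if "x \<notin> straddle a b P" for P
      using that x(1) unfolding straddle_def ev_def by blast
    have ev_conj: "ev (\<lambda>u w. P u w \<and> Q u w)" if "ev P" "ev Q" for P Q
    proof -
      obtain d1 d2 where "d1 > 0" "d2 > 0" and d: "\<forall>u w. a \<le> u \<and> w \<le> b \<and> u < x \<and> x < w \<and> w - u < d1 \<longrightarrow> P u w"
         "\<forall>u w. a \<le> u \<and> w \<le> b \<and> u < x \<and> x < w \<and> w - u < d2 \<longrightarrow> Q u w" using \<open>ev P\<close> \<open>ev Q\<close> unfolding ev_def by blast
      then show ?thesis unfolding ev_def by (intro exI[of _ "min d1 d2"]) auto
    qed
    have ev_mono: "ev Q" if "ev P" "\<And>u w. u < x \<Longrightarrow> x < w \<Longrightarrow> P u w \<Longrightarrow> Q u w" for P Q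
      using that unfolding ev_def by meson
    have ev_False: "\<not> ev (\<lambda>u w. False)"
    proof
      assume "ev (\<lambda>u w. False)"
      then obtain d where d: "d > 0" "\<forall>u w. \<not> (a \<le> u \<and> w \<le> b \<and> u < x \<and> x < w \<and> w - u < d)" unfolding ev_def by blast
      have "a \<le> max a (x - d/3)" "min b (x + d/3) \<le> b" "max a (x - d/3) < x" "x < min b (x + d/3)"
        "min b (x + d/3) - max a (x - d/3) < d" using d(1) x(1) by auto
      then show False using d(2) by blast
    qed
    \<comment> \<open>Rational strict upper bounds for the slopes at small scales; the infimum
      \<open>l\<close> is the upper limit of the slopes and turns out to be the derivative.\<close>
    define S where "S = {q \<in> \<rat>. ev (\<lambda>u w. f w - f u < q * (w - u))}"
    obtain M :: nat where M: "ev (\<lambda>u w. \<not> real M * (w - u) \<le> \<bar>f w - f u\<bar>)"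
      using x(1,2) not_straddle unfolding Inf_set_def by blast
    have "real M \<in> S"
      unfolding S_def by (auto intro: ev_mono[OF M])
    have lower: "- real M \<le> q" if "q \<in> S" for q
    proof (rule ccontr)
      assume "\<not> - real M \<le> q"
      have "ev (\<lambda>u w. f w - f u < q * (w - u) \<and> \<not> real M * (w - u) \<le> \<bar>f w - f u\<bar>)"
        using that M by (intro ev_conj) (auto simp: S_def)
      then have "ev (\<lambda>u w. False)"
      proof (rule ev_mono)
        fix u w assume "u < x" "x < w" "f w - f u < q * (w - u) \<and> \<not> real M * (w - u) \<le> \<bar>f w - f u\<bar>"
        moreover have "q * (w - u) \<le> - real M * (w - u)"
          using \<open>\<not> - real M \<le> q\<close> \<open>u < x\<close> \<open>x < w\<close> by (intro mult_right_mono) auto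
        ultimately show False by auto
      qed
      then show False using ev_False by blast
    qed
    then have bdd: "bdd_below S" by (meson bdd_belowI)
    define l where "l = Inf S"
    have "(f has_real_derivative l) (at x)"
    proof (rule differentiable_of_straddle_slopes[OF abs_cont_on_continuous[OF ac]])
      fix e :: real assume "e > 0"
      obtain q where q: "q \<in> S" "q < l + e"
        using cInf_lessD[of S "l + e"] \<open>real M \<in> S\<close> \<open>e > 0\<close> unfolding l_def by auto
      obtain p where p: "p \<in> \<rat>" "l - e < p" "p < l" using Rats_dense_in_real[of "l - e" l] \<open>e > 0\<close> by auto
      \<comment> \<open>Two rationals below \<open>l\<close> are needed: as \<open>q'\<close> is not
        in \<open>S\<close>, slopes of at least \<open>q'\<close> occur at every scale, and then
        \<open>x\<close> being outside \<open>G p q'\<close> forces the slopes above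
        \<open>p\<close> eventually.\<close>
      obtain q' where q': "q' \<in> \<rat>" "p < q'" "q' < l" using Rats_dense_in_real[OF p(3)] by auto
      have "q' \<notin> S" using q'(3) cInf_lower[OF _ bdd] unfolding l_def by force
      then have "x \<in> straddle a b (\<lambda>u w. q' * (w - u) \<le> f w - f u)"
        using not_straddle[of "\<lambda>u w. q' * (w - u) \<le> f w - f u"] q'(1) unfolding S_def by (auto simp: not_le)
      then have "x \<notin> straddle a b (\<lambda>u w. f w - f u \<le> p * (w - u))"
        using x(3)[OF p(1) q'(1,2)] unfolding G_def by blast
      then have "ev (\<lambda>u w. p * (w - u) < f w - f u)"
        using not_straddle[of "\<lambda>u w. f w - f u \<le> p * (w - u)"] by (simp add: not_le)
      then have "ev (\<lambda>u w. p * (w - u) < f w - f u \<and> f w - f u < q * (w - u))"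
        using q(1) by (intro ev_conj) (auto simp: S_def)
      then have "ev (\<lambda>u w. \<bar>f w - f u - l * (w - u)\<bar> \<le> e * (w - u))"
      proof (rule ev_mono)
        fix u w assume uw: "u < x" "x < w" "p * (w - u) < f w - f u \<and> f w - f u < q * (w - u)"
        have "(l - e) * (w - u) \<le> p * (w - u)" "q * (w - u) \<le> (l + e) * (w - u)"
          using uw p q by (auto intro!: mult_right_mono)
        then show "\<bar>f w - f u - l * (w - u)\<bar> \<le> e * (w - u)" using uw(3) by (auto simp: algebra_simps)
      qed
      then show "\<exists>d>0. \<forall>u w. a \<le> u \<and> w \<le> b \<and> u < x \<and> x < w \<and> w - u < d \<longrightarrow> \<bar>f w - f u - l * (w - u)\<bar> \<le> e * (w - u)"
        unfolding ev_def .
    qed (use x(1) in auto)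
    then show ?thesis using real_differentiable_def by blast
  qed
  have "{x \<in> {a..b}. \<not> f differentiable (at x)} \<subseteq> Inf_set \<union> (\<Union>p\<in>\<rat>. \<Union>q\<in>{q\<in>\<rat>. p < q}. G p q) \<union> {a,b}" (is "?A \<subseteq> ?B")
  proof (intro subsetI, rule ccontr)
    fix x assume x: "x \<in> ?A" "x \<notin> ?B"
    then have "x \<in> {a<..<b}" "x \<notin> Inf_set" by auto
    moreover have "x \<notin> G p q" if "p \<in> \<rat>" "q \<in> \<rat>" "p < q" for p q using x(2) that by blast
    ultimately have "f differentiable (at x)" using diff by blast
    then show False using x(1) by simp
  qed
  with neg show ?thesis by (rule negligible_subset)
qed

lemma abs_cont_differentiable_ae:
  fixes f :: "real \<Rightarrow> 'a::euclidean_space"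
  assumes ac: "abs_cont_on a b f"
  shows "negligible {x \<in> {a..b}. \<not> f differentiable (at x)}"
proof -
  have "negligible {x \<in> {a..b}. \<not> (\<lambda>t. f t \<bullet> i) differentiable (at x)}" for i
  proof (rule abs_cont_real_differentiable_ae, rule abs_cont_on_dominated[OF ac, of _ "norm i" 0])
    show "norm (f t \<bullet> i - f s \<bullet> i) \<le> norm i * norm (f t - f s) + 0 * (t - s)" for s t
      using Cauchy_Schwarz_ineq2[of "f t - f s" i] by (simp add: inner_diff_left mult.commute)
  qed auto
  then have "negligible (\<Union>i\<in>Basis. {x \<in> {a..b}. \<not> (\<lambda>t. f t \<bullet> i) differentiable (at x)})"
    by (intro negligible_Union) auto
  then show ?thesis
    by (rule negligible_subset) (use differentiable_componentwise_within[of f _ UNIV] in auto)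
qed

text \<open>Working directly with gauges makes integrability of the derivative part of the
  conclusion. Tags where \<open>f\<close> is differentiable are handled by linear approximation. At
  tags in the null set \<open>N\<close> the gauge forces the intervals into an open set of small
  measure, where absolute continuity bounds the increments.\<close>

theorem abs_cont_fundamental_theorem:
  fixes f :: "real \<Rightarrow> 'a::euclidean_space"
  assumes ac: "abs_cont_on a b f" and "a \<le> b"
  shows "((\<lambda>t. vector_derivative f (at t)) has_integral (f b - f a)) {a..b}"
proof -
  define N where "N = {x \<in> {a..b}. \<not> f differentiable (at x)}"
  have N: "negligible N" unfolding N_def by (rule abs_cont_differentiable_ae[OF ac])
  define g where "g t = (if t \<in> N then 0 else vector_derivative f (at t))" for t
  have "(g has_integral (f b - f a)) {a..b}"
    unfolding has_integral_real
  proof (intro allI impI)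
    fix e :: real assume "e > 0"
    define \<epsilon> where "\<epsilon> = e / (2 * (b - a + 1))"
    have "\<epsilon> > 0" using \<open>e > 0\<close> \<open>a \<le> b\<close> by (simp add: \<epsilon>_def)
    have e2: "\<epsilon> * (b - a) < e / 2"
    proof -
      have "\<epsilon> * (b - a) < \<epsilon> * (b - a + 1)" using \<open>\<epsilon> > 0\<close> by simp
      also have "\<dots> = e / 2" using \<open>a \<le> b\<close> by (simp add: \<epsilon>_def field_simps)
      finally show ?thesis .
    qed
    obtain \<delta> where "\<delta> > 0" and \<delta>: "\<And>D. finite D \<Longrightarrow> (\<And>s t. (s,t) \<in> D \<Longrightarrow> a \<le> s \<and> s \<le> t \<and> t \<le> b) \<Longrightarrow>
       disjoint_family_on (\<lambda>(s,t). {s<..<t}) D \<Longrightarrow> (\<Sum>(s,t)\<in>D. t - s) < \<delta> \<Longrightarrow>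
       (\<Sum>(s,t)\<in>D. norm (f t - f s)) < e / 2"
      using abs_cont_onD[OF ac half_gt_zero[OF \<open>e > 0\<close>]] by metis
    have "N \<in> sets lebesgue" using N negligible_imp_sets by blast
    then obtain W where W: "open W" "N \<subseteq> W" "W - N \<in> lmeasurable" "emeasure lebesgue (W - N) < ennreal \<delta>"
      using sets_lebesgue_outer_open[of N \<delta>] \<open>\<delta> > 0\<close> by metis
    have Wm: "W \<in> lmeasurable"
      using W(3) N by (metis W(2) Un_Diff_cancel2 Un_absorb2 fmeasurable.Un negligible_imp_measurable)
    have "measure lebesgue W \<le> measure lebesgue (W - N) + measure lebesgue N"
      using measure_Un_le[of "W - N" lebesgue N] W(2,3) N
      by (simp add: fmeasurableD negligible_imp_sets Un_absorb2)
    then have "measure lebesgue W \<le> measure lebesgue (W - N)" using N by (simp add: negligible_imp_measure0)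
    also have "\<dots> < \<delta>"
      using W(3,4) \<open>\<delta> > 0\<close> by (metis emeasure_eq_measure2 ennreal_less_iff measure_nonneg)
    finally have Wd: "measure lebesgue W < \<delta>" .
    have "\<exists>d>0. (t \<in> N \<longrightarrow> ball t d \<subseteq> W) \<and> (t \<in> {a..b} - N \<longrightarrow>
        (\<forall>y. \<bar>y - t\<bar> < d \<longrightarrow> norm (f y - f t - (y - t) *\<^sub>R g t) \<le> \<epsilon> * \<bar>y - t\<bar>))" for t
    proof (cases "t \<in> N")
      case True
      then obtain d where "d > 0" "ball t d \<subseteq> W" using W(1,2) by (meson openE subsetD)
      then show ?thesis using True by auto
    next
      case False
      show ?thesis
      proof (cases "t \<in> {a..b}")
        case True
        with False have "f differentiable (at t)" by (simp add: N_def)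
        then have "(f has_vector_derivative g t) (at t)"
          using False by (simp add: g_def vector_derivative_works)
        then show ?thesis
          unfolding has_vector_derivative_def has_derivative_at_alt
          using \<open>\<epsilon> > 0\<close> False by (metis DiffE real_norm_def)
      qed (use False in \<open>auto intro: zero_less_one\<close>)
    qed
    then obtain d where d: "\<And>t. d t > 0" "\<And>t. t \<in> N \<Longrightarrow> ball t (d t) \<subseteq> W"
      "\<And>t y. t \<in> {a..b} - N \<Longrightarrow> \<bar>y - t\<bar> < d t \<Longrightarrow> norm (f y - f t - (y - t) *\<^sub>R g t) \<le> \<epsilon> * \<bar>y - t\<bar>"
      by metis
    show "\<exists>\<gamma>. gauge \<gamma> \<and> (\<forall>\<D>. \<D> tagged_division_of {a..b} \<and> \<gamma> fine \<D> \<longrightarrow>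
        norm (sum (\<lambda>(x,k). measure lborel k *\<^sub>R g x) \<D> - (f b - f a)) < e)"
    proof (intro exI[of _ "\<lambda>t. ball t (d t)"] conjI allI impI)
      show "gauge (\<lambda>t. ball t (d t))" using d(1) by (simp add: gauge_def)
      fix \<D> assume D: "\<D> tagged_division_of {a..b} \<and> (\<lambda>t. ball t (d t)) fine \<D>"
      then have tag: "\<D> tagged_division_of {a..b}" and fine: "\<And>x K. (x,K) \<in> \<D> \<Longrightarrow> K \<subseteq> ball x (d x)"
        by (auto simp: fine_def)
      have fin: "finite \<D>" using tag by blast
      have K: "K = {Inf K..Sup K}" "Inf K \<le> x" "x \<le> Sup K" "a \<le> Inf K" "Sup K \<le> b" "x \<in> {a..b}"
        if "(x,K) \<in> \<D>" for x K
      proof -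
        obtain u w where uw: "K = cbox u w" using tagged_division_ofD(4)[OF tag \<open>(x,K) \<in> \<D>\<close>] by blast
        have xK: "x \<in> K" "K \<subseteq> {a..b}" using tagged_division_ofD(2,3)[OF tag that] by auto
        then have "u \<le> w" using uw by auto
        then have "Inf K = u" "Sup K = w" using uw by (auto simp: box_real)
        then show "K = {Inf K..Sup K}" "Inf K \<le> x" "x \<le> Sup K" "a \<le> Inf K" "Sup K \<le> b" "x \<in> {a..b}"
          using xK uw \<open>u \<le> w\<close> by (auto simp: box_real)
      qed
      have cK: "measure lborel K = Sup K - Inf K" if "(x,K) \<in> \<D>" for x K
        using K[OF that] by (metis content_real order_trans)
      define h where "h = (\<lambda>(x,K). measure lborel K *\<^sub>R g x - (f (Sup K) - f (Inf K)))"
      \<comment> \<open>Degenerate intervals contribute zero and are left out, so that distinct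
        members of \<open>A\<close> have disjoint non-empty interiors and are determined by their
        endpoints.\<close>
      define A where "A = {i \<in> \<D>. fst i \<in> N \<and> Inf (snd i) < Sup (snd i)}"
      define B where "B = {i \<in> \<D>. fst i \<notin> N}"
      have "sum (\<lambda>(x,k). measure lborel k *\<^sub>R g x) \<D> - (f b - f a) = sum h \<D>"
        unfolding additive_tagged_division_1[OF \<open>a \<le> b\<close> tag, of f, symmetric] sum_subtractf[symmetric]
        by (rule sum.cong) (auto simp: h_def)
      also have "sum h \<D> = sum h (A \<union> B)"
      proof (rule sum.mono_neutral_right[OF fin])
        show "\<forall>i\<in>\<D> - (A \<union> B). h i = 0"
        proof
          fix i assume i: "i \<in> \<D> - (A \<union> B)"
          obtain x K where [simp]: "i = (x,K)" by (cases i)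
          have "Inf K = Sup K" using i K[of x K] by (auto simp: A_def B_def)
          moreover have "g x = 0" using i by (auto simp: A_def B_def g_def)
          ultimately show "h i = 0" by (simp add: h_def)
        qed
      qed (auto simp: A_def B_def)
      also have "\<dots> = sum h A + sum h B"
        by (rule sum.union_disjoint) (use fin in \<open>auto simp: A_def B_def\<close>)
      finally have eq: "sum (\<lambda>(x,k). measure lborel k *\<^sub>R g x) \<D> - (f b - f a) = sum h A + sum h B" .
      have "norm (sum h B) \<le> (\<Sum>i\<in>B. \<epsilon> * measure lborel (snd i))"
      proof (rule sum_norm_le)
        fix i assume i: "i \<in> B"
        obtain x K where [simp]: "i = (x,K)" by (cases i)
        have xK: "(x,K) \<in> \<D>" "x \<notin> N" using i by (auto simp: B_def)
        note KK = K[OF xK(1)]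
        have "Sup K \<in> K" "Inf K \<in> K" using KK by (metis atLeastAtMost_iff order_refl order_trans)+
        then have *: "\<bar>Sup K - x\<bar> < d x" "\<bar>Inf K - x\<bar> < d x"
          using fine[OF xK(1)] by (auto simp: subset_iff dist_real_def abs_minus_commute)
        have 1: "norm (f (Sup K) - f x - (Sup K - x) *\<^sub>R g x) \<le> \<epsilon> * (Sup K - x)"
          using d(3)[of x "Sup K"] * xK KK by auto
        have 2: "norm (f (Inf K) - f x - (Inf K - x) *\<^sub>R g x) \<le> \<epsilon> * (x - Inf K)"
          using d(3)[of x "Inf K"] * xK KK by auto
        \<comment> \<open>The tag lies between the endpoints, so the two one-sided errors add up to
          \<open>\<epsilon>\<close> times the length of \<open>K\<close>.\<close>
        have "h i = (f (Inf K) - f x - (Inf K - x) *\<^sub>R g x) - (f (Sup K) - f x - (Sup K - x) *\<^sub>R g x)"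
          by (simp add: h_def cK[OF xK(1)] algebra_simps)
        then have "norm (h i) \<le> \<epsilon> * (x - Inf K) + \<epsilon> * (Sup K - x)"
          using 1 2 by (metis add_mono norm_triangle_ineq4 order_trans)
        then show "norm (h i) \<le> \<epsilon> * measure lborel (snd i)" by (simp add: cK[OF xK(1)] algebra_simps)
      qed
      also have "\<dots> \<le> (\<Sum>i\<in>\<D>. \<epsilon> * measure lborel (snd i))"
        using fin \<open>\<epsilon> > 0\<close> by (intro sum_mono2) (auto simp: B_def)
      also have "\<dots> = \<epsilon> * (b - a)"
        using additive_content_tagged_division[of \<D> a b] tag \<open>a \<le> b\<close>
        by (simp add: sum_distrib_left[symmetric] case_prod_beta box_real)
      finally have hB: "norm (sum h B) < e / 2" using e2 by simp
      define D where "D = (\<lambda>i. (Inf (snd i), Sup (snd i))) ` A"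
      have inj: "inj_on (\<lambda>i. (Inf (snd i), Sup (snd i))) A" and dis: "disjoint_family_on (\<lambda>(s,t). {s<..<t}) D"
      proof -
        have int: "{Inf (snd i)<..<Sup (snd i)} \<inter> {Inf (snd j)<..<Sup (snd j)} = {}"
          if "i \<in> A" "j \<in> A" "i \<noteq> j" for i j
        proof -
          obtain x K y M where [simp]: "i = (x,K)" "j = (y,M)" by (cases i, cases j)
          have "(x,K) \<in> \<D>" "(y,M) \<in> \<D>" "(x,K) \<noteq> (y,M)" using that by (auto simp: A_def)
          then have "interior K \<inter> interior M = {}" using tagged_division_ofD(5)[OF tag] by blast
          moreover have "interior K = {Inf K<..<Sup K}" "interior M = {Inf M<..<Sup M}"
            using K(1)[OF \<open>(x,K) \<in> \<D>\<close>] K(1)[OF \<open>(y,M) \<in> \<D>\<close>] by (metis interior_atLeastAtMost_real)+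
          ultimately show ?thesis by simp
        qed
        show "inj_on (\<lambda>i. (Inf (snd i), Sup (snd i))) A"
        proof (rule inj_onI, rule ccontr)
          fix i j assume ij: "i \<in> A" "j \<in> A" "(Inf (snd i), Sup (snd i)) = (Inf (snd j), Sup (snd j))" "i \<noteq> j"
          then have "{Inf (snd i)<..<Sup (snd i)} = {}" using int[of i j] by auto
          then show False using ij(1) by (auto simp: A_def)
        qed
        show "disjoint_family_on (\<lambda>(s,t). {s<..<t}) D"
          unfolding D_def disjoint_family_on_def using int by fastforce
      qed
      have sumD: "(\<Sum>(s,t)\<in>D. k s t) = (\<Sum>i\<in>A. k (Inf (snd i)) (Sup (snd i)))" for k :: "real \<Rightarrow> real \<Rightarrow> real"
        unfolding D_def by (subst sum.reindex[OF inj]) auto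
      have AD: "(fst i, snd i) \<in> \<D>" if "i \<in> A" for i using that by (simp add: A_def)
      have "(\<Sum>(s,t)\<in>D. t - s) \<le> measure lebesgue W"
      proof (rule sum_disjoint_intervals_le[OF _ _ Wm dis])
        show "finite D" using fin by (simp add: D_def A_def)
        show "s \<le> t \<and> {s<..<t} \<subseteq> W" if "(s,t) \<in> D" for s t
        proof -
          obtain i where i: "i \<in> A" "s = Inf (snd i)" "t = Sup (snd i)" using \<open>(s,t) \<in> D\<close> by (auto simp: D_def)
          have "snd i \<subseteq> W" using fine[OF AD[OF i(1)]] d(2)[of "fst i"] i(1) by (auto simp: A_def)
          moreover have "{s<..<t} \<subseteq> snd i" using K(1)[OF AD[OF i(1)]] i(2,3) by (metis greaterThanLessThan_subseteq_atLeastAtMost_iff order_refl)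
          ultimately show ?thesis using i by (auto simp: A_def)
        qed
      qed
      then have "(\<Sum>(s,t)\<in>D. norm (f t - f s)) < e / 2"
        using Wd fin K(4)[OF AD] K(5)[OF AD] by (intro \<delta> dis) (auto simp: D_def A_def)
      moreover have "norm (sum h A) \<le> (\<Sum>(s,t)\<in>D. norm (f t - f s))"
        unfolding sumD by (rule sum_norm_le) (auto simp: A_def h_def g_def norm_minus_commute)
      ultimately have "norm (sum h A) < e / 2" by simp
      then show "norm (sum (\<lambda>(x,k). measure lborel k *\<^sub>R g x) \<D> - (f b - f a)) < e"
        unfolding eq using hB norm_triangle_ineq[of "sum h A" "sum h B"] by simp
    qed
  qed
  then show ?thesis
    by (rule has_integral_spike[OF N, rotated]) (auto simp: g_def)
qed

section \<open>Tonelli Hamiltonians and their Lagrangians\<close>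

lemma grad_eqI:
  assumes "(f has_derivative (\<lambda>w. g \<bullet> w)) (at x)"
  shows "grad f x = g"
proof -
  have "(f has_derivative (\<lambda>w. grad f x \<bullet> w)) (at x)"
    unfolding grad_def by (rule someI[where P = "\<lambda>g. (f has_derivative (\<lambda>w. g \<bullet> w)) (at x)", OF assms])
  then have "(\<lambda>w. grad f x \<bullet> w) = (\<lambda>w. g \<bullet> w)"
    using assms has_derivative_unique by blast
  then show ?thesis by (metis vector_eq_rdot)
qed

lemma differentiable_grad:
  fixes f :: "real^'n \<Rightarrow> real"
  assumes "f differentiable (at x)"
  shows "(f has_derivative (\<lambda>w. grad f x \<bullet> w)) (at x)"
proof -
  obtain f' where f': "(f has_derivative f') (at x)" using assms by (auto simp: differentiable_def)
  then interpret bounded_linear f' by (rule has_derivative_bounded_linear)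
  define g where "g = (\<Sum>i\<in>Basis. f' i *\<^sub>R i)"
  have "f' w = g \<bullet> w" for w
  proof -
    have "f' w = f' (\<Sum>i\<in>Basis. (w \<bullet> i) *\<^sub>R i)" by (simp add: euclidean_representation)
    also have "\<dots> = g \<bullet> w" unfolding g_def inner_sum_left sum
      by (intro sum.cong refl) (simp add: scaleR inner_commute mult.commute)
    finally show ?thesis .
  qed
  then have "(f has_derivative (\<lambda>w. g \<bullet> w)) (at x)" using f' by presburger
  then show ?thesis using grad_eqI by metis
qed

lemma lattice_translate_into_cube:
  fixes x :: "real^'n"
  obtains k where "k \<in> lattice" "x + k \<in> cbox 0 1"
proof
  define k :: "real^'n" where "k = (\<chi> i. - of_int \<lfloor>x $ i\<rfloor>)"
  show "k \<in> lattice" by (simp add: k_def lattice_def)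
  show "x + k \<in> cbox 0 1"
    using real_of_int_floor_add_one_ge[of "x $ i" for i]
    by (auto simp: mem_box_cart k_def diff_le_eq add.commute)
qed

text \<open>Compactness of the torus, phrased on the cover: a lattice vector moves the position into
  the unit cube. The second factor is an arbitrary metric space, so a function of position alone is
  treated with a one-point set.\<close>

lemma periodic_bounded:
  fixes f :: "(real^'n) \<times> 'b::metric_space \<Rightarrow> 'c::real_normed_vector"
  assumes cont: "continuous_on UNIV f" and per: "\<And>x k p. k \<in> lattice \<Longrightarrow> f (x + k, p) = f (x, p)"
    and "compact S"
  shows "\<exists>B>0. \<forall>x. \<forall>p\<in>S. norm (f (x,p)) \<le> B"
proof -
  have "compact (f ` (cbox 0 1 \<times> S))"
    using cont assms(3) by (intro compact_continuous_image compact_Times) (auto intro: continuous_on_subset)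
  then obtain B where B: "B > 0" "\<And>y. y \<in> f ` (cbox 0 1 \<times> S) \<Longrightarrow> norm y \<le> B"
    using compact_imp_bounded bounded_pos by metis
  show ?thesis
  proof (intro exI[of _ B] conjI B(1) allI ballI)
    fix x :: "real^'n" and p assume "p \<in> S"
    obtain k where "k \<in> lattice" "x + k \<in> cbox 0 1" by (rule lattice_translate_into_cube)
    then show "norm (f (x,p)) \<le> B" using B(2)[of "f (x + k, p)"] per[of k x p] \<open>p \<in> S\<close> by (metis SigmaI image_eqI)
  qed
qed

lemma mean_value_segment:
  fixes f :: "'a::real_inner \<Rightarrow> real"
  assumes "\<And>y. (f has_derivative (\<lambda>w. g y \<bullet> w)) (at y)"
  obtains y where "y \<in> closed_segment a b" "f b - f a = g y \<bullet> (b - a)"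
proof -
  have "\<exists>s\<in>{0<..<1}. f (a + 1 *\<^sub>R (b - a)) - f (a + 0 *\<^sub>R (b - a)) = (\<lambda>h. g (a + s *\<^sub>R (b - a)) \<bullet> (h *\<^sub>R (b - a))) (1 - 0)"
  proof (rule mvt_simple)
    fix s :: real assume "0 \<le> s" "s \<le> 1"
    have "((\<lambda>s. a + s *\<^sub>R (b - a)) has_derivative (\<lambda>h. h *\<^sub>R (b - a))) (at s within {0..1})"
      by (auto intro!: derivative_eq_intros)
    from has_derivative_compose[OF this assms]
    show "((\<lambda>s. f (a + s *\<^sub>R (b - a))) has_derivative (\<lambda>h. g (a + s *\<^sub>R (b - a)) \<bullet> (h *\<^sub>R (b - a)))) (at s within {0..1})" .
  qed simp
  then obtain s where "s \<in> {0<..<1}" "f b - f a = g (a + s *\<^sub>R (b - a)) \<bullet> (b - a)" by auto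
  moreover have "a + s *\<^sub>R (b - a) \<in> closed_segment a b"
    using \<open>s \<in> {0<..<1}\<close> unfolding closed_segment_def
    by (auto intro!: exI[of _ s] simp: algebra_simps)
  ultimately show ?thesis using that by blast
qed

section \<open>Uniform regularity of the Hamiltonian on the cover\<close>

locale tonelli_hamiltonian =
  fixes H :: "real^'n \<Rightarrow> real^'n \<Rightarrow> real"
  assumes tonelli_H: "tonelli H"
begin

definition Hx :: "real^'n \<Rightarrow> real^'n \<Rightarrow> real^'n" where "Hx x p = grad (\<lambda>y. H y p) x"
definition Hp :: "real^'n \<Rightarrow> real^'n \<Rightarrow> real^'n" where "Hp x p = grad (H x) p"

lemma H_periodic: "k \<in> lattice \<Longrightarrow> H (x + k) p = H x p"
  using tonelli_H by (auto simp: tonelli_def)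

lemma H_superlinear: obtains R where "\<And>x p. R \<le> norm p \<Longrightarrow> M * norm p \<le> H x p"
  using tonelli_H unfolding tonelli_def by meson

text \<open>A single statement because the derivatives in \<open>C2\<close> are existentially bound.
  Representing the first derivative by vectors in each factor gives the partial gradients; a bound
  of the second derivative on a compact convex set gives their Lipschitz estimate.\<close>

lemma H_derivative:
  shows H_has_derivative: "((\<lambda>z. H (fst z) (snd z)) has_derivative (\<lambda>w. Hx x p \<bullet> fst w + Hp x p \<bullet> snd w)) (at (x,p))"
    and Hx_has_derivative: "((\<lambda>y. H y p) has_derivative (\<lambda>w. Hx x p \<bullet> w)) (at x)"
    and Hp_has_derivative: "(H x has_derivative (\<lambda>w. Hp x p \<bullet> w)) (at p)"
    and Hp_differentiable: "Hp x differentiable (at p)"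
    and grad_H_lipschitz_compact: "\<And>S. compact S \<Longrightarrow> convex S \<Longrightarrow> \<exists>K\<ge>0. \<forall>z\<in>S. \<forall>w\<in>S.
       norm (Hx (fst z) (snd z) - Hx (fst w) (snd w)) \<le> K * norm (z - w) \<and>
       norm (Hp (fst z) (snd z) - Hp (fst w) (snd w)) \<le> K * norm (z - w)"
proof -
  obtain D1 D2 where D1: "\<And>z. ((\<lambda>z. H (fst z) (snd z)) has_derivative blinfun_apply (D1 z)) (at z)"
    and D2: "\<And>z. (D1 has_derivative blinfun_apply (D2 z)) (at z)"
    and D2c: "continuous_on UNIV D2"
    using tonelli_H unfolding tonelli_def C2_def by blast
  define g1 where "g1 z = (\<Sum>i\<in>Basis. blinfun_apply (D1 z) (i,0) *\<^sub>R i)" for z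
  define g2 where "g2 z = (\<Sum>i\<in>Basis. blinfun_apply (D1 z) (0,i) *\<^sub>R i)" for z
  have g1: "blinfun_apply (D1 z) (w,0) = g1 z \<bullet> w" for z w
  proof -
    have "(w,0) = (\<Sum>i\<in>Basis. (w \<bullet> i) *\<^sub>R (i,0::real^'n))"
      by (rule prod_eqI) (simp_all add: fst_sum snd_sum euclidean_representation)
    then have "blinfun_apply (D1 z) (w,0) = (\<Sum>i\<in>Basis. (w \<bullet> i) * blinfun_apply (D1 z) (i,0))"
      by (simp only: blinfun.sum_right blinfun.scaleR_right real_scaleR_def)
    also have "\<dots> = g1 z \<bullet> w" unfolding g1_def inner_sum_left
      by (intro sum.cong refl) (simp add: inner_commute mult.commute)
    finally show ?thesis .
  qed
  have g2: "blinfun_apply (D1 z) (0,w) = g2 z \<bullet> w" for z w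
  proof -
    have "(0,w) = (\<Sum>i\<in>Basis. (w \<bullet> i) *\<^sub>R (0::real^'n,i))"
      by (rule prod_eqI) (simp_all add: fst_sum snd_sum euclidean_representation)
    then have "blinfun_apply (D1 z) (0,w) = (\<Sum>i\<in>Basis. (w \<bullet> i) * blinfun_apply (D1 z) (0,i))"
      by (simp only: blinfun.sum_right blinfun.scaleR_right real_scaleR_def)
    also have "\<dots> = g2 z \<bullet> w" unfolding g2_def inner_sum_left
      by (intro sum.cong refl) (simp add: inner_commute mult.commute)
    finally show ?thesis .
  qed
  have d1: "((\<lambda>y. H y p) has_derivative (\<lambda>w. g1 (x,p) \<bullet> w)) (at x)" for x p
  proof -
    have "((\<lambda>y. (y,p)) has_derivative (\<lambda>w. (w,0))) (at x)" by (auto intro!: derivative_eq_intros)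
    from has_derivative_compose[OF this D1] show ?thesis by (simp add: g1)
  qed
  have d2: "(H x has_derivative (\<lambda>w. g2 (x,p) \<bullet> w)) (at p)" for x p
  proof -
    have "((\<lambda>q. (x,q)) has_derivative (\<lambda>w. (0,w))) (at p)" by (auto intro!: derivative_eq_intros)
    from has_derivative_compose[OF this D1] show ?thesis by (simp add: g2)
  qed
  have Hx_g: "Hx x p = g1 (x,p)" for x p unfolding Hx_def by (rule grad_eqI[OF d1])
  have Hp_g: "Hp x p = g2 (x,p)" for x p unfolding Hp_def by (rule grad_eqI[OF d2])
  show "((\<lambda>y. H y p) has_derivative (\<lambda>w. Hx x p \<bullet> w)) (at x)"
    and "(H x has_derivative (\<lambda>w. Hp x p \<bullet> w)) (at p)" using d1 d2 Hx_g Hp_g by simp_all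
  have "blinfun_apply (D1 (x,p)) w = Hx x p \<bullet> fst w + Hp x p \<bullet> snd w" for w
  proof -
    have "w = (fst w, 0) + (0, snd w)" by simp
    then have "blinfun_apply (D1 (x,p)) w = blinfun_apply (D1 (x,p)) (fst w, 0) + blinfun_apply (D1 (x,p)) (0, snd w)"
      by (metis blinfun.add_right)
    then show ?thesis by (simp add: g1 g2 Hx_g Hp_g)
  qed
  then show "((\<lambda>z. H (fst z) (snd z)) has_derivative (\<lambda>w. Hx x p \<bullet> fst w + Hp x p \<bullet> snd w)) (at (x,p))"
    using D1[of "(x,p)"] by presburger
  show "Hp x differentiable (at p)"
  proof -
    have "((\<lambda>q. (x,q)) has_derivative (\<lambda>w. (0,w))) (at p)" by (auto intro!: derivative_eq_intros)
    from has_derivative_compose[OF this D2]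
    have *: "((\<lambda>q. D1 (x,q)) has_derivative (\<lambda>w. blinfun_apply (D2 (x,p)) (0,w))) (at p)" .
    have "((\<lambda>q. g2 (x,q)) has_derivative
        (\<lambda>w. \<Sum>i\<in>Basis. blinfun_apply (blinfun_apply (D2 (x,p)) (0,w)) (0,i) *\<^sub>R i)) (at p)"
      unfolding g2_def by (auto intro!: derivative_eq_intros * simp: blinfun.zero_right)
    then show ?thesis unfolding Hp_g[abs_def] differentiable_def by blast
  qed
  fix S :: "((real^'n) \<times> (real^'n)) set" assume S: "compact S" "convex S"
  have "compact (D2 ` S)" using S D2c by (intro compact_continuous_image) (auto intro: continuous_on_subset)
  then obtain K where K: "K > 0" "\<And>z. z \<in> S \<Longrightarrow> norm (D2 z) \<le> K"
    using compact_imp_bounded bounded_pos by (metis image_eqI)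
  have L: "norm (D1 z - D1 w) \<le> K * norm (z - w)" if "z \<in> S" "w \<in> S" for z w
    by (rule differentiable_bound[OF S(2), of D1 "\<lambda>z. blinfun_apply (D2 z)"])
       (use D2 K(2) that in \<open>auto simp: norm_blinfun.rep_eq[symmetric] intro: has_derivative_at_withinI\<close>)
  have sq: "norm u \<le> c" if "u \<bullet> u \<le> c * norm u" "c \<ge> 0" for u :: "real^'n" and c
    using that by (metis dot_square_norm mult_le_cancel_right norm_ge_zero not_le order.trans power2_eq_square)
  have b1: "norm (g1 z - g1 w) \<le> norm (D1 z - D1 w)" for z w
  proof (rule sq)
    have "(g1 z - g1 w) \<bullet> (g1 z - g1 w) = blinfun_apply (D1 z - D1 w) (g1 z - g1 w, 0)"
      by (simp add: blinfun.diff_left g1 inner_diff_left)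
    also have "\<dots> \<le> norm (D1 z - D1 w) * norm (g1 z - g1 w, 0::real^'n)"
      using norm_blinfun[of "D1 z - D1 w" "(g1 z - g1 w, 0)"] by (simp only: real_norm_def)
    finally show "(g1 z - g1 w) \<bullet> (g1 z - g1 w) \<le> norm (D1 z - D1 w) * norm (g1 z - g1 w)" by (simp add: norm_Pair)
  qed simp
  have b2: "norm (g2 z - g2 w) \<le> norm (D1 z - D1 w)" for z w
  proof (rule sq)
    have "(g2 z - g2 w) \<bullet> (g2 z - g2 w) = blinfun_apply (D1 z - D1 w) (0, g2 z - g2 w)"
      by (simp add: blinfun.diff_left g2 inner_diff_left)
    also have "\<dots> \<le> norm (D1 z - D1 w) * norm (0::real^'n, g2 z - g2 w)"
      using norm_blinfun[of "D1 z - D1 w" "(0, g2 z - g2 w)"] by (simp only: real_norm_def)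
    finally show "(g2 z - g2 w) \<bullet> (g2 z - g2 w) \<le> norm (D1 z - D1 w) * norm (g2 z - g2 w)" by (simp add: norm_Pair)
  qed simp
  show "\<exists>K\<ge>0. \<forall>z\<in>S. \<forall>w\<in>S.
       norm (Hx (fst z) (snd z) - Hx (fst w) (snd w)) \<le> K * norm (z - w) \<and>
       norm (Hp (fst z) (snd z) - Hp (fst w) (snd w)) \<le> K * norm (z - w)"
    using K(1) L b1 b2 by (intro exI[of _ K]) (simp add: Hx_g Hp_g, meson order_trans)
qed

lemma Hx_periodic: "k \<in> lattice \<Longrightarrow> Hx (x + k) p = Hx x p"
proof -
  assume k: "k \<in> lattice"
  have "((\<lambda>y. y + k) has_derivative (\<lambda>w. w)) (at x)" by (auto intro!: derivative_eq_intros)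
  from has_derivative_compose[OF this Hx_has_derivative]
  have "((\<lambda>y. H y p) has_derivative (\<lambda>w. Hx (x + k) p \<bullet> w)) (at x)" using H_periodic[OF k] by simp
  then show ?thesis unfolding Hx_def[of x p] by (rule grad_eqI[symmetric])
qed

lemma Hp_periodic: "k \<in> lattice \<Longrightarrow> Hp (x + k) p = Hp x p"
proof -
  assume k: "k \<in> lattice"
  have "H (x + k) = H x" using H_periodic[OF k] by auto
  then show ?thesis unfolding Hp_def by simp
qed

lemma grad_H_continuous:
  shows "continuous_on UNIV (\<lambda>z. Hx (fst z) (snd z))" "continuous_on UNIV (\<lambda>z. Hp (fst z) (snd z))"
proof -
  have "isCont (\<lambda>z. Hx (fst z) (snd z)) z \<and> isCont (\<lambda>z. Hp (fst z) (snd z)) z" for z :: "(real^'n) \<times> (real^'n)"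
  proof -
    obtain K where K: "K \<ge> 0" "\<forall>u\<in>cball z 1. \<forall>w\<in>cball z 1.
       norm (Hx (fst u) (snd u) - Hx (fst w) (snd w)) \<le> K * norm (u - w) \<and>
       norm (Hp (fst u) (snd u) - Hp (fst w) (snd w)) \<le> K * norm (u - w)"
      using grad_H_lipschitz_compact[of "cball z 1"] by auto
    have "K-lipschitz_on (cball z 1) (\<lambda>z. Hx (fst z) (snd z))" "K-lipschitz_on (cball z 1) (\<lambda>z. Hp (fst z) (snd z))"
      using K by (auto simp: lipschitz_on_def dist_norm)
    then have "continuous_on (cball z 1) (\<lambda>z. Hx (fst z) (snd z))" "continuous_on (cball z 1) (\<lambda>z. Hp (fst z) (snd z))"
      by (auto intro: lipschitz_on_continuous_on)
    then show ?thesis by (auto intro!: continuous_on_interior)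
  qed
  then show "continuous_on UNIV (\<lambda>z. Hx (fst z) (snd z))" "continuous_on UNIV (\<lambda>z. Hp (fst z) (snd z))"
    by (auto simp: continuous_on_eq_continuous_at)
qed

lemma H_continuous: "continuous_on UNIV (\<lambda>z. H (fst z) (snd z))"
proof -
  have "isCont (\<lambda>z. H (fst z) (snd z)) (x,p)" for x p
    by (rule has_derivative_continuous[OF H_has_derivative])
  then show ?thesis by (simp add: continuous_on_eq_continuous_at split_paired_all)
qed

lemma continuous_on_Hx [continuous_intros]:
  "continuous_on S f \<Longrightarrow> continuous_on S g \<Longrightarrow> continuous_on S (\<lambda>t. Hx (f t) (g t))"
  using continuous_on_compose2[OF grad_H_continuous(1), of S "\<lambda>t. (f t, g t)"] by (auto intro: continuous_on_Pair)

lemma continuous_on_Hp [continuous_intros]: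
  "continuous_on S f \<Longrightarrow> continuous_on S g \<Longrightarrow> continuous_on S (\<lambda>t. Hp (f t) (g t))"
  using continuous_on_compose2[OF grad_H_continuous(2), of S "\<lambda>t. (f t, g t)"] by (auto intro: continuous_on_Pair)

lemma continuous_on_H [continuous_intros]:
  "continuous_on S f \<Longrightarrow> continuous_on S g \<Longrightarrow> continuous_on S (\<lambda>t. H (f t) (g t))"
  using continuous_on_compose2[OF H_continuous, of S "\<lambda>t. (f t, g t)"] by (auto intro: continuous_on_Pair)

lemma H_bounded: obtains B where "B > 0" "\<And>x p. norm p \<le> R \<Longrightarrow> \<bar>H x p\<bar> \<le> B"
proof -
  have "\<exists>B>0. \<forall>x. \<forall>p\<in>cball 0 R. norm (H (fst (x,p)) (snd (x,p))) \<le> B"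
    by (rule periodic_bounded[OF H_continuous]) (simp_all add: H_periodic)
  then show ?thesis using that by auto
qed

lemma Hx_bounded: obtains B where "B > 0" "\<And>x p. norm p \<le> R \<Longrightarrow> norm (Hx x p) \<le> B"
proof -
  have "\<exists>B>0. \<forall>x. \<forall>p\<in>cball 0 R. norm (Hx (fst (x,p)) (snd (x,p))) \<le> B"
    by (rule periodic_bounded[OF grad_H_continuous(1)]) (simp_all add: Hx_periodic)
  then show ?thesis using that by auto
qed

lemma Hp_bounded: obtains B where "B > 0" "\<And>x p. norm p \<le> R \<Longrightarrow> norm (Hp x p) \<le> B"
proof -
  have "\<exists>B>0. \<forall>x. \<forall>p\<in>cball 0 R. norm (Hp (fst (x,p)) (snd (x,p))) \<le> B"
    by (rule periodic_bounded[OF grad_H_continuous(2)]) (simp_all add: Hp_periodic)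
  then show ?thesis using that by auto
qed

lemma H_lipschitz_x:
  obtains C where "C > 0" "\<And>x y p. norm p \<le> R \<Longrightarrow> \<bar>H x p - H y p\<bar> \<le> C * norm (x - y)"
proof -
  obtain B where B: "B > 0" "\<And>x p. norm p \<le> R \<Longrightarrow> norm (Hx x p) \<le> B" using Hx_bounded[where R = R] by blast
  show ?thesis
  proof (rule that[OF B(1)])
    fix x y p :: "real^'n" assume p: "norm p \<le> R"
    obtain z where "H x p - H y p = Hx z p \<bullet> (x - y)"
      by (rule mean_value_segment[OF Hx_has_derivative]) blast
    then have "\<bar>H x p - H y p\<bar> \<le> norm (Hx z p) * norm (x - y)" using Cauchy_Schwarz_ineq2 by simp
    also have "\<dots> \<le> B * norm (x - y)" using B(2)[OF p] by (intro mult_right_mono) auto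
    finally show "\<bar>H x p - H y p\<bar> \<le> B * norm (x - y)" .
  qed
qed

text \<open>The cover is not compact. Close pairs are moved by a common lattice vector into a fixed
  compact set; for pairs at distance above 1 the sup bounds of the gradients suffice.\<close>

lemma grad_H_lipschitz:
  obtains K where "K > 0" "\<And>x p y q. norm p \<le> R \<Longrightarrow> norm q \<le> R \<Longrightarrow>
    norm (Hx x p - Hx y q) \<le> K * norm ((x,p) - (y,q)) \<and> norm (Hp x p - Hp y q) \<le> K * norm ((x,p) - (y,q))"
proof -
  obtain B1 where B1: "B1 > 0" "\<And>x p. norm p \<le> R \<Longrightarrow> norm (Hx x p) \<le> B1" using Hx_bounded[where R = R] by blast
  obtain B2 where B2: "B2 > 0" "\<And>x p. norm p \<le> R \<Longrightarrow> norm (Hp x p) \<le> B2" using Hp_bounded[where R = R] by blast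
  \<comment> \<open>The unit cube enlarged by 1 on every side: it also contains the second point of
    a pair whose first point lies in the cube and whose distance is at most 1.\<close>
  define S where "S = cbox (\<chi> i. -1) ((\<chi> i. 2) :: real^'n) \<times> cball (0 :: real^'n) R"
  have "compact S" "convex S" by (auto simp: S_def intro: compact_Times convex_Times)
  then obtain K where K: "K \<ge> 0" "\<And>z w. z \<in> S \<Longrightarrow> w \<in> S \<Longrightarrow>
       norm (Hx (fst z) (snd z) - Hx (fst w) (snd w)) \<le> K * norm (z - w) \<and>
       norm (Hp (fst z) (snd z) - Hp (fst w) (snd w)) \<le> K * norm (z - w)"
    using grad_H_lipschitz_compact by meson
  define M where "M = K + 2 * B1 + 2 * B2"
  have "M > 0" using K B1 B2 by (simp add: M_def)
  show ?thesis
  proof (rule that[OF \<open>M > 0\<close>])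
    fix x p y q :: "real^'n" assume pq: "norm p \<le> R" "norm q \<le> R"
    let ?d = "norm ((x,p) - (y,q))"
    show "norm (Hx x p - Hx y q) \<le> M * ?d \<and> norm (Hp x p - Hp y q) \<le> M * ?d"
    proof (cases "?d \<le> 1")
      case True
      obtain k where k: "k \<in> lattice" "x + k \<in> cbox 0 1" by (rule lattice_translate_into_cube)
      have "norm (x - y) \<le> 1" using True norm_fst_le[of "x - y" "p - q"] by simp
      then have "\<bar>x $ i - y $ i\<bar> \<le> 1" for i using component_le_norm_cart[of "x - y" i] by simp
      then have "(x + k, p) \<in> S" "(y + k, q) \<in> S"
        using k(2) pq by (auto simp: S_def mem_box_cart abs_le_iff) (smt (verit, best))+
      from K(2)[OF this] have "norm (Hx x p - Hx y q) \<le> K * ?d \<and> norm (Hp x p - Hp y q) \<le> K * ?d"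
        by (simp add: Hx_periodic[OF k(1)] Hp_periodic[OF k(1)])
      moreover have "K * ?d \<le> M * ?d" using K B1 B2 by (intro mult_right_mono) (auto simp: M_def)
      ultimately show ?thesis by linarith
    next
      case False
      have "norm (Hx x p - Hx y q) \<le> M" "norm (Hp x p - Hp y q) \<le> M"
        using norm_triangle_ineq4[of "Hx x p" "Hx y q"] norm_triangle_ineq4[of "Hp x p" "Hp y q"]
          B1(2)[OF pq(1), of x] B1(2)[OF pq(2), of y] B2(2)[OF pq(1), of x] B2(2)[OF pq(2), of y] K(1) B1(1) B2(1)
        unfolding M_def by linarith+
      moreover have "M \<le> M * ?d" using False \<open>M > 0\<close> by simp
      ultimately show ?thesis by linarith
    qed
  qed
qed

lemma Hp_strict_mono:
  assumes "p \<noteq> q"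
  shows "(Hp x q - Hp x p) \<bullet> (q - p) > 0"
proof -
  define \<phi> where "\<phi> s = Hp x (p + s *\<^sub>R (q - p)) \<bullet> (q - p)" for s :: real
  have pos: "\<exists>y. (\<phi> has_real_derivative y) (at s) \<and> y > 0" for s
  proof -
    let ?D = "frechet_derivative (Hp x) (at (p + s *\<^sub>R (q - p)))"
    have D: "(Hp x has_derivative ?D) (at (p + s *\<^sub>R (q - p)))"
      using Hp_differentiable frechet_derivative_works by blast
    have "((\<lambda>s. p + s *\<^sub>R (q - p)) has_derivative (\<lambda>h. h *\<^sub>R (q - p))) (at s)"
      by (auto intro!: derivative_eq_intros)
    from has_derivative_compose[OF this D]
    have "((\<lambda>s. Hp x (p + s *\<^sub>R (q - p)) \<bullet> (q - p)) has_derivative (\<lambda>h. ?D (h *\<^sub>R (q - p)) \<bullet> (q - p))) (at s)"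
      by (rule has_derivative_inner_left)
    moreover have "?D (h *\<^sub>R (q - p)) \<bullet> (q - p) = (?D (q - p) \<bullet> (q - p)) * h" for h
      using linear_scale[OF has_derivative_linear[OF D]] by simp
    ultimately have "(\<phi> has_real_derivative (?D (q - p) \<bullet> (q - p))) (at s)"
      unfolding has_field_derivative_def \<phi>_def by simp
    moreover have "?D (q - p) \<bullet> (q - p) > 0"
      using tonelli_H assms unfolding tonelli_def Hp_def[abs_def] by auto
    ultimately show ?thesis by blast
  qed
  have "\<phi> 0 < \<phi> 1" by (rule DERIV_pos_imp_increasing[OF zero_less_one]) (rule pos)
  then show ?thesis by (simp add: \<phi>_def inner_diff_left)
qed

lemma H_above_tangent:
  assumes "p \<noteq> q"
  shows "H x p + Hp x p \<bullet> (q - p) < H x q"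
proof -
  have "\<exists>s\<in>{0<..<1}. H x (p + 1 *\<^sub>R (q - p)) - H x (p + 0 *\<^sub>R (q - p)) = (\<lambda>h. Hp x (p + s *\<^sub>R (q - p)) \<bullet> (h *\<^sub>R (q - p))) (1 - 0)"
  proof (rule mvt_simple)
    fix s :: real
    have "((\<lambda>s. p + s *\<^sub>R (q - p)) has_derivative (\<lambda>h. h *\<^sub>R (q - p))) (at s within {0..1})"
      by (auto intro!: derivative_eq_intros)
    from has_derivative_compose[OF this Hp_has_derivative]
    show "((\<lambda>s. H x (p + s *\<^sub>R (q - p))) has_derivative (\<lambda>h. Hp x (p + s *\<^sub>R (q - p)) \<bullet> (h *\<^sub>R (q - p)))) (at s within {0..1})" .
  qed simp
  then obtain s where s: "0 < s" "s < 1" "H x q - H x p = Hp x (p + s *\<^sub>R (q - p)) \<bullet> (q - p)" by auto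
  have "(Hp x (p + s *\<^sub>R (q - p)) - Hp x p) \<bullet> (s *\<^sub>R (q - p)) > 0"
    using Hp_strict_mono[of p "p + s *\<^sub>R (q - p)" x] assms s by simp
  then have "(Hp x (p + s *\<^sub>R (q - p)) - Hp x p) \<bullet> (q - p) > 0"
    using s(1) by (simp add: zero_less_mult_iff)
  then show ?thesis using s(3) by (simp add: inner_diff_left)
qed

section \<open>The fibrewise Legendre transform and the regularity of the Lagrangian\<close>

lemma Hp_inj: "Hp x p = Hp x q \<Longrightarrow> p = q"
  using Hp_strict_mono[of p q x] by (cases "p = q") auto

text \<open>Minimise \<open>H x p - \<xi> \<bullet> p\<close> over \<open>p\<close>: growth of
  \<open>H\<close> with slope \<open>norm \<xi> + 1\<close> makes this coercive, and the gradient
  vanishes at the minimiser.\<close>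

lemma Hp_surj: "\<exists>p. Hp x p = \<xi>"
proof -
  obtain R where R: "\<And>x p. R \<le> norm p \<Longrightarrow> (norm \<xi> + 1) * norm p \<le> H x p" using H_superlinear by blast
  define F where "F p = H x p - \<xi> \<bullet> p" for p
  define R' where "R' = max R (\<bar>H x 0\<bar> + 1)"
  have big: "F p > F 0" if "norm p > R'" for p
  proof -
    have "\<xi> \<bullet> p \<le> norm \<xi> * norm p" by (rule norm_cauchy_schwarz)
    moreover have "(norm \<xi> + 1) * norm p \<le> H x p" using R[of p x] that by (simp add: R'_def)
    ultimately have "norm p \<le> F p" by (simp add: F_def algebra_simps)
    moreover have "norm p > H x 0" using that abs_ge_self[of "H x 0"] by (simp add: R'_def)
    ultimately show ?thesis by (simp add: F_def)
  qed
  have "continuous_on (cball 0 R') F" unfolding F_def by (intro continuous_intros)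
  moreover have "0 \<in> cball 0 R'" by (simp add: R'_def)
  ultimately obtain p0 where p0: "p0 \<in> cball 0 R'" "\<And>p. p \<in> cball 0 R' \<Longrightarrow> F p0 \<le> F p"
    using continuous_attains_inf[of "cball 0 R'" F] by (metis compact_cball empty_iff)
  have min: "F p0 \<le> F p" for p
    using p0(2)[of p] big[of p] p0(2)[OF \<open>0 \<in> cball 0 R'\<close>] by (cases "norm p \<le> R'") auto
  have "(F has_derivative (\<lambda>w. Hp x p0 \<bullet> w - \<xi> \<bullet> w)) (at p0)"
    unfolding F_def by (intro derivative_intros Hp_has_derivative)
  then have "(\<lambda>w. Hp x p0 \<bullet> w - \<xi> \<bullet> w) = (\<lambda>w. 0)"
    using differential_zero_maxmin[of p0 UNIV F] min by auto
  then have "(Hp x p0 - \<xi>) \<bullet> w = 0" for w by (metis inner_diff_left)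
  then show ?thesis by (metis eq_iff_diff_eq_0 inner_eq_zero_iff)
qed

text \<open>The momentum dual to a velocity, which \<open>grad_Lag_xi\<close> identifies with the
  velocity gradient of the Lagrangian.\<close>

definition Pm :: "real^'n \<Rightarrow> real^'n \<Rightarrow> real^'n" where "Pm x \<xi> = (THE p. Hp x p = \<xi>)"

lemma Hp_Pm [simp]: "Hp x (Pm x \<xi>) = \<xi>"
proof -
  obtain p where p: "Hp x p = \<xi>" using Hp_surj by blast
  then have "Pm x \<xi> = p" unfolding Pm_def by (intro the_equality) (metis Hp_inj)+
  then show ?thesis using p by simp
qed

lemma Pm_Hp [simp]: "Pm x (Hp x p) = p"
  by (rule Hp_inj[of x]) simp

text \<open>Invariance of domain: the map sending \<open>(x, p)\<close> to
  \<open>(x, Hp x p)\<close> is a continuous bijection between spaces of equal dimension, so its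
  inverse is continuous.\<close>

lemma Pm_continuous: "continuous_on UNIV (\<lambda>z. Pm (fst z) (snd z))"
proof -
  define \<Psi> where "\<Psi> z = (fst z, Hp (fst z) (snd z))" for z
  have "continuous_on UNIV \<Psi>" unfolding \<Psi>_def by (intro continuous_intros)
  moreover have "inj \<Psi>" unfolding \<Psi>_def by (rule injI) (auto intro: Hp_inj simp: prod_eq_iff)
  ultimately obtain g where g: "homeomorphism UNIV (range \<Psi>) \<Psi> g"
    using invariance_of_domain_homeomorphism[of UNIV \<Psi>] by auto
  have inv: "\<Psi> (fst z, Pm (fst z) (snd z)) = z" for z by (simp add: \<Psi>_def)
  have "range \<Psi> = UNIV" using inv by (rule surjI)
  moreover have "g z = (fst z, Pm (fst z) (snd z))" for z
    using homeomorphism_apply1[OF g UNIV_I, of "(fst z, Pm (fst z) (snd z))"] inv[of z] by simp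
  moreover have "continuous_on (range \<Psi>) (\<lambda>z. snd (g z))"
    using g by (auto simp: homeomorphism_def intro: continuous_intros)
  ultimately show ?thesis by simp
qed

lemma continuous_on_Pm [continuous_intros]:
  "continuous_on S f \<Longrightarrow> continuous_on S g \<Longrightarrow> continuous_on S (\<lambda>t. Pm (f t) (g t))"
  using continuous_on_compose2[OF Pm_continuous, of S "\<lambda>t. (f t, g t)"] by (auto intro: continuous_on_Pair)

lemma Pm_periodic: "k \<in> lattice \<Longrightarrow> Pm (x + k) \<xi> = Pm x \<xi>"
  unfolding Pm_def by (simp add: Hp_periodic)

lemma Lag_eq: "Lag H x \<xi> = \<xi> \<bullet> Pm x \<xi> - H x (Pm x \<xi>)"
proof -
  have "\<xi> \<bullet> p - H x p \<le> \<xi> \<bullet> Pm x \<xi> - H x (Pm x \<xi>)" for p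
    using H_above_tangent[of "Pm x \<xi>" p x] by (cases "p = Pm x \<xi>") (auto simp: inner_diff_right)
  then show ?thesis unfolding Lag_def by (intro cSup_eq_maximum) auto
qed

lemma Lag_Hp: "Lag H x (Hp x p) = Hp x p \<bullet> p - H x p"
  by (simp add: Lag_eq)

lemma fenchel: "\<xi> \<bullet> p \<le> Lag H x \<xi> + H x p"
  using H_above_tangent[of "Pm x \<xi>" p x] by (cases "p = Pm x \<xi>") (auto simp: Lag_eq inner_diff_right)

text \<open>The equality case of the Fenchel inequality; by strict convexity only one momentum
  attains it. This later identifies the momentum along a calibrated curve with \<open>c\<close> plus
  the gradient of \<open>v\<close>.\<close>

lemma fenchel_eq_imp:
  assumes "Lag H x \<xi> + H x p \<le> \<xi> \<bullet> p"
  shows "p = Pm x \<xi>"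
  using H_above_tangent[of "Pm x \<xi>" p x] assms by (cases "p = Pm x \<xi>") (auto simp: Lag_eq inner_diff_right)

lemma Lag_periodic: "k \<in> lattice \<Longrightarrow> Lag H (x + k) \<xi> = Lag H x \<xi>"
  by (simp add: Lag_eq Pm_periodic H_periodic)

lemma continuous_on_Lag [continuous_intros]:
  "continuous_on S f \<Longrightarrow> continuous_on S g \<Longrightarrow> continuous_on S (\<lambda>t. Lag H (f t) (g t))"
  unfolding Lag_eq by (intro continuous_intros)

lemma Lag_subgradient: "Lag H x \<xi> + Pm x \<xi> \<bullet> (\<eta> - \<xi>) \<le> Lag H x \<eta>"
  using fenchel[of \<eta> "Pm x \<xi>" x] by (simp add: Lag_eq[of x \<xi>] inner_diff_right inner_commute[of \<xi> "Pm x \<xi>"] inner_commute[of \<eta> "Pm x \<xi>"])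

lemma Lag_superlinear:
  assumes "K \<ge> 0"
  obtains C where "\<And>x \<xi>. K * norm \<xi> - C \<le> Lag H x \<xi>"
proof -
  obtain B where B: "B > 0" "\<And>x p. norm p \<le> K \<Longrightarrow> \<bar>H x p\<bar> \<le> B" using H_bounded[where R = K] by blast
  show ?thesis
  proof (rule that[of B])
    fix x \<xi> :: "real^'n"
    \<comment> \<open>A momentum of size \<open>K\<close> in the direction of \<open>\<xi>\<close>;
      for \<open>\<xi> = 0\<close>, division by zero yields \<open>p = 0\<close>, which also
      works.\<close>
    define p where "p = (K / norm \<xi>) *\<^sub>R \<xi>"
    have "norm p \<le> K" using assms by (simp add: p_def)
    moreover have "\<xi> \<bullet> p = K * norm \<xi>"
      by (cases "\<xi> = 0") (auto simp: p_def dot_square_norm power2_eq_square)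
    ultimately show "K * norm \<xi> - B \<le> Lag H x \<xi>" using fenchel[of \<xi> p x] B(2)[of p x] by linarith
  qed
qed

text \<open>An envelope argument: two Fenchel inequalities enclose the increment of the Lagrangian,
  and continuity of \<open>Pm\<close> closes the gap between them. No derivative of
  \<open>Pm\<close> enters.\<close>

lemma Lag_has_derivative:
  "((\<lambda>z. Lag H (fst z) (snd z)) has_derivative
     (\<lambda>w. - (Hx x (Pm x \<xi>) \<bullet> fst w) + Pm x \<xi> \<bullet> snd w)) (at (x,\<xi>))"
  unfolding has_derivative_at_alt
proof (intro conjI allI impI)
  show "bounded_linear (\<lambda>w. - (Hx x (Pm x \<xi>) \<bullet> fst w) + Pm x \<xi> \<bullet> snd w)"
    by (intro bounded_linear_intros bounded_linear_minus)
  fix e :: real assume "e > 0"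
  define p where "p = Pm x \<xi>"
  have "isCont (\<lambda>z. Hx (fst z) (snd z)) (x,p)"
    using grad_H_continuous(1) by (simp add: continuous_on_eq_continuous_at)
  then obtain d1 where d1: "d1 > 0" "\<And>z. dist z (x,p) < d1 \<Longrightarrow> dist (Hx (fst z) (snd z)) (Hx x p) < e / 2"
    using \<open>e > 0\<close> unfolding continuous_at_eps_delta by (metis fst_conv snd_conv half_gt_zero)
  have "isCont (\<lambda>z. Pm (fst z) (snd z)) (x,\<xi>)"
    using Pm_continuous by (simp add: continuous_on_eq_continuous_at)
  then obtain d2 where d2: "d2 > 0" "\<And>z. dist z (x,\<xi>) < d2 \<Longrightarrow> dist (Pm (fst z) (snd z)) p < min (e / 2) (d1 / 2)"
    using \<open>e > 0\<close> d1(1) unfolding continuous_at_eps_delta p_def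
    by (metis fst_conv snd_conv half_gt_zero min_less_iff_conj)
  have diffH: "\<bar>H x' q - H x q - Hx x p \<bullet> (x' - x)\<bar> \<le> e / 2 * norm (x' - x)"
    if "norm (x' - x) < d1 / 2" "dist q p < d1 / 2" for x' q
  proof -
    obtain y where y: "y \<in> closed_segment x x'" "H x' q - H x q = Hx y q \<bullet> (x' - x)"
      by (rule mean_value_segment[OF Hx_has_derivative])
    have "norm (y - x) < d1 / 2" using segment_bound(1)[OF y(1)] that(1) by simp
    then have "dist (y,q) (x,p) < d1"
      using that(2) norm_Pair_le[of "y - x" "q - p"] by (simp add: dist_norm)
    then have "norm (Hx y q - Hx x p) < e / 2" using d1(2)[of "(y,q)"] by (simp add: dist_norm)
    moreover have "\<bar>(Hx y q - Hx x p) \<bullet> (x' - x)\<bar> \<le> norm (Hx y q - Hx x p) * norm (x' - x)"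
      by (rule Cauchy_Schwarz_ineq2)
    ultimately have "\<bar>(Hx y q - Hx x p) \<bullet> (x' - x)\<bar> \<le> e / 2 * norm (x' - x)"
      by (smt (verit) mult_right_mono norm_ge_zero)
    then show ?thesis using y(2) by (simp add: inner_diff_left)
  qed
  define d where "d = min d2 (d1 / 2)"
  show "\<exists>d>0. \<forall>y. norm (y - (x,\<xi>)) < d \<longrightarrow>
     norm (Lag H (fst y) (snd y) - Lag H (fst (x,\<xi>)) (snd (x,\<xi>)) -
       (- (Hx x (Pm x \<xi>) \<bullet> fst (y - (x,\<xi>))) + Pm x \<xi> \<bullet> snd (y - (x,\<xi>)))) \<le> e * norm (y - (x,\<xi>))"
  proof (intro exI[of _ d] conjI allI impI)
    show "d > 0" using d1(1) d2(1) by (simp add: d_def)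
    fix y :: "(real^'n) \<times> (real^'n)" assume y: "norm (y - (x,\<xi>)) < d"
    obtain x' \<xi>' where [simp]: "y = (x',\<xi>')" by (cases y)
    define p' where "p' = Pm x' \<xi>'"
    have nx: "norm (x' - x) \<le> norm (y - (x,\<xi>))" using norm_fst_le[of "x' - x" "\<xi>' - \<xi>"] by simp
    have nxi: "norm (\<xi>' - \<xi>) \<le> norm (y - (x,\<xi>))" using norm_snd_le[of "\<xi>' - \<xi>" "x' - x"] by simp
    have pp: "dist p' p < e / 2" "dist p' p < d1 / 2"
      using d2(2)[of y] y by (auto simp: p'_def d_def dist_norm)
    have xx: "norm (x' - x) < d1 / 2" using nx y by (simp add: d_def)
    have a: "\<bar>H x' p - H x p - Hx x p \<bullet> (x' - x)\<bar> \<le> e / 2 * norm (x' - x)"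
      using diffH[OF xx] d1(1) by simp
    have b: "\<bar>H x' p' - H x p' - Hx x p \<bullet> (x' - x)\<bar> \<le> e / 2 * norm (x' - x)"
      using diffH[OF xx pp(2)] .
    have c: "(p' - p) \<bullet> (\<xi>' - \<xi>) \<le> e / 2 * norm (\<xi>' - \<xi>)"
      using norm_cauchy_schwarz[of "p' - p" "\<xi>' - \<xi>"] pp(1)
      by (smt (verit) dist_norm mult_right_mono norm_ge_zero)
    \<comment> \<open>The upper bound takes the dual momentum of the new point as a competitor at
      the old one; the lower bound below takes the old momentum as a competitor at the new
      point.\<close>
    have up: "Lag H x' \<xi>' - Lag H x \<xi> \<le> (\<xi>' - \<xi>) \<bullet> p' - (H x' p' - H x p')"
      using fenchel[of \<xi> p' x] by (simp add: Lag_eq[of x' \<xi>'] p'_def[symmetric] inner_diff_left)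
    have lo: "(\<xi>' - \<xi>) \<bullet> p - (H x' p - H x p) \<le> Lag H x' \<xi>' - Lag H x \<xi>"
      using fenchel[of \<xi>' p x'] by (simp add: Lag_eq[of x \<xi>] p_def[symmetric] inner_diff_left)
    define \<Delta> where "\<Delta> = Lag H x' \<xi>' - Lag H x \<xi> - (- (Hx x p \<bullet> (x' - x)) + p \<bullet> (\<xi>' - \<xi>))"
    have 1: "\<Delta> \<le> e / 2 * norm (\<xi>' - \<xi>) + e / 2 * norm (x' - x)"
    proof -
      have "(\<xi>' - \<xi>) \<bullet> p' - p \<bullet> (\<xi>' - \<xi>) \<le> e / 2 * norm (\<xi>' - \<xi>)"
        using c by (simp add: inner_diff_left inner_diff_right inner_commute)
      then show ?thesis using up b unfolding \<Delta>_def by linarith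
    qed
    have 2: "- \<Delta> \<le> e / 2 * norm (x' - x)"
      using lo a inner_commute[of "\<xi>' - \<xi>" p] unfolding \<Delta>_def by linarith
    have "e / 2 * norm (x' - x) \<le> e / 2 * norm (y - (x,\<xi>))" "e / 2 * norm (\<xi>' - \<xi>) \<le> e / 2 * norm (y - (x,\<xi>))"
      using nx nxi \<open>e > 0\<close> by (auto intro!: mult_left_mono)
    then have "\<bar>\<Delta>\<bar> \<le> e * norm (y - (x,\<xi>))" using 1 2 by (simp add: abs_le_iff)
    then show "norm (Lag H (fst y) (snd y) - Lag H (fst (x,\<xi>)) (snd (x,\<xi>)) -
       (- (Hx x (Pm x \<xi>) \<bullet> fst (y - (x,\<xi>))) + Pm x \<xi> \<bullet> snd (y - (x,\<xi>)))) \<le> e * norm (y - (x,\<xi>))"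
      by (simp add: \<Delta>_def p_def)
  qed
qed

lemma Lag_has_derivative_xi: "(Lag H x has_derivative (\<lambda>w. Pm x \<xi> \<bullet> w)) (at \<xi>)"
proof -
  have "((\<lambda>q. (x,q)) has_derivative (\<lambda>w. (0,w))) (at \<xi>)" by (auto intro!: derivative_eq_intros)
  from has_derivative_compose[OF this Lag_has_derivative] show ?thesis by simp
qed

lemma Lag_has_derivative_x: "((\<lambda>y. Lag H y \<xi>) has_derivative (\<lambda>w. (- Hx x (Pm x \<xi>)) \<bullet> w)) (at x)"
proof -
  have "((\<lambda>q. (q,\<xi>)) has_derivative (\<lambda>w. (w,0))) (at x)" by (auto intro!: derivative_eq_intros)
  from has_derivative_compose[OF this Lag_has_derivative] show ?thesis by (simp add: inner_minus_left)
qed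

lemma grad_Lag_xi: "grad (Lag H x) \<xi> = Pm x \<xi>"
  by (rule grad_eqI[OF Lag_has_derivative_xi])

lemma grad_Lag_x: "grad (\<lambda>y. Lag H y \<xi>) x = - Hx x (Pm x \<xi>)"
  by (rule grad_eqI[OF Lag_has_derivative_x])

lemma Pm_bounded: obtains B where "B > 0" "\<And>x \<xi>. norm \<xi> \<le> R \<Longrightarrow> norm (Pm x \<xi>) \<le> B"
proof -
  have "\<exists>B>0. \<forall>x. \<forall>p\<in>cball 0 R. norm (Pm (fst (x,p)) (snd (x,p))) \<le> B"
    by (rule periodic_bounded[OF Pm_continuous]) (simp_all add: Pm_periodic)
  then show ?thesis using that by auto
qed

lemma Lag_bounded: obtains B where "B > 0" "\<And>x \<xi>. norm \<xi> \<le> R \<Longrightarrow> \<bar>Lag H x \<xi>\<bar> \<le> B"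
proof -
  have "continuous_on UNIV (\<lambda>z. Lag H (fst z) (snd z))" by (intro continuous_intros)
  then have "\<exists>B>0. \<forall>x. \<forall>p\<in>cball 0 R. norm (Lag H (fst (x,p)) (snd (x,p))) \<le> B"
    by (rule periodic_bounded) (simp_all add: Lag_periodic)
  then show ?thesis using that by auto
qed

lemma Lag_lipschitz_x:
  obtains C where "C > 0" "\<And>x y \<xi>. norm \<xi> \<le> R \<Longrightarrow> \<bar>Lag H x \<xi> - Lag H y \<xi>\<bar> \<le> C * norm (x - y)"
proof -
  obtain P where P: "P > 0" "\<And>x \<xi>. norm \<xi> \<le> R \<Longrightarrow> norm (Pm x \<xi>) \<le> P" using Pm_bounded[where R = R] by blast
  obtain B where B: "B > 0" "\<And>x p. norm p \<le> P \<Longrightarrow> norm (Hx x p) \<le> B" using Hx_bounded[where R = P] by blast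
  show ?thesis
  proof (rule that[OF B(1)])
    fix x y \<xi> :: "real^'n" assume \<xi>: "norm \<xi> \<le> R"
    obtain z where "Lag H x \<xi> - Lag H y \<xi> = (- Hx z (Pm z \<xi>)) \<bullet> (x - y)"
      by (rule mean_value_segment[OF Lag_has_derivative_x]) blast
    then have "\<bar>Lag H x \<xi> - Lag H y \<xi>\<bar> \<le> norm (- Hx z (Pm z \<xi>)) * norm (x - y)"
      using Cauchy_Schwarz_ineq2 by metis
    also have "\<dots> \<le> B * norm (x - y)" using B(2)[OF P(2)[OF \<xi>]] by (intro mult_right_mono) auto
    finally show "\<bar>Lag H x \<xi> - Lag H y \<xi>\<bar> \<le> B * norm (x - y)" .
  qed
qed

end

section \<open>The Hamiltonian flow\<close>

text \<open>The oriented integral from 0 to \<open>t\<close>: whichever of the two intervals runs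
  backward is empty and contributes 0.\<close>

definition signed_integral :: "(real \<Rightarrow> 'a::euclidean_space) \<Rightarrow> real \<Rightarrow> 'a" where
  "signed_integral g t = integral {0..t} g - integral {t..0} g"

lemma signed_integral_has_vector_derivative:
  fixes g :: "real \<Rightarrow> 'a::euclidean_space"
  assumes g: "continuous_on UNIV g"
  shows "(signed_integral g has_vector_derivative g t) (at t)"
proof -
  define a where "a = min t 0 - 1"
  define b where "b = max t 0 + 1"
  have int: "g integrable_on {u..w}" for u w
    by (rule integrable_continuous_real) (use g in \<open>auto intro: continuous_on_subset\<close>)
  have zero: "integral {u..w} g = 0" if "w \<le> u" for u w :: real
    using that by (cases "u = w") (auto simp: atLeastatMost_empty)
  have eq: "integral {a..u} g - integral {a..0} g = signed_integral g u" if "u \<in> {a<..<b}" for u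
  proof (cases "0 \<le> u")
    case True
    then show ?thesis
      using Henstock_Kurzweil_Integration.integral_combine[of a 0 u g] int zero[of 0 u]
      by (simp add: signed_integral_def a_def algebra_simps)
  next
    case False
    then show ?thesis
      using Henstock_Kurzweil_Integration.integral_combine[of a u 0 g] int zero[of u 0] that
      by (simp add: signed_integral_def algebra_simps)
  qed
  have ab: "t \<in> {a<..<b}" by (auto simp: a_def b_def)
  have "((\<lambda>u. integral {a..u} g) has_vector_derivative g t) (at t within {a..b})"
    by (rule integral_has_vector_derivative) (use g ab in \<open>auto intro: continuous_on_subset\<close>)
  then have "((\<lambda>u. integral {a..u} g) has_vector_derivative g t) (at t)"
    using ab at_within_Icc_at[of a t b] by simp
  then have "((\<lambda>u. integral {a..u} g - integral {a..0} g) has_vector_derivative g t) (at t)"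
    by (auto intro!: derivative_eq_intros)
  then show ?thesis
    by (rule has_vector_derivative_transform_within_open[of _ _ _ "{a<..<b}"]) (use ab eq in auto)
qed

text \<open>Integrating against the exponential weight gains the factor \<open>1 / l\<close>, which
  is the source of the contraction below.\<close>

lemma signed_integral_exp_bound:
  fixes g :: "real \<Rightarrow> 'a::euclidean_space"
  assumes g: "continuous_on UNIV g" and bd: "\<And>s. norm (g s) \<le> C * exp (l * \<bar>s\<bar>)" and "l > 0" "C \<ge> 0"
  shows "norm (signed_integral g t) \<le> C / l * exp (l * \<bar>t\<bar>)"
proof (cases "t \<ge> 0")
  case True
  have hi: "((\<lambda>s. C * exp (l * s)) has_integral (C / l * exp (l * t) - C / l * exp (l * 0))) {0..t}"
    by (rule fundamental_theorem_of_calculus[OF True])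
       (use \<open>l > 0\<close> in \<open>auto intro!: derivative_eq_intros simp: has_real_derivative_iff_has_vector_derivative[symmetric]\<close>)
  note i = integral_unique[OF hi] and ii = has_integral_integrable[OF hi]
  have "norm (integral {0..t} g) \<le> integral {0..t} (\<lambda>s. C * exp (l * s))"
    by (rule integral_norm_bound_integral)
       (use g bd ii in \<open>auto intro!: integrable_continuous_real continuous_on_subset[OF g] simp: order_trans[OF bd]\<close>)
  moreover have "integral {t..0} g = 0" using True by (cases "t = 0") auto
  moreover have "C / l \<ge> 0" using assms by simp
  ultimately show ?thesis unfolding i using True by (simp add: signed_integral_def)
next
  case False
  then have "t \<le> 0" by simp
  have hi: "((\<lambda>s. C * exp (- l * s)) has_integral (- C / l * exp (- l * 0) - (- C / l * exp (- l * t)))) {t..0}"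
    by (rule fundamental_theorem_of_calculus[OF \<open>t \<le> 0\<close>])
       (use \<open>l > 0\<close> in \<open>auto intro!: derivative_eq_intros simp: has_real_derivative_iff_has_vector_derivative[symmetric]\<close>)
  note i = integral_unique[OF hi] and ii = has_integral_integrable[OF hi]
  have "norm (g s) \<le> C * exp (- l * s)" if "s \<in> {t..0}" for s
    using bd[of s] that by simp
  then have "norm (integral {t..0} g) \<le> integral {t..0} (\<lambda>s. C * exp (- l * s))"
    by (intro integral_norm_bound_integral)
       (use g ii in \<open>auto intro!: integrable_continuous_real continuous_on_subset[OF g]\<close>)
  moreover have "C / l \<ge> 0" using assms by simp
  moreover have "integral {0..t} g = 0" using False by simp
  ultimately show ?thesis unfolding i using False by (simp add: signed_integral_def)
qed

text \<open>Picard iteration in an exponentially weighted sup norm. With \<open>z\<close> written as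
  \<open>z0\<close> plus the weight times a bounded continuous function, the integral operator
  contracts on the whole line, so one fixed point gives the global solution.\<close>

lemma lipschitz_ode_exists:
  fixes F :: "'a::euclidean_space \<Rightarrow> 'a"
  assumes F: "K-lipschitz_on UNIV F"
  shows "\<exists>z. z 0 = z0 \<and> (\<forall>t. (z has_vector_derivative F (z t)) (at t))"
proof -
  have K: "K \<ge> 0" using F by (rule lipschitz_on_nonneg)
  have FK: "norm (F u - F w) \<le> K * norm (u - w)" for u w using lipschitz_on_normD[OF F] by auto
  have Fc: "continuous_on UNIV F" using F by (rule lipschitz_on_continuous_on)
  \<comment> \<open>Any rate above \<open>K\<close> makes \<open>K / l\<close> smaller than 1;
    adding 1 also covers \<open>K = 0\<close>.\<close>
  define l where "l = K + 1"
  have "l > 0" using K by (simp add: l_def)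
  define G where "G y s = F (z0 + exp (l * \<bar>s\<bar>) *\<^sub>R apply_bcontfun y s)" for y :: "real \<Rightarrow>\<^sub>C 'a" and s
  have Gc: "continuous_on UNIV (G y)" for y
    unfolding G_def by (intro continuous_on_compose2[OF Fc] continuous_intros) auto
  define T where "T y = Bcontfun (\<lambda>t. exp (- l * \<bar>t\<bar>) *\<^sub>R signed_integral (G y) t)" for y
  have sc: "continuous_on UNIV (signed_integral (G y))" for y
    using signed_integral_has_vector_derivative[OF Gc]
    by (intro continuous_at_imp_continuous_on ballI) (metis has_vector_derivative_continuous)
  have T: "apply_bcontfun (T y) t = exp (- l * \<bar>t\<bar>) *\<^sub>R signed_integral (G y) t" for y t
  proof -
    have "(\<lambda>t. exp (- l * \<bar>t\<bar>) *\<^sub>R signed_integral (G y) t) \<in> bcontfun"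
    proof (rule bcontfun_normI)
      show "continuous_on UNIV (\<lambda>t. exp (- l * \<bar>t\<bar>) *\<^sub>R signed_integral (G y) t)"
        by (intro continuous_intros sc)
      fix t
      define C where "C = norm (F z0) + K * norm y"
      have "norm (G y s) \<le> C * exp (l * \<bar>s\<bar>)" for s
      proof -
        have "norm (G y s) \<le> norm (F z0) + norm (G y s - F z0)" by (metis add.commute norm_triangle_sub)
        also have "norm (G y s - F z0) \<le> K * norm (exp (l * \<bar>s\<bar>) *\<^sub>R apply_bcontfun y s)"
          unfolding G_def using FK by (metis add_diff_cancel_left')
        also have "\<dots> \<le> K * (exp (l * \<bar>s\<bar>) * norm y)"
          using K norm_bounded[of y s] by (intro mult_left_mono) auto
        also have "norm (F z0) \<le> norm (F z0) * exp (l * \<bar>s\<bar>)"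
          using \<open>l > 0\<close> by (simp add: mult_le_cancel_left1)
        finally show ?thesis by (simp add: C_def algebra_simps)
      qed
      then have "norm (signed_integral (G y) t) \<le> C / l * exp (l * \<bar>t\<bar>)"
        using K by (intro signed_integral_exp_bound Gc \<open>l > 0\<close>) (auto simp: C_def)
      then show "norm (exp (- l * \<bar>t\<bar>) *\<^sub>R signed_integral (G y) t) \<le> (norm (F z0) + K * norm y) / l"
        by (simp add: C_def exp_minus field_simps)
    qed
    then show ?thesis by (simp add: T_def Bcontfun_inverse)
  qed
  have "dist (T y1) (T y2) \<le> (K / l) * dist y1 y2" for y1 y2
  proof (rule dist_bound)
    fix t
    have int: "G y integrable_on {u..w}" for y u w
      by (rule integrable_continuous_real) (auto intro: continuous_on_subset[OF Gc])
    have "signed_integral (G y1) t - signed_integral (G y2) t = signed_integral (\<lambda>s. G y1 s - G y2 s) t"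
      by (simp add: signed_integral_def int integral_diff)
    moreover have "norm (signed_integral (\<lambda>s. G y1 s - G y2 s) t) \<le> (K * dist y1 y2) / l * exp (l * \<bar>t\<bar>)"
    proof (rule signed_integral_exp_bound)
      show "continuous_on UNIV (\<lambda>s. G y1 s - G y2 s)" by (intro continuous_intros Gc)
      fix s
      have "norm (G y1 s - G y2 s) \<le> K * norm (exp (l * \<bar>s\<bar>) *\<^sub>R apply_bcontfun y1 s - exp (l * \<bar>s\<bar>) *\<^sub>R apply_bcontfun y2 s)"
        unfolding G_def using FK by (metis add_diff_cancel_left)
      also have "\<dots> = K * (exp (l * \<bar>s\<bar>) * dist (apply_bcontfun y1 s) (apply_bcontfun y2 s))"
        by (simp add: dist_norm scaleR_diff_right[symmetric])
      also have "\<dots> \<le> K * (exp (l * \<bar>s\<bar>) * dist y1 y2)"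
        using K dist_bounded[of y1 s y2] by (intro mult_left_mono) auto
      finally show "norm (G y1 s - G y2 s) \<le> K * dist y1 y2 * exp (l * \<bar>s\<bar>)" by (simp add: ac_simps)
    qed (use \<open>l > 0\<close> K in auto)
    ultimately show "dist (apply_bcontfun (T y1) t) (apply_bcontfun (T y2) t) \<le> (K / l) * dist y1 y2"
      by (simp add: T dist_norm scaleR_diff_right[symmetric] exp_minus field_simps)
  qed
  moreover have "0 \<le> K / l" "K / l < 1" using K by (auto simp: l_def)
  ultimately obtain y where y: "T y = y" using banach_fix_type[of "K / l" T] by auto
  define z where "z t = z0 + exp (l * \<bar>t\<bar>) *\<^sub>R apply_bcontfun y t" for t
  have zeq: "z = (\<lambda>t. z0 + signed_integral (G y) t)"
  proof
    fix t
    have "apply_bcontfun y t = exp (- l * \<bar>t\<bar>) *\<^sub>R signed_integral (G y) t" using T[of y t] y by simp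
    then show "z t = z0 + signed_integral (G y) t" by (simp add: z_def exp_minus)
  qed
  have "(z has_vector_derivative F (z t)) (at t)" for t
  proof -
    have "(z has_vector_derivative G y t) (at t)"
      unfolding zeq by (auto intro!: derivative_eq_intros signed_integral_has_vector_derivative[OF Gc])
    moreover have "G y t = F (z t)" by (simp add: G_def z_def)
    ultimately show ?thesis by simp
  qed
  moreover have "z 0 = z0" by (simp add: zeq signed_integral_def)
  ultimately show ?thesis by blast
qed

text \<open>The Gronwall inequality for the squared distance, in both time directions. The
  assumptions concern only times between 0 and \<open>t\<close> and only the two curves, so
  solutions known on an interval can be compared as well.\<close>

lemma ode_dependence:
  fixes z w :: "real \<Rightarrow> 'a::real_inner"
  assumes z: "\<And>\<tau>. \<tau> \<in> closed_segment 0 t \<Longrightarrow> (z has_vector_derivative z' \<tau>) (at \<tau>)"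
    and w: "\<And>\<tau>. \<tau> \<in> closed_segment 0 t \<Longrightarrow> (w has_vector_derivative w' \<tau>) (at \<tau>)"
    and K: "\<And>\<tau>. \<tau> \<in> closed_segment 0 t \<Longrightarrow> norm (z' \<tau> - w' \<tau>) \<le> K * norm (z \<tau> - w \<tau>)"
  shows "norm (z t - w t) \<le> exp (K * \<bar>t\<bar>) * norm (z 0 - w 0)"
proof -
  define u where "u t = (z t - w t) \<bullet> (z t - w t)" for t
  define u' where "u' t = 2 * ((z t - w t) \<bullet> (z' t - w' t))" for t
  have u: "(u has_real_derivative u' \<tau>) (at \<tau>)" if "\<tau> \<in> closed_segment 0 t" for \<tau>
  proof -
    have zw: "((\<lambda>t. z t - w t) has_derivative (\<lambda>h. h *\<^sub>R (z' \<tau> - w' \<tau>))) (at \<tau>)"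
      using has_vector_derivative_diff[OF z w] that by (simp add: has_vector_derivative_def)
    show ?thesis unfolding has_field_derivative_def u_def
      by (rule has_derivative_eq_rhs[OF has_derivative_inner[OF zw zw]])
         (auto simp: u'_def inner_commute algebra_simps)
  qed
  have u'b: "\<bar>u' \<tau>\<bar> \<le> 2 * K * u \<tau>" if "\<tau> \<in> closed_segment 0 t" for \<tau>
  proof -
    have "\<bar>(z \<tau> - w \<tau>) \<bullet> (z' \<tau> - w' \<tau>)\<bar> \<le> norm (z \<tau> - w \<tau>) * norm (z' \<tau> - w' \<tau>)" by (rule Cauchy_Schwarz_ineq2)
    also have "\<dots> \<le> norm (z \<tau> - w \<tau>) * (K * norm (z \<tau> - w \<tau>))" by (intro mult_left_mono K that) auto
    also have "\<dots> = K * u \<tau>" by (simp add: u_def dot_square_norm power2_eq_square)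
    finally show ?thesis by (simp add: u'_def)
  qed
  have le: "u t \<le> exp (2 * K * \<bar>t\<bar>) * u 0"
  proof (cases "t \<ge> 0")
    case True
    have "exp (- 2 * K * t) * u t \<le> exp (- 2 * K * 0) * u 0"
    proof (rule DERIV_nonpos_imp_nonincreasing[OF True])
      fix s assume "0 \<le> s" "s \<le> t"
      then have s: "s \<in> closed_segment 0 t" by (simp add: closed_segment_eq_real_ivl)
      have "((\<lambda>s. exp (- 2 * K * s) * u s) has_real_derivative (exp (- 2 * K * s) * (u' s - 2 * K * u s))) (at s)"
        by (auto intro!: derivative_eq_intros u[OF s] simp: algebra_simps)
      moreover have "exp (- 2 * K * s) * (u' s - 2 * K * u s) \<le> 0"
        using u'b[OF s] by (simp add: mult_le_0_iff abs_le_iff)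
      ultimately show "\<exists>y. ((\<lambda>s. exp (- 2 * K * s) * u s) has_real_derivative y) (at s) \<and> y \<le> 0" by blast
    qed
    then show ?thesis using True by (simp add: exp_minus field_simps)
  next
    case False
    then have "t \<le> 0" by simp
    have "exp (2 * K * t) * u t \<le> exp (2 * K * 0) * u 0"
    proof (rule DERIV_nonneg_imp_nondecreasing[OF \<open>t \<le> 0\<close>])
      fix s assume "t \<le> s" "s \<le> 0"
      then have s: "s \<in> closed_segment 0 t" by (simp add: closed_segment_eq_real_ivl)
      have "((\<lambda>s. exp (2 * K * s) * u s) has_real_derivative (exp (2 * K * s) * (u' s + 2 * K * u s))) (at s)"
        by (auto intro!: derivative_eq_intros u[OF s] simp: algebra_simps)
      moreover have "exp (2 * K * s) * (u' s + 2 * K * u s) \<ge> 0"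
        using u'b[OF s] by (simp add: abs_le_iff)
      ultimately show "\<exists>y. ((\<lambda>s. exp (2 * K * s) * u s) has_real_derivative y) (at s) \<and> y \<ge> 0" by blast
    qed
    then show ?thesis using False by (simp add: exp_minus field_simps)
  qed
  have "(norm (z t - w t))\<^sup>2 \<le> (exp (K * \<bar>t\<bar>) * norm (z 0 - w 0))\<^sup>2"
    using le by (simp add: u_def dot_square_norm power_mult_distrib exp_double[symmetric] mult.assoc)
  then show ?thesis by (rule power2_le_imp_le) simp
qed

section \<open>Hamiltonian orbits, energy and the Euler-Lagrange flow\<close>

context tonelli_hamiltonian
begin

definition vf :: "(real^'n) \<times> (real^'n) \<Rightarrow> (real^'n) \<times> (real^'n)" where
  "vf z = (Hp (fst z) (snd z), - Hx (fst z) (snd z))"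

definition ham :: "(real \<Rightarrow> (real^'n) \<times> (real^'n)) \<Rightarrow> bool" where
  "ham z \<longleftrightarrow> (\<forall>s. (z has_vector_derivative vf (z s)) (at s))"

lemma ham_fst: "ham z \<Longrightarrow> ((\<lambda>s. fst (z s)) has_vector_derivative Hp (fst (z s)) (snd (z s))) (at s)"
  using bounded_linear.has_vector_derivative[OF bounded_linear_fst, of z "vf (z s)" "at s"]
  by (simp add: ham_def vf_def)

lemma ham_snd: "ham z \<Longrightarrow> ((\<lambda>s. snd (z s)) has_vector_derivative - Hx (fst (z s)) (snd (z s))) (at s)"
  using bounded_linear.has_vector_derivative[OF bounded_linear_snd, of z "vf (z s)" "at s"]
  by (simp add: ham_def vf_def)

lemma Ham_solution_iff: "Ham_solution H X P \<longleftrightarrow> ham (\<lambda>s. (X s, P s))"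
proof
  assume "Ham_solution H X P"
  then show "ham (\<lambda>s. (X s, P s))"
    unfolding Ham_solution_def ham_def vf_def Hx_def Hp_def by (auto intro!: has_vector_derivative_Pair)
next
  assume "ham (\<lambda>s. (X s, P s))"
  then show "Ham_solution H X P"
    using ham_fst[of "\<lambda>s. (X s, P s)"] ham_snd[of "\<lambda>s. (X s, P s)"] by (simp add: Ham_solution_def Hx_def Hp_def)
qed

lemma H_along_has_derivative:
  assumes "(z has_vector_derivative z') (at s)"
  shows "((\<lambda>s. H (fst (z s)) (snd (z s))) has_real_derivative
     (Hx (fst (z s)) (snd (z s)) \<bullet> fst z' + Hp (fst (z s)) (snd (z s)) \<bullet> snd z')) (at s)"
proof -
  have D: "((\<lambda>z. H (fst z) (snd z)) has_derivative (\<lambda>w. Hx (fst (z s)) (snd (z s)) \<bullet> fst w + Hp (fst (z s)) (snd (z s)) \<bullet> snd w)) (at (z s))"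
    using H_has_derivative[of "fst (z s)" "snd (z s)"] by simp
  have "(z has_derivative (\<lambda>h. h *\<^sub>R z')) (at s)" using assms by (simp add: has_vector_derivative_def)
  from has_derivative_compose[OF this D] show ?thesis
    unfolding has_field_derivative_def by (rule has_derivative_eq_rhs) (auto simp: algebra_simps)
qed

lemma energy_conserved:
  assumes "ham z"
  shows "H (fst (z s)) (snd (z s)) = H (fst (z 0)) (snd (z 0))"
proof -
  have "((\<lambda>s. H (fst (z s)) (snd (z s))) has_real_derivative 0) (at s)" for s
    using H_along_has_derivative[of z "vf (z s)" s] assms by (simp add: ham_def vf_def inner_commute)
  then show ?thesis using DERIV_isconst_all[of "\<lambda>s. H (fst (z s)) (snd (z s))" s 0] by blast
qed

lemma sublevel_bounded: obtains R where "R > 0" "\<And>x p. H x p \<le> E \<Longrightarrow> norm p < R"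
proof -
  obtain R where R: "\<And>x p. R \<le> norm p \<Longrightarrow> (\<bar>E\<bar> + 1) * norm p \<le> H x p" using H_superlinear by blast
  show ?thesis
  proof (rule that[of "max R 1"])
    fix x p assume "H x p \<le> E"
    show "norm p < max R 1"
    proof (rule ccontr)
      assume "\<not> norm p < max R 1"
      then have "(\<bar>E\<bar> + 1) * norm p \<le> H x p" "norm p \<ge> 1" using R by auto
      have "E < (\<bar>E\<bar> + 1) * 1" by simp
      also have "\<dots> \<le> (\<bar>E\<bar> + 1) * norm p" using \<open>norm p \<ge> 1\<close> by (intro mult_left_mono) auto
      also have "\<dots> \<le> H x p" by fact
      finally show False using \<open>H x p \<le> E\<close> by simp
    qed
  qed simp
qed

lemma ham_exists: "\<exists>z. ham z \<and> z 0 = z0"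
proof -
  define E where "E = H (fst z0) (snd z0)"
  obtain R where R: "R > 0" "\<And>x p. H x p \<le> E \<Longrightarrow> norm p < R" using sublevel_bounded[where E = E] by blast
  obtain K where K: "K > 0" "\<And>x p y q. norm p \<le> R \<Longrightarrow> norm q \<le> R \<Longrightarrow>
    norm (Hx x p - Hx y q) \<le> K * norm ((x,p) - (y,q)) \<and> norm (Hp x p - Hp y q) \<le> K * norm ((x,p) - (y,q))"
    using grad_H_lipschitz[where R = R] by blast
  \<comment> \<open>Truncating the momentum makes the field globally Lipschitz; conservation of energy keeps the
    truncated solution inside the ball, where nothing was changed.\<close>
  define c where "c p = closest_point (cball 0 R) p" for p :: "real^'n"
  have ne: "cball (0::real^'n) R \<noteq> {}" using R(1) by auto
  have c1: "norm (c p) \<le> R" for p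
    using closest_point_in_set[of "cball 0 R" p] ne by (simp add: c_def)
  have c2: "c p = p" if "norm p \<le> R" for p using that by (simp add: c_def closest_point_self)
  have c3: "norm (c p - c q) \<le> norm (p - q)" for p q
    using closest_point_lipschitz[of "cball 0 R" p q] ne by (simp add: c_def dist_norm)
  define F where "F z = vf (fst z, c (snd z))" for z
  have "(2 * K)-lipschitz_on UNIV F"
  proof (rule lipschitz_onI)
    fix z w :: "(real^'n) \<times> (real^'n)"
    obtain x p y q where [simp]: "z = (x,p)" "w = (y,q)" by (cases z, cases w)
    have "norm ((x, c p) - (y, c q)) \<le> norm ((x,p) - (y,q))"
      using c3[of p q] by (auto simp: norm_Pair intro!: real_sqrt_le_mono add_mono power_mono)
    then have "K * norm ((x, c p) - (y, c q)) \<le> K * dist z w"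
      using K(1) by (simp add: dist_norm)
    moreover note K(2)[OF c1[of p] c1[of q], of x y]
    moreover have "dist (F z) (F w) \<le> norm (Hp x (c p) - Hp y (c q)) + norm (Hx x (c p) - Hx y (c q))"
      using norm_Pair_le[of "Hp x (c p) - Hp y (c q)" "- (Hx x (c p) - Hx y (c q))"]
      by (simp add: F_def vf_def dist_norm norm_minus_commute)
    ultimately show "dist (F z) (F w) \<le> 2 * K * dist z w" by linarith
  qed (use K in simp)
  then obtain z where z: "z 0 = z0" "\<And>t. (z has_vector_derivative F (z t)) (at t)"
    using lipschitz_ode_exists[of "2 * K" F z0] by blast
  have zc: "continuous_on UNIV z"
    by (intro continuous_at_imp_continuous_on ballI) (metis z(2) has_vector_derivative_continuous)
  \<comment> \<open>The times at which the energy still has its initial value. The set is closed by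
    continuity. It is open because such a time has momentum strictly inside the ball, where
    truncated and true field agree nearby and the energy is locally constant. Connectedness of the
    line concludes.\<close>
  define S where "S = {t. H (fst (z t)) (snd (z t)) = E}"
  have F_vf: "F (z t) = vf (z t)" if "norm (snd (z t)) < R" for t
    using c2[of "snd (z t)"] that by (simp add: F_def)
  have "closed S" unfolding S_def
    by (intro closed_Collect_eq continuous_on_H continuous_intros continuous_on_fst continuous_on_snd zc)
  moreover have "open S"
    unfolding open_contains_ball
  proof
    fix t assume "t \<in> S"
    then have "norm (snd (z t)) < R" using R(2) by (auto simp: S_def)
    moreover have "open {t. norm (snd (z t)) < R}"
      by (intro open_Collect_less continuous_intros zc)
    ultimately obtain d where d: "d > 0" "ball t d \<subseteq> {t. norm (snd (z t)) < R}"
      by (metis (mono_tags, lifting) openE mem_Collect_eq)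
    have "((\<lambda>s. H (fst (z s)) (snd (z s))) has_derivative (\<lambda>h. 0)) (at s within ball t d)" if "s \<in> ball t d" for s
    proof -
      have "F (z s) = vf (z s)" using d(2) that F_vf by blast
      then have "((\<lambda>s. H (fst (z s)) (snd (z s))) has_real_derivative 0) (at s)"
        using H_along_has_derivative[OF z(2)[of s]] by (simp add: vf_def inner_commute)
      then have "((\<lambda>s. H (fst (z s)) (snd (z s))) has_derivative (\<lambda>h. 0)) (at s)"
        unfolding has_field_derivative_def by (rule has_derivative_eq_rhs) auto
      then show ?thesis by (rule has_derivative_at_withinI)
    qed
    note zero = this
    have "s \<in> S" if "s \<in> ball t d" for s
      using has_derivative_zero_unique[OF convex_ball zero that, of t] d(1) \<open>t \<in> S\<close> by (simp add: S_def)
    then show "\<exists>e>0. ball t e \<subseteq> S" using d(1) by blast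
  qed
  moreover have "0 \<in> S" using z(1) by (simp add: S_def E_def)
  ultimately have "S = UNIV"
    using connected_clopen[of "UNIV::real set"] by (auto simp: connected_UNIV)
  then have "t \<in> S" for t by blast
  then have "norm (snd (z t)) < R" for t using R(2)[of "fst (z t)" "snd (z t)"] by (simp add: S_def)
  then have "ham z" using z(2) F_vf by (simp add: ham_def)
  then show ?thesis using z(1) by blast
qed

text \<open>Energy conservation keeps all solutions below level \<open>E\<close> in one momentum
  ball, on which the field is Lipschitz uniformly in position; hence one constant for all such
  solutions and all times.\<close>

lemma ham_dependence:
  obtains K where "K > 0" "\<And>z w t. ham z \<Longrightarrow> ham w \<Longrightarrow> H (fst (z 0)) (snd (z 0)) \<le> E \<Longrightarrow>
    H (fst (w 0)) (snd (w 0)) \<le> E \<Longrightarrow> norm (z t - w t) \<le> exp (K * \<bar>t\<bar>) * norm (z 0 - w 0)"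
proof -
  obtain R where R: "R > 0" "\<And>x p. H x p \<le> E \<Longrightarrow> norm p < R" using sublevel_bounded[where E = E] by blast
  obtain K where K: "K > 0" "\<And>x p y q. norm p \<le> R \<Longrightarrow> norm q \<le> R \<Longrightarrow>
    norm (Hx x p - Hx y q) \<le> K * norm ((x,p) - (y,q)) \<and> norm (Hp x p - Hp y q) \<le> K * norm ((x,p) - (y,q))"
    using grad_H_lipschitz[where R = R] by blast
  show ?thesis
  proof (rule that[of "2 * K"])
    fix z w t assume zw: "ham z" "ham w" "H (fst (z 0)) (snd (z 0)) \<le> E" "H (fst (w 0)) (snd (w 0)) \<le> E"
    have b: "norm (snd (z s)) \<le> R" "norm (snd (w s)) \<le> R" for s
      using R(2)[of "fst (z s)" "snd (z s)"] R(2)[of "fst (w s)" "snd (w s)"]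
        energy_conserved[OF zw(1), of s] energy_conserved[OF zw(2), of s] zw(3,4) by simp_all
    show "norm (z t - w t) \<le> exp (2 * K * \<bar>t\<bar>) * norm (z 0 - w 0)"
    proof (rule ode_dependence)
      show "(z has_vector_derivative vf (z s)) (at s)" "(w has_vector_derivative vf (w s)) (at s)" for s
        using zw(1,2) by (auto simp: ham_def)
      fix s
      have "norm (vf (z s) - vf (w s)) \<le> norm (Hp (fst (z s)) (snd (z s)) - Hp (fst (w s)) (snd (w s)))
          + norm (- (Hx (fst (z s)) (snd (z s)) - Hx (fst (w s)) (snd (w s))))"
        unfolding vf_def by (simp only: diff_Pair minus_diff_minus norm_Pair_le)
      then show "norm (vf (z s) - vf (w s)) \<le> 2 * K * norm (z s - w s)"
        using K(2)[OF b(1)[of s] b(2)[of s], of "fst (z s)" "fst (w s)"] by (simp add: norm_minus_commute)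
    qed
  qed (use K in simp)
qed

lemma ham_unique:
  assumes "ham z" "ham w" "z 0 = w 0"
  shows "z t = w t"
proof -
  obtain K where "K > 0" and K: "\<And>z' w' t. ham z' \<Longrightarrow> ham w' \<Longrightarrow> H (fst (z' 0)) (snd (z' 0)) \<le> H (fst (w 0)) (snd (w 0)) \<Longrightarrow>
    H (fst (w' 0)) (snd (w' 0)) \<le> H (fst (w 0)) (snd (w 0)) \<Longrightarrow> norm (z' t - w' t) \<le> exp (K * \<bar>t\<bar>) * norm (z' 0 - w' 0)"
    using ham_dependence[where E = "H (fst (w 0)) (snd (w 0))"] by blast
  from K[OF assms(1,2)] have "norm (z t - w t) \<le> 0" using assms(3) by simp
  then show ?thesis by simp
qed

lemma phiH_ham:
  assumes "ham w"
  shows "phiH H s (w 0) = w s"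
  unfolding phiH_def
proof (rule the_equality)
  show "\<exists>X P. Ham_solution H X P \<and> X 0 = fst (w 0) \<and> P 0 = snd (w 0) \<and> w s = (X s, P s)"
    using assms by (intro exI[of _ "\<lambda>s. fst (w s)"] exI[of _ "\<lambda>s. snd (w s)"]) (simp add: Ham_solution_iff)
  fix u assume "\<exists>X P. Ham_solution H X P \<and> X 0 = fst (w 0) \<and> P 0 = snd (w 0) \<and> u = (X s, P s)"
  then obtain X P where XP: "ham (\<lambda>s. (X s, P s))" "X 0 = fst (w 0)" "P 0 = snd (w 0)" "u = (X s, P s)"
    by (auto simp: Ham_solution_iff)
  then show "u = w s" using ham_unique[OF XP(1) assms, of s] by simp
qed

lemma ham_phiH: "ham (\<lambda>s. phiH H s z)"
proof -
  obtain w where w: "ham w" "w 0 = z" using ham_exists by blast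
  then show ?thesis using phiH_ham[OF w(1)] by simp
qed

lemma phiH_0 [simp]: "phiH H 0 z = z"
  using ham_exists[of z] phiH_ham[of _ 0] by auto

lemma ham_shift:
  assumes "ham z"
  shows "ham (\<lambda>s. z (s + t))"
  unfolding ham_def
proof
  fix s
  have "((\<lambda>s. s + t) has_vector_derivative 1) (at s)" by (auto intro!: derivative_eq_intros)
  moreover have "(z has_vector_derivative vf (z (s + t))) (at (s + t))" using assms by (simp add: ham_def)
  ultimately show "((\<lambda>s. z (s + t)) has_vector_derivative vf (z (s + t))) (at s)"
    using vector_diff_chain_at[of "\<lambda>s. s + t" 1 s z] by (simp add: o_def)
qed

lemma phiH_add: "phiH H s (phiH H t z) = phiH H (s + t) z"
  using phiH_ham[OF ham_shift[OF ham_phiH, of t z], of s] by simp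

text \<open>Uniqueness for a curve that solves the equation only on an open interval, as calibrated
  curves do at first. Its momentum is bounded by compactness of the segment between the two
  times.\<close>

lemma ham_on_interval_phiH:
  assumes z: "\<And>r. r \<in> {s<..<t} \<Longrightarrow> (z has_vector_derivative vf (z r)) (at r)"
    and r: "r \<in> {s<..<t}" "r0 \<in> {s<..<t}"
  shows "z r = phiH H (r - r0) (z r0)"
proof -
  define y where "y u = z (u + r0)" for u
  define w where "w u = phiH H u (z r0)" for u
  have seg: "u + r0 \<in> {s<..<t}" if "u \<in> closed_segment 0 (r - r0)" for u
    using that r by (auto simp: closed_segment_eq_real_ivl split: if_splits)
  have y: "(y has_vector_derivative vf (y u)) (at u)" if "u \<in> closed_segment 0 (r - r0)" for u
  proof -
    have "((\<lambda>s. s + r0) has_vector_derivative 1) (at u)" by (auto intro!: derivative_eq_intros)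
    then show ?thesis
      using vector_diff_chain_at[of "\<lambda>s. s + r0" 1 u z, OF _ z[OF seg[OF that]]] by (simp add: o_def y_def[abs_def])
  qed
  have w: "ham w" unfolding w_def by (rule ham_phiH)
  have "continuous_on (closed_segment 0 (r - r0)) (\<lambda>u. snd (y u))"
    using y by (intro continuous_on_snd continuous_at_imp_continuous_on ballI) (metis has_vector_derivative_continuous)
  then have "bounded ((\<lambda>u. snd (y u)) ` closed_segment 0 (r - r0))"
    by (intro compact_imp_bounded compact_continuous_image) auto
  then obtain R1 where R1: "\<And>u. u \<in> closed_segment 0 (r - r0) \<Longrightarrow> norm (snd (y u)) \<le> R1"
    unfolding bounded_iff by blast
  obtain R2 where R2: "R2 > 0" "\<And>x p. H x p \<le> H (fst (w 0)) (snd (w 0)) \<Longrightarrow> norm p < R2"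
    using sublevel_bounded[where E = "H (fst (w 0)) (snd (w 0))"] by blast
  define R where "R = max R1 R2"
  have bw: "norm (snd (w u)) \<le> R" for u
    using R2(2)[of "fst (w u)" "snd (w u)"] energy_conserved[OF w, of u] by (simp add: R_def)
  have by': "norm (snd (y u)) \<le> R" if "u \<in> closed_segment 0 (r - r0)" for u using R1[OF that] by (simp add: R_def)
  obtain K where K: "K > 0" "\<And>x p y q. norm p \<le> R \<Longrightarrow> norm q \<le> R \<Longrightarrow>
    norm (Hx x p - Hx y q) \<le> K * norm ((x,p) - (y,q)) \<and> norm (Hp x p - Hp y q) \<le> K * norm ((x,p) - (y,q))"
    using grad_H_lipschitz[where R = R] by blast
  have "norm (y (r - r0) - w (r - r0)) \<le> exp (2 * K * \<bar>r - r0\<bar>) * norm (y 0 - w 0)"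
  proof (rule ode_dependence[OF y])
    show "(w has_vector_derivative vf (w u)) (at u)" for u using w by (simp add: ham_def)
    fix u assume u: "u \<in> closed_segment 0 (r - r0)"
    have "norm (vf (y u) - vf (w u)) \<le> norm (Hp (fst (y u)) (snd (y u)) - Hp (fst (w u)) (snd (w u)))
        + norm (- (Hx (fst (y u)) (snd (y u)) - Hx (fst (w u)) (snd (w u))))"
      unfolding vf_def by (simp only: diff_Pair minus_diff_minus norm_Pair_le)
    then show "norm (vf (y u) - vf (w u)) \<le> 2 * K * norm (y u - w u)"
      using K(2)[OF by'[OF u] bw[of u], of "fst (y u)" "fst (w u)"] by (simp add: norm_minus_commute)
  qed
  then show ?thesis by (simp add: y_def w_def)
qed

lemma phiH_lattice:
  assumes "k \<in> lattice"
  shows "phiH H s (x + k, p) = phiH H s (x, p) + (k, 0)"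
proof -
  have "ham (\<lambda>s. phiH H s (x, p) + (k, 0))"
    using ham_phiH[of "(x,p)"] unfolding ham_def vf_def
    by (auto intro!: derivative_eq_intros simp: Hp_periodic[OF assms] Hx_periodic[OF assms])
  from phiH_ham[OF this, of s] show ?thesis by simp
qed

lemma phiH_continuous: "continuous_on UNIV (\<lambda>u. phiH H (fst u) (snd u))"
  unfolding continuous_on_eq_continuous_at[OF open_UNIV]
proof
  fix u :: "real \<times> (real^'n) \<times> (real^'n)"
  obtain s z where u: "u = (s,z)" by (cases u)
  \<comment> \<open>The level is raised by 1 so that all initial points near \<open>z\<close> lie
    below it and share one Gronwall constant.\<close>
  obtain K where K: "K > 0" "\<And>y w t. ham y \<Longrightarrow> ham w \<Longrightarrow> H (fst (y 0)) (snd (y 0)) \<le> H (fst z) (snd z) + 1 \<Longrightarrow>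
    H (fst (w 0)) (snd (w 0)) \<le> H (fst z) (snd z) + 1 \<Longrightarrow> norm (y t - w t) \<le> exp (K * \<bar>t\<bar>) * norm (y 0 - w 0)"
    using ham_dependence[where E = "H (fst z) (snd z) + 1"] by blast
  have lim: "((\<lambda>u'. fst u') \<longlongrightarrow> s) (at u)" "((\<lambda>u'. snd u') \<longlongrightarrow> z) (at u)"
    using tendsto_fst[OF tendsto_ident_at, of u UNIV] tendsto_snd[OF tendsto_ident_at, of u UNIV] u by auto
  have "isCont (\<lambda>z. H (fst z) (snd z)) z" using H_continuous unfolding continuous_on_eq_continuous_at[OF open_UNIV] by blast
  then have "((\<lambda>u'. H (fst (snd u')) (snd (snd u'))) \<longlongrightarrow> H (fst z) (snd z)) (at u)"
    using isCont_tendsto_compose[OF _ lim(2), of "\<lambda>z. H (fst z) (snd z)"] by simp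
  then have ev: "\<forall>\<^sub>F u' in at u. H (fst (snd u')) (snd (snd u')) < H (fst z) (snd z) + 1"
    by (rule order_tendstoD(2)) simp
  have 1: "((\<lambda>u'. phiH H (fst u') (snd u') - phiH H (fst u') z) \<longlongrightarrow> 0) (at u)"
  proof (rule Lim_null_comparison)
    show "\<forall>\<^sub>F u' in at u. norm (phiH H (fst u') (snd u') - phiH H (fst u') z) \<le> exp (K * \<bar>fst u'\<bar>) * norm (snd u' - z)"
      using ev by eventually_elim (use K(2)[OF ham_phiH ham_phiH, of _ z] in simp)
    have "((\<lambda>u'. exp (K * \<bar>fst u'\<bar>) * norm (snd u' - z)) \<longlongrightarrow> exp (K * \<bar>s\<bar>) * norm (z - z)) (at u)"
      by (intro tendsto_intros lim)
    then show "((\<lambda>u'. exp (K * \<bar>fst u'\<bar>) * norm (snd u' - z)) \<longlongrightarrow> 0) (at u)" by simp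
  qed
  have "isCont (\<lambda>s. phiH H s z) s"
    using ham_phiH[of z] unfolding ham_def by (metis has_vector_derivative_continuous)
  then have "((\<lambda>u'. phiH H (fst u') z) \<longlongrightarrow> phiH H s z) (at u)"
    using isCont_tendsto_compose[OF _ lim(1), of "\<lambda>s. phiH H s z"] by simp
  from tendsto_add[OF 1 this] show "isCont (\<lambda>u. phiH H (fst u) (snd u)) u"
    by (simp add: isCont_def u)
qed

lemma continuous_on_phiH [continuous_intros]:
  "continuous_on S f \<Longrightarrow> continuous_on S g \<Longrightarrow> continuous_on S (\<lambda>t. phiH H (f t) (g t))"
  using continuous_on_compose2[OF phiH_continuous, of S "\<lambda>t. (f t, g t)"] by (auto intro: continuous_on_Pair)

text \<open>With velocity gradient \<open>Pm\<close> and position gradient \<open>- Hx\<close> of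
  the Lagrangian, the Euler-Lagrange equation is exactly the momentum equation. Translating an
  arbitrary solution back to a Hamiltonian orbit gives the uniqueness demanded by
  \<open>THE\<close>.\<close>

lemma phiL_phiH:
  "phiL H s (x, Hp x p) = (fst (phiH H s (x,p)), Hp (fst (phiH H s (x,p))) (snd (phiH H s (x,p))))"
  unfolding phiL_def
proof (rule the_equality)
  let ?z = "\<lambda>s. phiH H s (x,p)"
  have "EL_solution H (\<lambda>s. fst (?z s)) (\<lambda>s. Hp (fst (?z s)) (snd (?z s)))"
    unfolding EL_solution_def grad_Lag_xi grad_Lag_x
    using ham_fst[OF ham_phiH, of "(x,p)"] ham_snd[OF ham_phiH, of "(x,p)"] by simp
  then show "\<exists>\<gamma> d\<gamma>. EL_solution H \<gamma> d\<gamma> \<and> \<gamma> 0 = fst (x, Hp x p) \<and> d\<gamma> 0 = snd (x, Hp x p) \<and>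
      (fst (?z s), Hp (fst (?z s)) (snd (?z s))) = (\<gamma> s, d\<gamma> s)"
    by (intro exI[of _ "\<lambda>s. fst (?z s)"] exI[of _ "\<lambda>s. Hp (fst (?z s)) (snd (?z s))"]) simp
  fix w assume "\<exists>\<gamma> d\<gamma>. EL_solution H \<gamma> d\<gamma> \<and> \<gamma> 0 = fst (x, Hp x p) \<and> d\<gamma> 0 = snd (x, Hp x p) \<and> w = (\<gamma> s, d\<gamma> s)"
  then obtain \<gamma> d\<gamma> where E: "EL_solution H \<gamma> d\<gamma>" "\<gamma> 0 = x" "d\<gamma> 0 = Hp x p" "w = (\<gamma> s, d\<gamma> s)" by auto
  have "ham (\<lambda>t. (\<gamma> t, Pm (\<gamma> t) (d\<gamma> t)))"
    unfolding ham_def vf_def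
    using E(1) unfolding EL_solution_def grad_Lag_xi grad_Lag_x by (auto intro!: has_vector_derivative_Pair)
  from phiH_ham[OF this, of s] have "?z s = (\<gamma> s, Pm (\<gamma> s) (d\<gamma> s))" using E by simp
  then show "w = (fst (?z s), Hp (fst (?z s)) (snd (?z s)))" using E(4) by simp
qed

end

section \<open>Viscosity solutions are dominated by the action\<close>

lemma has_integral_le_ae:
  fixes f g :: "'a::euclidean_space \<Rightarrow> real"
  assumes f: "(f has_integral i) S" and g: "(g has_integral j) S" and N: "negligible N"
    and le: "\<And>x. x \<in> S - N \<Longrightarrow> f x \<le> g x"
  shows "i \<le> j"
proof -
  have "((\<lambda>x. if x \<in> N then g x else f x) has_integral i) S"
    by (rule has_integral_spike[OF N _ f]) auto
  then show ?thesis by (rule has_integral_le[OF _ g]) (use le in auto)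
qed

text \<open>The difference is non-negative off a null set with integral zero. For non-negative
  functions the gauge integral is the Lebesgue integral, which then forces vanishing almost
  everywhere.\<close>

lemma has_integral_eq_imp_eq_ae:
  fixes f g :: "'a::euclidean_space \<Rightarrow> real"
  assumes f: "(f has_integral i) S" and g: "(g has_integral i) S" and N: "negligible N"
    and le: "\<And>x. x \<in> S - N \<Longrightarrow> f x \<le> g x"
  shows "negligible {x \<in> S. f x \<noteq> g x}"
proof -
  define h where "h x = (if x \<in> S - N then g x - f x else 0)" for x
  have h0: "h x \<ge> 0" for x using le by (simp add: h_def)
  have "((\<lambda>x. g x - f x) has_integral (i - i)) S" by (rule has_integral_diff[OF g f])
  then have "((\<lambda>x. g x - f x) has_integral 0) S" by simp
  then have "((\<lambda>x. if x \<in> N then 0 else g x - f x) has_integral 0) S"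
    by (rule has_integral_spike[OF N, rotated]) auto
  then have "((\<lambda>x. if x \<in> S then (if x \<in> N then 0 else g x - f x) else 0) has_integral 0) UNIV"
    by (simp add: has_integral_restrict_UNIV)
  moreover have "(\<lambda>x. if x \<in> S then (if x \<in> N then 0 else g x - f x) else 0) = h"
    by (auto simp: h_def)
  ultimately have "(h has_integral 0) UNIV" by simp
  then have hm: "h \<in> lebesgue \<rightarrow>\<^sub>M borel" and "integral\<^sup>N lebesgue h = ennreal 0"
    using has_integral_iff_nn_integral_lebesgue[of h 0] h0 by auto
  then have "AE x in lebesgue. ennreal (h x) = 0"
    using nn_integral_0_iff_AE[of "\<lambda>x. ennreal (h x)" lebesgue] by auto
  then have "AE x in lebesgue. h x = 0"
    by eventually_elim (metis ennreal_eq_0_iff h0 order_antisym)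
  then obtain Z where Z: "{x. h x \<noteq> 0} \<subseteq> Z" "Z \<in> null_sets lebesgue"
    unfolding eventually_ae_filter by auto
  then have "negligible (Z \<union> N)" using N by (simp add: negligible_iff_null_sets null_sets.Un)
  moreover have "{x \<in> S. f x \<noteq> g x} \<subseteq> Z \<union> N" using Z(1) by (auto simp: h_def)
  ultimately show ?thesis by (rule negligible_subset)
qed

text \<open>The local bound holds only for times of ratio at most \<open>1 + \<delta>\<close>,
  because the functions to which it is applied degenerate at time zero. A longer interval is filled
  with a geometric progression, whose number of steps does not enter the bound.\<close>

lemma increment_bound_chain:
  fixes m :: "real \<Rightarrow> real"
  assumes "\<delta> > 0"
    and step: "\<And>s t. 0 < s \<Longrightarrow> s < t \<Longrightarrow> t \<le> (1 + \<delta>) * s \<Longrightarrow> t \<le> T \<Longrightarrow> m t - m s \<le> B * (t - s)"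
    and "0 < s" "s < t" "t \<le> T"
  shows "m t - m s \<le> B * (t - s)"
proof -
  have chain: "0 < s \<Longrightarrow> s < t \<Longrightarrow> t \<le> T \<Longrightarrow> t \<le> (1 + \<delta>) ^ n * s \<Longrightarrow> m t - m s \<le> B * (t - s)" for n t
  proof (induction n arbitrary: t)
    case (Suc n)
    show ?case
    proof (cases "t \<le> (1 + \<delta>) * s")
      case True
      then show ?thesis using step Suc.prems by blast
    next
      case False
      define u where "u = t / (1 + \<delta>)"
      have u: "s < u" "u < t" "t \<le> (1 + \<delta>) * u" "u \<le> (1 + \<delta>) ^ n * s"
        using False \<open>\<delta> > 0\<close> Suc.prems by (auto simp: u_def field_simps)
      have "m u - m s \<le> B * (u - s)" by (rule Suc.IH) (use u Suc.prems in auto)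
      moreover have "m t - m u \<le> B * (t - u)" by (rule step) (use u Suc.prems in auto)
      ultimately show ?thesis by (simp add: algebra_simps)
    qed
  qed simp
  obtain n where "t / s < (1 + \<delta>) ^ n" using real_arch_pow[of "1 + \<delta>" "t / s"] \<open>\<delta> > 0\<close> by auto
  then have "t \<le> (1 + \<delta>) ^ n * s" using \<open>0 < s\<close> by (simp add: field_simps)
  then show ?thesis using chain assms by blast
qed

lemma norm_divideR:
  fixes z :: "'a::real_normed_vector"
  shows "t > 0 \<Longrightarrow> norm (z /\<^sub>R t) = norm z / t"
  by (simp add: divide_inverse mult.commute)

lemma vector_derivative_quotient_tendsto:
  assumes "(f has_vector_derivative f') (at u)"
  shows "((\<lambda>h. (f (u + h) - f u) /\<^sub>R h) \<longlongrightarrow> f') (at 0)"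
proof (rule tendstoI)
  fix e :: real assume "e > 0"
  then obtain d where d: "d > 0" "\<And>y. norm (y - u) < d \<Longrightarrow> norm (f y - f u - (y - u) *\<^sub>R f') \<le> e / 2 * norm (y - u)"
    using assms unfolding has_vector_derivative_def has_derivative_at_alt by (metis half_gt_zero)
  have "dist ((f (u + h) - f u) /\<^sub>R h) f' < e" if "h \<noteq> 0" "dist h 0 < d" for h
  proof -
    have "norm (f (u + h) - f u - h *\<^sub>R f') \<le> e / 2 * \<bar>h\<bar>" using d(2)[of "u + h"] that by simp
    moreover have "(f (u + h) - f u) /\<^sub>R h - f' = (f (u + h) - f u - h *\<^sub>R f') /\<^sub>R h"
      using that by (simp add: scaleR_diff_right)
    ultimately have "norm ((f (u + h) - f u) /\<^sub>R h - f') \<le> e / 2"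
      using that by (simp add: inverse_eq_divide pos_divide_le_eq)
    then show ?thesis using \<open>e > 0\<close> by (simp add: dist_norm)
  qed
  then show "\<forall>\<^sub>F h in at 0. dist ((f (u + h) - f u) /\<^sub>R h) f' < e"
    unfolding eventually_at using d(1) by blast
qed

section \<open>Lipschitz continuity of the solution and the one-step estimates\<close>

locale weak_kam = tonelli_hamiltonian H for H :: "real^'n \<Rightarrow> real^'n \<Rightarrow> real" +
  fixes c :: "real^'n" and v :: "real^'n \<Rightarrow> real"
  assumes visc: "viscosity_solution H c (crit_value H c) v"
begin

abbreviation a :: real where "a \<equiv> crit_value H c"

text \<open>In the velocity, this is the convex conjugate of the function sending \<open>p\<close>
  to \<open>H x (c + p) - a\<close>.\<close>

definition ell :: "real^'n \<Rightarrow> real^'n \<Rightarrow> real" where "ell x \<xi> = Lag H x \<xi> - c \<bullet> \<xi> + a"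

lemma v_continuous: "continuous_on UNIV v"
  using visc by (simp add: viscosity_solution_def)

lemma v_periodic: "k \<in> lattice \<Longrightarrow> v (x + k) = v x"
  using visc by (simp add: viscosity_solution_def)

lemma v_bounded: obtains B where "B > 0" "\<And>x. \<bar>v x\<bar> \<le> B"
proof -
  have "\<exists>B>0. \<forall>x. \<forall>p\<in>{0::real}. norm (v (fst (x,p))) \<le> B"
    by (rule periodic_bounded) (auto simp: v_periodic intro!: continuous_on_compose2[OF v_continuous] continuous_intros)
  then show ?thesis using that by auto
qed

lemma subsolution_test:
  assumes d: "\<And>y. (\<phi> has_derivative (\<lambda>w. g y \<bullet> w)) (at y)" and "continuous_on UNIV g"
    and "\<And>y. v y - \<phi> y \<le> v x - \<phi> x"
  shows "H x (c + g x) \<le> a"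
proof -
  have "C1_fun \<phi>" using assms(1,2) unfolding C1_fun_def by blast
  moreover have "\<forall>\<^sub>F y in at x. v y - \<phi> y \<le> v x - \<phi> x" using assms(3) by simp
  ultimately have "H x (c + grad \<phi> x) \<le> a" using visc unfolding viscosity_solution_def by blast
  then show ?thesis using grad_eqI[OF d] by simp
qed

lemma supersolution_test:
  assumes d: "\<And>y. (\<phi> has_derivative (\<lambda>w. g y \<bullet> w)) (at y)" and "continuous_on UNIV g"
    and "\<And>y. v y - \<phi> y \<ge> v x - \<phi> x"
  shows "H x (c + g x) \<ge> a"
proof -
  have "C1_fun \<phi>" using assms(1,2) unfolding C1_fun_def by blast
  moreover have "\<forall>\<^sub>F y in at x. v y - \<phi> y \<ge> v x - \<phi> x" using assms(3) by simp
  ultimately have "H x (c + grad \<phi> x) \<ge> a" using visc unfolding viscosity_solution_def by blast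
  then show ?thesis using grad_eqI[OF d] by simp
qed

text \<open>A cone of slope \<open>2 * K\<close> with vertex \<open>y\<close>, smoothed at scale
  \<open>\<delta>\<close> into a C1 function, touches \<open>v\<close> from above. Its slope is at
  least \<open>K\<close> outside the \<open>\<delta>\<close>-ball, while the subsolution test allows
  only slopes below \<open>K\<close>; so contact occurs within \<open>\<delta>\<close> of the
  vertex, and \<open>\<delta>\<close> tends to 0.\<close>

lemma v_lipschitz_exists: "\<exists>K. K-lipschitz_on UNIV v"
proof -
  obtain R where R: "R > 0" "\<And>x p. H x p \<le> a \<Longrightarrow> norm p < R" using sublevel_bounded[where E = a] by blast
  define K where "K = R + norm c"
  have "K > 0" using R by (simp add: K_def add_pos_nonneg)
  have test: "norm g < K" if "H x (c + g) \<le> a" for x g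
    using R(2)[OF that] norm_triangle_ineq4[of "c + g" c] by (simp add: K_def)
  obtain B where B: "B > 0" "\<And>x. \<bar>v x\<bar> \<le> B" using v_bounded by blast
  have key: "\<exists>x. norm (x - y) < \<delta> \<and> v z \<le> v x + 2 * K * (norm (z - y) + \<delta>)" if "\<delta> > 0" for y z \<delta>
  proof -
    define S where "S z = sqrt ((z - y) \<bullet> (z - y) + \<delta>\<^sup>2)" for z
    have pos: "(z - y) \<bullet> (z - y) + \<delta>\<^sup>2 > 0" for z using \<open>\<delta> > 0\<close> by (simp add: add_nonneg_pos)
    have S0: "S z > 0" for z using pos by (simp add: S_def)
    have S1: "norm (z - y) \<le> S z" for z unfolding S_def by (rule real_le_rsqrt) (simp add: power2_norm_eq_inner)
    have S2: "S z \<le> norm (z - y) + \<delta>" for z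
      unfolding S_def using \<open>\<delta> > 0\<close> by (intro real_le_lsqrt) (auto simp: power2_sum power2_norm_eq_inner)
    have Sc: "continuous_on UNIV S" unfolding S_def by (intro continuous_intros)
    define \<phi> where "\<phi> z = 2 * K * S z" for z
    define g where "g z = (2 * K / S z) *\<^sub>R (z - y)" for z
    have dS: "(S has_derivative (\<lambda>w. (z - y) \<bullet> w / S z)) (at z)" for z
    proof -
      have "((\<lambda>z. (z - y) \<bullet> (z - y) + \<delta>\<^sup>2) has_derivative (\<lambda>w. 2 * ((z - y) \<bullet> w))) (at z)"
        by (auto intro!: derivative_eq_intros simp: inner_commute)
      from has_derivative_compose[OF this DERIV_real_sqrt[OF pos[of z], unfolded has_field_derivative_def]]
      show ?thesis unfolding S_def by (rule has_derivative_eq_rhs) (simp add: fun_eq_iff inverse_eq_divide)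
    qed
    have d: "(\<phi> has_derivative (\<lambda>w. g z \<bullet> w)) (at z)" for z
      using has_derivative_mult_right[OF dS[of z], of "2 * K"] by (simp add: \<phi>_def[abs_def] g_def)
    have gc: "continuous_on UNIV g" unfolding g_def using S0 by (intro continuous_intros Sc) (auto simp: less_imp_neq[symmetric])
    \<comment> \<open>Beyond this radius \<open>\<phi>\<close> exceeds its value at \<open>y\<close>
      by more than \<open>2 * B\<close>, a bound for the oscillation of \<open>v\<close>, so the
      maximum over the ball is global.\<close>
    define r where "r = (B + K * \<delta>) / K + 1"
    have "continuous_on (cball y r) (\<lambda>z. v z - \<phi> z)"
      unfolding \<phi>_def by (intro continuous_intros continuous_on_subset[OF Sc] continuous_on_subset[OF v_continuous]) auto
    moreover have "y \<in> cball y r" using B \<open>K > 0\<close> \<open>\<delta> > 0\<close> by (simp add: r_def add_pos_nonneg)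
    ultimately obtain x where x: "x \<in> cball y r" "\<And>z. z \<in> cball y r \<Longrightarrow> v z - \<phi> z \<le> v x - \<phi> x"
      using continuous_attains_sup[of "cball y r" "\<lambda>z. v z - \<phi> z"] by (metis compact_cball empty_iff)
    have max: "v z - \<phi> z \<le> v x - \<phi> x" for z
    proof (cases "z \<in> cball y r")
      case False
      then have "norm (z - y) > r" by (simp add: dist_norm norm_minus_commute)
      then have "K * r < K * norm (z - y)" using \<open>K > 0\<close> by simp
      moreover have "K * r = B + K * \<delta> + K" using \<open>K > 0\<close> by (simp add: r_def field_simps)
      moreover have "K * norm (z - y) \<le> K * S z" using S1 \<open>K > 0\<close> by simp
      ultimately have "\<phi> z > 2 * B + 2 * K * \<delta>" using \<open>K > 0\<close> unfolding \<phi>_def by linarith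
      moreover have "\<phi> y = 2 * K * \<delta>" using \<open>\<delta> > 0\<close> by (simp add: \<phi>_def S_def)
      ultimately have "v z - \<phi> z \<le> v y - \<phi> y" using B(2)[of z] B(2)[of y] by linarith
      then show ?thesis using x(2)[OF \<open>y \<in> cball y r\<close>] by linarith
    qed (use x in auto)
    have "norm (g x) < K" by (rule test) (rule subsolution_test[OF d gc max])
    moreover have "norm (g x) = 2 * K * norm (x - y) / S x" using \<open>K > 0\<close> S0[of x] by (simp add: g_def)
    ultimately have "2 * norm (x - y) < S x" using \<open>K > 0\<close> S0[of x] by (simp add: field_simps)
    then have "norm (x - y) < \<delta>" using S2[of x] by simp
    moreover have "v z \<le> v x + 2 * K * (norm (z - y) + \<delta>)"
    proof -
      have "v z \<le> v x + \<phi> z" using max[of z] S0[of x] \<open>K > 0\<close> by (simp add: \<phi>_def) (smt (verit) mult_pos_pos)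
      also have "\<phi> z \<le> 2 * K * (norm (z - y) + \<delta>)" unfolding \<phi>_def using S2[of z] \<open>K > 0\<close> by (intro mult_left_mono) auto
      finally show ?thesis by simp
    qed
    ultimately show ?thesis by blast
  qed
  have up: "v z \<le> v y + 2 * K * norm (z - y)" for y z
  proof (rule field_le_epsilon)
    fix e :: real assume "e > 0"
    have "isCont v y" using v_continuous by (simp add: continuous_on_eq_continuous_at)
    then obtain d where d: "d > 0" "\<And>x. dist x y < d \<Longrightarrow> dist (v x) (v y) < e / 2"
      using \<open>e > 0\<close> unfolding continuous_at_eps_delta by (metis half_gt_zero)
    define \<delta> where "\<delta> = min d (e / (4 * K))"
    have "\<delta> > 0" using d \<open>e > 0\<close> \<open>K > 0\<close> by (simp add: \<delta>_def)
    then obtain x where x: "norm (x - y) < \<delta>" "v z \<le> v x + 2 * K * (norm (z - y) + \<delta>)" using key by blast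
    have "\<bar>v x - v y\<bar> < e / 2" using d(2)[of x] x(1) by (simp add: \<delta>_def dist_norm)
    then have "v x \<le> v y + e / 2" by linarith
    moreover have "2 * K * \<delta> \<le> e / 2"
    proof -
      have "\<delta> \<le> e / (4 * K)" by (simp add: \<delta>_def)
      then show ?thesis using \<open>K > 0\<close> by (simp add: field_simps)
    qed
    ultimately show "v z \<le> v y + 2 * K * norm (z - y) + e" using x(2) by (simp add: distrib_left)
  qed
  have "(2 * K)-lipschitz_on UNIV v"
  proof (rule lipschitz_onI)
    fix y z
    show "dist (v y) (v z) \<le> 2 * K * dist y z"
      using up[of y z] up[of z y] by (auto simp: dist_real_def dist_norm norm_minus_commute)
  qed (use \<open>K > 0\<close> in simp)
  then show ?thesis by blast
qed

definition Lv :: real where "Lv = (SOME K. K-lipschitz_on UNIV v)"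

lemma v_lipschitz_on: "Lv-lipschitz_on UNIV v"
  unfolding Lv_def by (rule someI_ex[OF v_lipschitz_exists])

lemma Lv_nonneg: "Lv \<ge> 0"
  using v_lipschitz_on by (rule lipschitz_on_nonneg)

lemma v_lipschitz: "\<bar>v x - v y\<bar> \<le> Lv * norm (x - y)"
  using lipschitz_on_normD[OF v_lipschitz_on, of x y] by simp

lemma ell_has_derivative: "(ell x has_derivative (\<lambda>w. (Pm x \<xi> - c) \<bullet> w)) (at \<xi>)"
proof -
  have "((\<lambda>\<xi>. Lag H x \<xi> - c \<bullet> \<xi> + a) has_derivative (\<lambda>w. Pm x \<xi> \<bullet> w - c \<bullet> w)) (at \<xi>)"
    by (auto intro!: derivative_eq_intros Lag_has_derivative_xi)
  then show ?thesis unfolding ell_def[abs_def] by (simp add: inner_diff_left)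
qed

lemma continuous_on_ell [continuous_intros]:
  "continuous_on S f \<Longrightarrow> continuous_on S g \<Longrightarrow> continuous_on S (\<lambda>t. ell (f t) (g t))"
  unfolding ell_def by (intro continuous_intros)

lemma ell_subgradient: "ell x \<xi> + (Pm x \<xi> - c) \<bullet> (\<eta> - \<xi>) \<le> ell x \<eta>"
  using Lag_subgradient[of x \<xi> \<eta>] by (simp add: ell_def inner_diff_left inner_diff_right)

lemma ell_lower: obtains C where "C > 0" "\<And>x \<xi>. (Lv + 1) * norm \<xi> - C \<le> ell x \<xi>"
proof -
  obtain C where C: "\<And>x \<xi>. (Lv + 1 + norm c) * norm \<xi> - C \<le> Lag H x \<xi>"
    using Lag_superlinear[of "Lv + 1 + norm c"] Lv_nonneg by (meson add_nonneg_nonneg norm_ge_zero zero_le_one)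
  show ?thesis
  proof (rule that[of "\<bar>C\<bar> + \<bar>a\<bar> + 1"])
    fix x \<xi> :: "real^'n"
    have "c \<bullet> \<xi> \<le> norm c * norm \<xi>" by (rule norm_cauchy_schwarz)
    then have "(Lv + 1) * norm \<xi> - C + a \<le> ell x \<xi>" using C[of \<xi> x] by (simp add: ell_def distrib_right)
    then show "(Lv + 1) * norm \<xi> - (\<bar>C\<bar> + \<bar>a\<bar> + 1) \<le> ell x \<xi>" by linarith
  qed simp
qed

text \<open>Above speed \<open>V\<close>, moving costs more than resting even after crediting the
  largest possible change of \<open>v\<close>. This confines the extremal points of the one-step
  problems to distance \<open>V * t\<close>.\<close>

lemma velocity_bound: obtains V where "V > 0" "\<And>x \<xi>. norm \<xi> > V \<Longrightarrow> ell x \<xi> > ell x 0 + Lv * norm \<xi>"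
proof -
  obtain C where C: "C > 0" "\<And>x \<xi>. (Lv + 1) * norm \<xi> - C \<le> ell x \<xi>" using ell_lower by blast
  obtain B where B: "B > 0" "\<And>x \<xi>. norm \<xi> \<le> 0 \<Longrightarrow> \<bar>Lag H x \<xi>\<bar> \<le> B" using Lag_bounded[where R = 0] by blast
  show ?thesis
  proof (rule that[of "C + B + \<bar>a\<bar>"])
    fix x \<xi> :: "real^'n" assume "norm \<xi> > C + B + \<bar>a\<bar>"
    then show "ell x \<xi> > ell x 0 + Lv * norm \<xi>"
      using C(2)[of \<xi> x] B(2)[of 0 x] by (simp add: ell_def distrib_right)
  qed (use C B in simp)
qed

text \<open>Differentiation in \<open>\<tau>\<close> leaves \<open>ell\<close> minus the product of
  velocity and its own gradient, which the Legendre identity turns into \<open>a - H\<close> at the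
  dual momentum.\<close>

lemma perspective_has_derivative:
  assumes "\<tau> > 0"
  shows "((\<lambda>\<tau>. \<tau> * ell x (z /\<^sub>R \<tau>)) has_real_derivative (a - H x (Pm x (z /\<^sub>R \<tau>)))) (at \<tau>)"
proof -
  let ?\<xi> = "z /\<^sub>R \<tau>"
  have "((\<lambda>\<tau>. z /\<^sub>R \<tau>) has_derivative (\<lambda>h. (- h / \<tau>\<^sup>2) *\<^sub>R z)) (at \<tau>)"
    using assms by (auto intro!: derivative_eq_intros simp: power2_eq_square divide_inverse)
  from has_derivative_compose[OF this ell_has_derivative]
  have "((\<lambda>\<tau>. ell x (z /\<^sub>R \<tau>)) has_derivative (\<lambda>h. (Pm x ?\<xi> - c) \<bullet> ((- h / \<tau>\<^sup>2) *\<^sub>R z))) (at \<tau>)" .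
  from has_derivative_mult[OF has_derivative_ident this]
  have "((\<lambda>\<tau>. \<tau> * ell x (z /\<^sub>R \<tau>)) has_derivative (\<lambda>h. \<tau> * ((Pm x ?\<xi> - c) \<bullet> ((- h / \<tau>\<^sup>2) *\<^sub>R z)) + h * ell x ?\<xi>)) (at \<tau>)" .
  moreover have "\<tau> * ((Pm x ?\<xi> - c) \<bullet> ((- h / \<tau>\<^sup>2) *\<^sub>R z)) + h * ell x ?\<xi> = (a - H x (Pm x ?\<xi>)) * h" for h
    using assms by (simp add: ell_def Lag_eq inner_diff_left inner_diff_right power2_eq_square inner_commute field_simps)
  ultimately show ?thesis by (simp add: has_field_derivative_def)
qed

text \<open>The mean value theorem evaluates the energy at an unknown time; uniform continuity moves
  it to any chosen \<open>\<sigma>\<close>, since \<open>z /\<^sub>R \<tau>\<close> changes little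
  when \<open>t / s\<close> is close to 1. The upper step estimate takes the right endpoint, the
  lower one the left. The radius \<open>2 * V * s\<close> admits an extremal displacement belonging
  to a time up to \<open>2 * s\<close>.\<close>

lemma perspective_increment:
  assumes "\<epsilon> > 0" "V > 0"
  obtains \<delta> where "\<delta> > 0" "\<delta> \<le> 1" "\<And>s t z \<sigma>. 0 < s \<Longrightarrow> s < t \<Longrightarrow> t \<le> (1 + \<delta>) * s \<Longrightarrow> norm z \<le> 2 * V * s \<Longrightarrow>
     \<sigma> \<in> {s..t} \<Longrightarrow> \<bar>t * ell x (z /\<^sub>R t) - s * ell x (z /\<^sub>R s) - (t - s) * (a - H x (Pm x (z /\<^sub>R \<sigma>)))\<bar> \<le> \<epsilon> * (t - s)"
proof -
  define G where "G \<xi> = H x (Pm x \<xi>)" for \<xi>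
  have "continuous_on (cball 0 (2 * V)) G" unfolding G_def by (intro continuous_intros)
  then have "uniformly_continuous_on (cball 0 (2 * V)) G" by (intro compact_uniformly_continuous) auto
  then obtain d where d: "d > 0" "\<And>\<xi> \<eta>. \<xi> \<in> cball 0 (2 * V) \<Longrightarrow> \<eta> \<in> cball 0 (2 * V) \<Longrightarrow> dist \<eta> \<xi> < d \<Longrightarrow> dist (G \<eta>) (G \<xi>) < \<epsilon>"
    unfolding uniformly_continuous_on_def using \<open>\<epsilon> > 0\<close> by metis
  define \<delta> where "\<delta> = min 1 (d / (4 * V))"
  have \<delta>: "\<delta> > 0" "\<delta> \<le> 1" "2 * V * \<delta> < d"
  proof -
    show "\<delta> > 0" "\<delta> \<le> 1" using d \<open>V > 0\<close> by (auto simp: \<delta>_def)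
    have "\<delta> \<le> d / (4 * V)" by (simp add: \<delta>_def)
    then show "2 * V * \<delta> < d" using d \<open>V > 0\<close> by (simp add: field_simps)
  qed
  show ?thesis
  proof (rule that[OF \<delta>(1,2)])
    fix s t \<sigma> :: real and z :: "real^'n" assume st: "0 < s" "s < t" "t \<le> (1 + \<delta>) * s" "norm z \<le> 2 * V * s" "\<sigma> \<in> {s..t}"
    obtain \<tau> where \<tau>: "s < \<tau>" "\<tau> < t" "t * ell x (z /\<^sub>R t) - s * ell x (z /\<^sub>R s) = (t - s) * (a - H x (Pm x (z /\<^sub>R \<tau>)))"
      using MVT2[OF st(2), of "\<lambda>\<tau>. \<tau> * ell x (z /\<^sub>R \<tau>)" "\<lambda>\<tau>. a - H x (Pm x (z /\<^sub>R \<tau>))"]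
        perspective_has_derivative st(1) by fastforce
    have inb: "z /\<^sub>R u \<in> cball 0 (2 * V)" if "u \<ge> s" for u
    proof -
      have "norm z \<le> 2 * V * u" using st(4) that \<open>V > 0\<close> by (smt (verit) mult_left_mono)
      then show ?thesis using that st(1) by (simp add: norm_divideR pos_divide_le_eq del: norm_scaleR)
    qed
    have "dist (z /\<^sub>R \<tau>) (z /\<^sub>R \<sigma>) < d"
    proof -
      have "z /\<^sub>R \<tau> - z /\<^sub>R \<sigma> = ((\<sigma> - \<tau>) / (\<tau> * \<sigma>)) *\<^sub>R z"
        using \<tau> st by (simp add: scaleR_diff_left[symmetric] field_simps)
      then have "dist (z /\<^sub>R \<tau>) (z /\<^sub>R \<sigma>) = \<bar>\<sigma> - \<tau>\<bar> * norm z / (\<tau> * \<sigma>)"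
        using \<tau> st by (simp add: dist_norm abs_mult)
      also have "\<dots> \<le> (\<delta> * s) * (2 * V * s) / (s * s)"
      proof (rule frac_le)
        have "\<bar>\<sigma> - \<tau>\<bar> \<le> \<delta> * s" using \<tau> st by (auto simp: algebra_simps)
        then show "\<bar>\<sigma> - \<tau>\<bar> * norm z \<le> (\<delta> * s) * (2 * V * s)" using st \<open>V > 0\<close> \<delta>(1) by (intro mult_mono) auto
        show "s * s \<le> \<tau> * \<sigma>" using \<tau> st by (intro mult_mono) auto
      qed (use st \<open>V > 0\<close> \<delta> in auto)
      also have "\<dots> = 2 * V * \<delta>" using st(1) by simp
      also have "\<dots> < d" by fact
      finally show ?thesis .
    qed
    then have "dist (G (z /\<^sub>R \<tau>)) (G (z /\<^sub>R \<sigma>)) < \<epsilon>" using d(2) inb \<tau> st by (metis atLeastAtMost_iff less_imp_le)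
    then have "\<bar>(t - s) * (G (z /\<^sub>R \<sigma>) - G (z /\<^sub>R \<tau>))\<bar> \<le> (t - s) * \<epsilon>"
      unfolding abs_mult using st by (intro mult_mono) (auto simp: dist_real_def)
    then show "\<bar>t * ell x (z /\<^sub>R t) - s * ell x (z /\<^sub>R s) - (t - s) * (a - H x (Pm x (z /\<^sub>R \<sigma>)))\<bar> \<le> \<epsilon> * (t - s)"
      unfolding \<tau>(3) by (simp add: G_def algebra_simps)
  qed
qed

lemma step_upper_bound:
  obtains C where "C > 0" "\<And>x y t. 0 < t \<Longrightarrow> v x \<le> v y + t * ell y ((x - y) /\<^sub>R t) + C * t\<^sup>2"
proof -
  obtain V where V: "V > 0" "\<And>x \<xi>. norm \<xi> > V \<Longrightarrow> ell x \<xi> > ell x 0 + Lv * norm \<xi>" using velocity_bound by blast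
  obtain P where P: "P > 0" "\<And>x \<xi>. norm \<xi> \<le> V \<Longrightarrow> norm (Pm x \<xi>) \<le> P" using Pm_bounded[where R = V] by blast
  obtain Cx where Cx: "Cx > 0" "\<And>x y p. norm p \<le> P \<Longrightarrow> \<bar>H x p - H y p\<bar> \<le> Cx * norm (x - y)"
    using H_lipschitz_x[where R = P] by blast
  obtain C1 where C1: "C1 > 0" "\<And>x \<xi>. (Lv + 1) * norm \<xi> - C1 \<le> ell x \<xi>" using ell_lower by blast
  show ?thesis
  proof (rule that[of "Cx * V"])
    fix x y :: "real^'n" and t :: real assume "0 < t"
    define f where "f t x = v x - t * ell y ((x - y) /\<^sub>R t)" for t x
    have "\<exists>x. norm (x - y) \<le> V * t \<and> (\<forall>z. f t z \<le> f t x)" if "t > 0" for t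
    proof -
      have "continuous_on (cball y (V * t)) (f t)"
        unfolding f_def by (intro continuous_intros continuous_on_subset[OF v_continuous]) auto
      moreover have "y \<in> cball y (V * t)" using V that by simp
      ultimately obtain x where x: "x \<in> cball y (V * t)" "\<And>z. z \<in> cball y (V * t) \<Longrightarrow> f t z \<le> f t x"
        using continuous_attains_sup[of "cball y (V * t)" "f t"] by (metis compact_cball empty_iff)
      have "f t z \<le> f t x" for z
      proof (cases "z \<in> cball y (V * t)")
        case False
        let ?\<xi> = "(z - y) /\<^sub>R t"
        have "norm (z - y) > V * t" using False by (simp add: dist_norm norm_minus_commute)
        then have "norm ?\<xi> > V" using \<open>t > 0\<close> by (simp add: norm_divideR pos_less_divide_eq del: norm_scaleR)
        then have "t * ell y ?\<xi> > t * (ell y 0 + Lv * norm ?\<xi>)" using V(2)[of ?\<xi> y] \<open>t > 0\<close> by simp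
        moreover have "t * (ell y 0 + Lv * norm ?\<xi>) = t * ell y 0 + Lv * norm (z - y)"
          using \<open>t > 0\<close> by (simp add: norm_divideR distrib_left del: norm_scaleR)
        ultimately have "f t z \<le> f t y" using v_lipschitz[of z y] by (simp add: f_def)
        then show ?thesis using x(2)[OF \<open>y \<in> cball y (V * t)\<close>] by simp
      qed (use x in auto)
      then show ?thesis using x(1) by (auto simp: dist_norm norm_minus_commute)
    qed
    then obtain xm where xm: "\<And>t. t > 0 \<Longrightarrow> norm (xm t - y) \<le> V * t" "\<And>t z. t > 0 \<Longrightarrow> f t z \<le> f t (xm t)"
      by metis
    define m where "m t = f t (xm t)" for t
    have sub: "H y (Pm y ((xm t - y) /\<^sub>R t)) \<le> a + Cx * V * t" if "t > 0" for t
    proof -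
      let ?p = "Pm y ((xm t - y) /\<^sub>R t)"
      define \<phi> where "\<phi> z = t * ell y ((z - y) /\<^sub>R t)" for z
      have "(\<phi> has_derivative (\<lambda>w. (Pm y ((z - y) /\<^sub>R t) - c) \<bullet> w)) (at z)" for z
      proof -
        have "((\<lambda>z. (z - y) /\<^sub>R t) has_derivative (\<lambda>w. w /\<^sub>R t)) (at z)" by (auto intro!: derivative_eq_intros)
        from has_derivative_mult_right[OF has_derivative_compose[OF this ell_has_derivative], of t]
        show ?thesis unfolding \<phi>_def by (rule has_derivative_eq_rhs) (use \<open>t > 0\<close> in auto)
      qed
      then have "H (xm t) (c + (?p - c)) \<le> a"
        by (rule subsolution_test) (use xm(2)[OF that] in \<open>auto intro!: continuous_intros simp: f_def \<phi>_def\<close>)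
      then have 1: "H (xm t) ?p \<le> a" by simp
      have "norm ?p \<le> P" using xm(1)[OF that] that by (intro P(2)) (simp add: norm_divideR pos_divide_le_eq del: norm_scaleR)
      then have "H y ?p \<le> H (xm t) ?p + Cx * norm (xm t - y)"
        using Cx(2)[of ?p y "xm t"] by (simp add: norm_minus_commute)
      also have "\<dots> \<le> a + Cx * (V * t)" using 1 xm(1)[OF that] Cx(1) by (intro add_mono mult_left_mono) auto
      finally show ?thesis by (simp add: mult.assoc)
    qed
    \<comment> \<open>An envelope argument that does not differentiate \<open>m\<close>: the
      maximiser of the later time \<open>u\<close> competes at the earlier time
      \<open>s\<close>.\<close>
    have inc: "m t - m s \<le> (Cx * V * t + \<epsilon>) * (t - s)" if "\<epsilon> > 0" "0 < s" "s < t" for s \<epsilon>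
    proof -
      obtain \<delta> where \<delta>: "\<delta> > 0" "\<delta> \<le> 1" and inc: "\<And>s t z \<sigma>. 0 < s \<Longrightarrow> s < t \<Longrightarrow> t \<le> (1 + \<delta>) * s \<Longrightarrow> norm z \<le> 2 * V * s \<Longrightarrow>
        \<sigma> \<in> {s..t} \<Longrightarrow> \<bar>t * ell y (z /\<^sub>R t) - s * ell y (z /\<^sub>R s) - (t - s) * (a - H y (Pm y (z /\<^sub>R \<sigma>)))\<bar> \<le> \<epsilon> * (t - s)"
        using perspective_increment[OF \<open>\<epsilon> > 0\<close> V(1), where x = y] by blast
      show ?thesis
      proof (rule increment_bound_chain[OF \<delta>(1) _ that(2,3) order_refl])
        fix s u assume su: "0 < s" "s < u" "u \<le> (1 + \<delta>) * s" "u \<le> t"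
        let ?z = "xm u - y"
        have "(1 + \<delta>) * s \<le> 2 * s" using su(1) \<delta>(2) by (intro mult_right_mono) auto
        then have "u \<le> 2 * s" using su(3) by linarith
        then have "V * u \<le> V * (2 * s)" using V(1) by simp
        then have "norm ?z \<le> 2 * V * s" using xm(1)[of u] su by simp
        from inc[OF su(1-3) this, of u]
        have "s * ell y (?z /\<^sub>R s) - u * ell y (?z /\<^sub>R u) \<le> (u - s) * (H y (Pm y (?z /\<^sub>R u)) - a) + \<epsilon> * (u - s)"
          using su by (simp add: abs_le_iff algebra_simps)
        also have "(u - s) * (H y (Pm y (?z /\<^sub>R u)) - a) \<le> (u - s) * (Cx * V * t)"
        proof (intro mult_left_mono)
          have "Cx * V * u \<le> Cx * V * t" using su Cx(1) V(1) by simp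
          then show "H y (Pm y (?z /\<^sub>R u)) - a \<le> Cx * V * t" using sub[of u] su by linarith
        qed (use su in simp)
        finally have "f u (xm u) - f s (xm u) \<le> (Cx * V * t + \<epsilon>) * (u - s)" by (simp add: f_def algebra_simps)
        then show "m u - m s \<le> (Cx * V * t + \<epsilon>) * (u - s)" using xm(2)[OF su(1), of "xm u"] by (simp add: m_def)
      qed
    qed
    have ms: "m s \<le> v y + (Lv * V + C1) * s" if "s > 0" for s
    proof -
      have "v (xm s) \<le> v y + Lv * (V * s)"
        using v_lipschitz[of "xm s" y] mult_left_mono[OF xm(1)[OF that] Lv_nonneg] by linarith
      moreover have "- C1 \<le> ell y ((xm s - y) /\<^sub>R s)"
      proof -
        have "0 \<le> (Lv + 1) * norm ((xm s - y) /\<^sub>R s)" using Lv_nonneg by (intro mult_nonneg_nonneg) auto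
        then show ?thesis using C1(2)[of "(xm s - y) /\<^sub>R s" y] by linarith
      qed
      then have "- (s * C1) \<le> s * ell y ((xm s - y) /\<^sub>R s)" using that by (metis less_imp_le mult_left_mono mult_minus_right)
      ultimately show ?thesis by (simp add: m_def f_def algebra_simps)
    qed
    have "m t \<le> v y + Cx * V * t * t"
    proof (rule field_le_epsilon)
      fix e :: real assume "e > 0"
      define k where "k = Lv * V + C1"
      have "k > 0" using Lv_nonneg V C1 by (simp add: k_def add_nonneg_pos)
      define \<epsilon> where "\<epsilon> = e / (2 * t)"
      define s where "s = min (t / 2) (e / (2 * k))"
      have s: "s > 0" "s < t" "k * s \<le> e / 2" and "\<epsilon> > 0"
      proof -
        show "s > 0" "s < t" "\<epsilon> > 0" using \<open>t > 0\<close> \<open>e > 0\<close> \<open>k > 0\<close> by (auto simp: s_def \<epsilon>_def)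
        have "s \<le> e / (2 * k)" by (simp add: s_def)
        then show "k * s \<le> e / 2" using \<open>k > 0\<close> by (simp add: field_simps)
      qed
      have "m t \<le> m s + (Cx * V * t + \<epsilon>) * (t - s)" using inc[OF \<open>\<epsilon> > 0\<close> s(1,2)] by simp
      also have "(Cx * V * t + \<epsilon>) * (t - s) \<le> (Cx * V * t + \<epsilon>) * t"
        using s \<open>\<epsilon> > 0\<close> \<open>t > 0\<close> Cx V by (intro mult_left_mono) auto
      also have "\<dots> = Cx * V * t * t + e / 2" using \<open>t > 0\<close> by (simp add: \<epsilon>_def distrib_right)
      also have "m s \<le> v y + e / 2" using ms[OF s(1)] s(3) by (simp add: k_def)
      finally show "m t \<le> v y + Cx * V * t * t + e" by simp
    qed
    then show "v x \<le> v y + t * ell y ((x - y) /\<^sub>R t) + Cx * V * t\<^sup>2"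
      using xm(2)[OF \<open>t > 0\<close>, of x] by (simp add: m_def f_def power2_eq_square mult.assoc)
  qed (use Cx V in simp)
qed

text \<open>The mirror image: now \<open>x\<close> is frozen, \<open>y\<close> minimises, and the
  supersolution test gives energy at least \<open>a\<close>. Opposite ends are frozen in the two
  estimates because the test function must vary in the point where it touches \<open>v\<close>. The
  minimiser itself is returned, as the next vertex of a backward chain.\<close>

lemma step_lower_bound:
  obtains C V where "C > 0" "V > 0" "\<And>x t. 0 < t \<Longrightarrow>
    \<exists>y. norm (x - y) \<le> V * t \<and> v y + t * ell x ((x - y) /\<^sub>R t) \<le> v x + C * t\<^sup>2"
proof -
  obtain V where V: "V > 0" "\<And>x \<xi>. norm \<xi> > V \<Longrightarrow> ell x \<xi> > ell x 0 + Lv * norm \<xi>" using velocity_bound by blast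
  obtain P where P: "P > 0" "\<And>x \<xi>. norm \<xi> \<le> V \<Longrightarrow> norm (Pm x \<xi>) \<le> P" using Pm_bounded[where R = V] by blast
  obtain Cx where Cx: "Cx > 0" "\<And>x y p. norm p \<le> P \<Longrightarrow> \<bar>H x p - H y p\<bar> \<le> Cx * norm (x - y)"
    using H_lipschitz_x[where R = P] by blast
  show ?thesis
  proof (rule that[of "Cx * V" V])
    fix x :: "real^'n" and t :: real assume "0 < t"
    define f where "f t y = v y + t * ell x ((x - y) /\<^sub>R t)" for t y
    have "\<exists>y. norm (x - y) \<le> V * t \<and> (\<forall>z. f t y \<le> f t z)" if "t > 0" for t
    proof -
      have "continuous_on (cball x (V * t)) (f t)"
        unfolding f_def by (intro continuous_intros continuous_on_subset[OF v_continuous]) auto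
      moreover have "x \<in> cball x (V * t)" using V that by simp
      ultimately obtain y where y: "y \<in> cball x (V * t)" "\<And>z. z \<in> cball x (V * t) \<Longrightarrow> f t y \<le> f t z"
        using continuous_attains_inf[of "cball x (V * t)" "f t"] by (metis compact_cball empty_iff)
      have "f t y \<le> f t z" for z
      proof (cases "z \<in> cball x (V * t)")
        case False
        let ?\<xi> = "(x - z) /\<^sub>R t"
        have "norm (x - z) > V * t" using False by (simp add: dist_norm)
        then have "norm ?\<xi> > V" using \<open>t > 0\<close> by (simp add: norm_divideR pos_less_divide_eq del: norm_scaleR)
        then have "t * ell x ?\<xi> > t * (ell x 0 + Lv * norm ?\<xi>)" using V(2)[of ?\<xi> x] \<open>t > 0\<close> by simp
        moreover have "t * (ell x 0 + Lv * norm ?\<xi>) = t * ell x 0 + Lv * norm (x - z)"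
          using \<open>t > 0\<close> by (simp add: norm_divideR distrib_left del: norm_scaleR)
        ultimately have "f t x \<le> f t z" using v_lipschitz[of x z] by (simp add: f_def)
        then show ?thesis using y(2)[OF \<open>x \<in> cball x (V * t)\<close>] by simp
      qed (use y in auto)
      then show ?thesis using y(1) by (auto simp: dist_norm)
    qed
    then obtain ym where ym: "\<And>t. t > 0 \<Longrightarrow> norm (x - ym t) \<le> V * t" "\<And>t z. t > 0 \<Longrightarrow> f t (ym t) \<le> f t z"
      by metis
    define m where "m t = f t (ym t)" for t
    have sup: "H x (Pm x ((x - ym t) /\<^sub>R t)) \<ge> a - Cx * V * t" if "t > 0" for t
    proof -
      let ?p = "Pm x ((x - ym t) /\<^sub>R t)"
      \<comment> \<open>The sign turns the minimum of the sum into a minimum of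
        \<open>v - \<phi>\<close>; the inner sign of \<open>x - z\<close> restores the gradient
        \<open>Pm - c\<close>.\<close>
      define \<phi> where "\<phi> z = - t * ell x ((x - z) /\<^sub>R t)" for z
      have "(\<phi> has_derivative (\<lambda>w. (Pm x ((x - z) /\<^sub>R t) - c) \<bullet> w)) (at z)" for z
      proof -
        have "((\<lambda>z. (x - z) /\<^sub>R t) has_derivative (\<lambda>w. - w /\<^sub>R t)) (at z)" by (auto intro!: derivative_eq_intros)
        from has_derivative_mult_right[OF has_derivative_compose[OF this ell_has_derivative], of "- t"]
        show ?thesis unfolding \<phi>_def by (rule has_derivative_eq_rhs) (use \<open>t > 0\<close> in auto)
      qed
      then have "H (ym t) (c + (?p - c)) \<ge> a"
        by (rule supersolution_test) (use ym(2)[OF that] in \<open>auto intro!: continuous_intros simp: f_def \<phi>_def\<close>)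
      then have 1: "H (ym t) ?p \<ge> a" by simp
      have "norm ?p \<le> P" using ym(1)[OF that] that by (intro P(2)) (simp add: norm_divideR pos_divide_le_eq del: norm_scaleR)
      then have "H (ym t) ?p - Cx * norm (x - ym t) \<le> H x ?p"
        using Cx(2)[of ?p x "ym t"] by simp
      moreover have "Cx * norm (x - ym t) \<le> Cx * (V * t)" using ym(1)[OF that] Cx(1) by simp
      ultimately show ?thesis using 1 by (simp add: mult.assoc)
    qed
    have inc: "m t - m s \<le> (Cx * V * t + \<epsilon>) * (t - s)" if "\<epsilon> > 0" "0 < s" "s < t" for s \<epsilon>
    proof -
      obtain \<delta> where \<delta>: "\<delta> > 0" "\<delta> \<le> 1" and inc: "\<And>s t z \<sigma>. 0 < s \<Longrightarrow> s < t \<Longrightarrow> t \<le> (1 + \<delta>) * s \<Longrightarrow> norm z \<le> 2 * V * s \<Longrightarrow>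
        \<sigma> \<in> {s..t} \<Longrightarrow> \<bar>t * ell x (z /\<^sub>R t) - s * ell x (z /\<^sub>R s) - (t - s) * (a - H x (Pm x (z /\<^sub>R \<sigma>)))\<bar> \<le> \<epsilon> * (t - s)"
        using perspective_increment[OF \<open>\<epsilon> > 0\<close> V(1), where x = x] by blast
      show ?thesis
      proof (rule increment_bound_chain[OF \<delta>(1) _ that(2,3) order_refl])
        fix s u assume su: "0 < s" "s < u" "u \<le> (1 + \<delta>) * s" "u \<le> t"
        \<comment> \<open>Here the minimiser of the earlier time competes at the later one, so the
          energy is taken at the left endpoint.\<close>
        let ?z = "x - ym s"
        have "norm ?z \<le> 2 * V * s" using ym(1)[OF su(1)] mult_pos_pos[OF V(1) su(1)] by simp
        from inc[OF su(1-3) this, of s]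
        have "u * ell x (?z /\<^sub>R u) - s * ell x (?z /\<^sub>R s) \<le> (u - s) * (a - H x (Pm x (?z /\<^sub>R s))) + \<epsilon> * (u - s)"
          using su by (simp add: abs_le_iff algebra_simps)
        also have "(u - s) * (a - H x (Pm x (?z /\<^sub>R s))) \<le> (u - s) * (Cx * V * t)"
        proof (intro mult_left_mono)
          have "Cx * V * s \<le> Cx * V * t" using su Cx(1) V(1) by simp
          then show "a - H x (Pm x (?z /\<^sub>R s)) \<le> Cx * V * t" using sup[of s] su by linarith
        qed (use su in simp)
        finally have "f u (ym s) - f s (ym s) \<le> (Cx * V * t + \<epsilon>) * (u - s)" by (simp add: f_def algebra_simps)
        then show "m u - m s \<le> (Cx * V * t + \<epsilon>) * (u - s)" using ym(2)[of u "ym s"] su by (simp add: m_def)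
      qed
    qed
    have ms: "m s \<le> v x + ell x 0 * s" if "s > 0" for s
      using ym(2)[OF that, of x] by (simp add: m_def f_def mult.commute)
    have "m t \<le> v x + Cx * V * t * t"
    proof (rule field_le_epsilon)
      fix e :: real assume "e > 0"
      define k where "k = \<bar>ell x 0\<bar> + 1"
      have "k > 0" by (simp add: k_def)
      define \<epsilon> where "\<epsilon> = e / (2 * t)"
      define s where "s = min (t / 2) (e / (2 * k))"
      have s: "s > 0" "s < t" "k * s \<le> e / 2" and "\<epsilon> > 0"
      proof -
        show "s > 0" "s < t" "\<epsilon> > 0" using \<open>t > 0\<close> \<open>e > 0\<close> \<open>k > 0\<close> by (auto simp: s_def \<epsilon>_def)
        have "s \<le> e / (2 * k)" by (simp add: s_def)
        then show "k * s \<le> e / 2" using \<open>k > 0\<close> by (simp add: field_simps)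
      qed
      have "m t \<le> m s + (Cx * V * t + \<epsilon>) * (t - s)" using inc[OF \<open>\<epsilon> > 0\<close> s(1,2)] by simp
      also have "(Cx * V * t + \<epsilon>) * (t - s) \<le> (Cx * V * t + \<epsilon>) * t"
        using s \<open>\<epsilon> > 0\<close> \<open>t > 0\<close> Cx V by (intro mult_left_mono) auto
      also have "\<dots> = Cx * V * t * t + e / 2" using \<open>t > 0\<close> by (simp add: \<epsilon>_def distrib_right)
      also have "m s \<le> v x + e / 2"
      proof -
        have "ell x 0 * s \<le> k * s" using s(1) by (intro mult_right_mono) (auto simp: k_def)
        then show ?thesis using ms[OF s(1)] s(3) by simp
      qed
      finally show "m t \<le> v x + Cx * V * t * t + e" by simp
    qed
    then show "\<exists>y. norm (x - y) \<le> V * t \<and> v y + t * ell x ((x - y) /\<^sub>R t) \<le> v x + Cx * V * t\<^sup>2"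
      using ym(1)[OF \<open>t > 0\<close>] by (intro exI[of _ "ym t"]) (simp add: m_def f_def power2_eq_square mult.assoc)
  qed (use Cx V in auto)
qed

text \<open>Dividing the upper step estimate by a step tending to 0 from the right removes the
  quadratic error. Only differentiability at the single time \<open>u\<close> enters, so the bound
  is available almost everywhere along absolutely continuous curves.\<close>

lemma derivative_along_le_ell:
  assumes \<eta>: "(\<eta> has_vector_derivative \<xi>) (at u)" and f: "((\<lambda>u. v (\<eta> u)) has_real_derivative f') (at u)"
  shows "f' \<le> ell (\<eta> u) \<xi>"
proof -
  obtain C where C: "C > 0" "\<And>x y t. 0 < t \<Longrightarrow> v x \<le> v y + t * ell y ((x - y) /\<^sub>R t) + C * t\<^sup>2"
    using step_upper_bound by blast
  have "((\<lambda>h. (v (\<eta> (u + h)) - v (\<eta> u)) / h) \<longlongrightarrow> f') (at 0)"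
    using f by (simp add: DERIV_def)
  then have 1: "((\<lambda>h. (v (\<eta> (u + h)) - v (\<eta> u)) / h) \<longlongrightarrow> f') (at_right 0)"
    by (simp add: filterlim_at_split)
  have "((\<lambda>h. (\<eta> (u + h) - \<eta> u) /\<^sub>R h) \<longlongrightarrow> \<xi>) (at_right 0)"
    using vector_derivative_quotient_tendsto[OF \<eta>] by (simp add: filterlim_at_split)
  moreover have "isCont (ell (\<eta> u)) \<xi>" by (rule has_derivative_continuous[OF ell_has_derivative])
  ultimately have "((\<lambda>h. ell (\<eta> u) ((\<eta> (u + h) - \<eta> u) /\<^sub>R h)) \<longlongrightarrow> ell (\<eta> u) \<xi>) (at_right 0)"
    by (rule isCont_tendsto_compose[rotated])
  then have "((\<lambda>h. ell (\<eta> u) ((\<eta> (u + h) - \<eta> u) /\<^sub>R h) + C * h) \<longlongrightarrow> ell (\<eta> u) \<xi> + C * 0) (at_right 0)"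
    by (intro tendsto_intros)
  then have 2: "((\<lambda>h. ell (\<eta> u) ((\<eta> (u + h) - \<eta> u) /\<^sub>R h) + C * h) \<longlongrightarrow> ell (\<eta> u) \<xi>) (at_right 0)" by simp
  have "\<forall>\<^sub>F h in at_right 0. (v (\<eta> (u + h)) - v (\<eta> u)) / h \<le> ell (\<eta> u) ((\<eta> (u + h) - \<eta> u) /\<^sub>R h) + C * h"
    unfolding eventually_at_right_field
  proof (intro exI[of _ 1] conjI allI impI zero_less_one)
    fix h :: real assume "h > 0"
    then show "(v (\<eta> (u + h)) - v (\<eta> u)) / h \<le> ell (\<eta> u) ((\<eta> (u + h) - \<eta> u) /\<^sub>R h) + C * h"
      using C(2)[of h "\<eta> (u + h)" "\<eta> u"] by (simp add: pos_divide_le_eq power2_eq_square algebra_simps)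
  qed
  then show ?thesis by (rule tendsto_le[OF trivial_limit_at_right_real 2 1])
qed

section \<open>Domination by the action along absolutely continuous curves\<close>

lemma v_along_abs_cont:
  assumes "abs_cont_on s t \<eta>"
  shows "abs_cont_on s t (\<lambda>u. v (\<eta> u))"
  by (rule abs_cont_on_compose_lipschitz[OF assms v_lipschitz_on])

lemma v_along_derivative_ae:
  assumes ac: "abs_cont_on s t \<eta>" and "s \<le> t"
  obtains N where "negligible N" "((\<lambda>u. vector_derivative (\<lambda>u. v (\<eta> u)) (at u)) has_integral (v (\<eta> t) - v (\<eta> s))) {s..t}"
    "\<And>u. u \<in> {s..t} - N \<Longrightarrow> (\<eta> has_vector_derivative vector_derivative \<eta> (at u)) (at u)"
    "\<And>u. u \<in> {s..t} - N \<Longrightarrow> ((\<lambda>u. v (\<eta> u)) has_real_derivative vector_derivative (\<lambda>u. v (\<eta> u)) (at u)) (at u)"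
    "\<And>u. u \<in> {s..t} - N \<Longrightarrow> vector_derivative (\<lambda>u. v (\<eta> u)) (at u) \<le> ell (\<eta> u) (vector_derivative \<eta> (at u))"
proof -
  define N where "N = {u \<in> {s..t}. \<not> \<eta> differentiable (at u)} \<union> {u \<in> {s..t}. \<not> (\<lambda>u. v (\<eta> u)) differentiable (at u)}"
  have "negligible N" unfolding N_def
    by (intro negligible_Un abs_cont_differentiable_ae ac v_along_abs_cont)
  moreover have "((\<lambda>u. vector_derivative (\<lambda>u. v (\<eta> u)) (at u)) has_integral (v (\<eta> t) - v (\<eta> s))) {s..t}"
    by (rule abs_cont_fundamental_theorem[OF v_along_abs_cont[OF ac] \<open>s \<le> t\<close>])
  moreover have 1: "(\<eta> has_vector_derivative vector_derivative \<eta> (at u)) (at u)" if "u \<in> {s..t} - N" for u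
    using that by (auto simp: N_def vector_derivative_works)
  moreover have 2: "((\<lambda>u. v (\<eta> u)) has_real_derivative vector_derivative (\<lambda>u. v (\<eta> u)) (at u)) (at u)" if "u \<in> {s..t} - N" for u
    using that by (auto simp: N_def vector_derivative_works has_real_derivative_iff_has_vector_derivative)
  moreover have "vector_derivative (\<lambda>u. v (\<eta> u)) (at u) \<le> ell (\<eta> u) (vector_derivative \<eta> (at u))" if "u \<in> {s..t} - N" for u
    by (rule derivative_along_le_ell[OF 1[OF that] 2[OF that]])
  ultimately show ?thesis using that by blast
qed

lemma ell_along_integrable:
  assumes ac: "abs_cont_on s t \<eta>" and "s \<le> t"
    and L: "(\<lambda>u. Lag H (\<eta> u) (vector_derivative \<eta> (at u))) integrable_on {s..t}"
  shows "(\<lambda>u. ell (\<eta> u) (vector_derivative \<eta> (at u))) integrable_on {s..t}"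
proof -
  have "(\<lambda>u. vector_derivative \<eta> (at u)) integrable_on {s..t}"
    using abs_cont_fundamental_theorem[OF ac \<open>s \<le> t\<close>] by blast
  then have "(\<lambda>u. c \<bullet> vector_derivative \<eta> (at u)) integrable_on {s..t}"
    using integrable_linear[OF _ bounded_linear_inner_right, of _ _ c] by (simp add: o_def)
  then show ?thesis unfolding ell_def using L
    by (intro integrable_add integrable_diff integrable_const_ivl)
qed

text \<open>\<open>v\<close> along the curve is again absolutely continuous, so it is recovered from
  its derivative and the pointwise bound integrates.\<close>

theorem domination:
  assumes ac: "abs_cont_on s t \<eta>" and "s \<le> t"
    and L: "(\<lambda>u. Lag H (\<eta> u) (vector_derivative \<eta> (at u))) integrable_on {s..t}"
  shows "v (\<eta> t) - v (\<eta> s) \<le> integral {s..t} (\<lambda>u. ell (\<eta> u) (vector_derivative \<eta> (at u)))"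
proof -
  obtain N where N: "negligible N" "((\<lambda>u. vector_derivative (\<lambda>u. v (\<eta> u)) (at u)) has_integral (v (\<eta> t) - v (\<eta> s))) {s..t}"
    "\<And>u. u \<in> {s..t} - N \<Longrightarrow> (\<eta> has_vector_derivative vector_derivative \<eta> (at u)) (at u)"
    "\<And>u. u \<in> {s..t} - N \<Longrightarrow> ((\<lambda>u. v (\<eta> u)) has_real_derivative vector_derivative (\<lambda>u. v (\<eta> u)) (at u)) (at u)"
    "\<And>u. u \<in> {s..t} - N \<Longrightarrow> vector_derivative (\<lambda>u. v (\<eta> u)) (at u) \<le> ell (\<eta> u) (vector_derivative \<eta> (at u))"
    using v_along_derivative_ae[OF ac \<open>s \<le> t\<close>] by blast
  show ?thesis
    by (rule has_integral_le_ae[OF N(2) integrable_integral[OF ell_along_integrable[OF assms]] N(1,5)])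
qed

end

section \<open>Calibrated curves\<close>

lemma C1_uniform_expansion:
  fixes f :: "'a::euclidean_space \<Rightarrow> real"
  assumes d: "\<And>z. (f has_derivative (\<lambda>w. g z \<bullet> w)) (at z)" and g: "continuous_on UNIV g"
    and K: "compact K" and "e > 0"
  obtains \<delta> where "\<delta> > 0" "\<And>z w. z \<in> K \<Longrightarrow> norm w < \<delta> \<Longrightarrow> \<bar>f (z + w) - f z - g z \<bullet> w\<bar> \<le> e * norm w"
proof -
  define K' where "K' = (\<lambda>(x,y). x + y) ` (K \<times> cball 0 1)"
  have "compact K'" unfolding K'_def
    by (intro compact_continuous_image compact_Times K compact_cball) (auto intro!: continuous_intros simp: case_prod_beta)
  then have "uniformly_continuous_on K' g"
    using g by (intro compact_uniformly_continuous) (auto intro: continuous_on_subset)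
  then obtain \<delta> where \<delta>: "\<delta> > 0" "\<And>x y. x \<in> K' \<Longrightarrow> y \<in> K' \<Longrightarrow> dist y x < \<delta> \<Longrightarrow> dist (g y) (g x) < e"
    unfolding uniformly_continuous_on_def using \<open>e > 0\<close> by metis
  show ?thesis
  proof (rule that[of "min \<delta> 1"])
    fix z w :: 'a assume z: "z \<in> K" and w: "norm w < min \<delta> 1"
    obtain y where y: "y \<in> closed_segment z (z + w)" "f (z + w) - f z = g y \<bullet> (z + w - z)"
      by (rule mean_value_segment[OF d])
    have "norm (y - z) \<le> norm w" using segment_bound(1)[OF y(1)] by simp
    moreover have "y \<in> K'" unfolding K'_def
      by (rule image_eqI[of _ _ "(z, y - z)"]) (use z w \<open>norm (y - z) \<le> norm w\<close> in auto)
    moreover have "z \<in> K'" unfolding K'_def by (rule image_eqI[of _ _ "(z, 0)"]) (use z in auto)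
    ultimately have "norm (g y - g z) < e" using \<delta>(2)[of z y] w by (simp add: dist_norm)
    have "f (z + w) - f z - g z \<bullet> w = (g y - g z) \<bullet> w" using y(2) by (simp add: inner_diff_left)
    then have "\<bar>f (z + w) - f z - g z \<bullet> w\<bar> \<le> norm (g y - g z) * norm w" using Cauchy_Schwarz_ineq2 by metis
    also have "\<dots> \<le> e * norm w" using \<open>norm (g y - g z) < e\<close> by (intro mult_right_mono) auto
    finally show "\<bar>f (z + w) - f z - g z \<bullet> w\<bar> \<le> e * norm w" .
  qed (use \<delta> in simp)
qed

text \<open>The velocity is controlled only off a null set. Truncating it at \<open>V\<close> gives
  a bounded measurable integrand that differs only there. The explicit time argument of
  \<open>g\<close> makes room for the affine factor of a variation.\<close>

lemma continuous_along_integrable: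
  fixes \<gamma> :: "real \<Rightarrow> 'a::euclidean_space" and g :: "real \<times> 'a \<times> 'a \<Rightarrow> 'b::euclidean_space"
  assumes ac: "abs_cont_on s t \<gamma>" and "s \<le> t" and N: "negligible N"
    and V: "\<And>u. u \<in> {s..t} - N \<Longrightarrow> norm (vector_derivative \<gamma> (at u)) \<le> V"
    and g: "continuous_on UNIV g"
  shows "(\<lambda>u. g (u, \<gamma> u, vector_derivative \<gamma> (at u))) integrable_on {s..t}"
proof -
  define d where "d u = (if norm (vector_derivative \<gamma> (at u)) \<le> V then vector_derivative \<gamma> (at u) else 0)" for u
  have "V \<ge> 0 \<or> {s..t} \<subseteq> N" using V norm_ge_zero order_trans by (metis Diff_iff subsetI)
  then show ?thesis
  proof
    assume "{s..t} \<subseteq> N"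
    then show ?thesis using N by (meson integrable_negligible negligible_subset)
  next
    assume "V \<ge> 0"
    have "(\<lambda>u. vector_derivative \<gamma> (at u)) integrable_on {s..t}"
      using abs_cont_fundamental_theorem[OF ac \<open>s \<le> t\<close>] by blast
    then have m [measurable]: "(\<lambda>u. vector_derivative \<gamma> (at u)) \<in> borel_measurable (lebesgue_on {s..t})"
      by (rule integrable_imp_measurable)
    have [measurable]: "d \<in> borel_measurable (lebesgue_on {s..t})" unfolding d_def by measurable
    have [measurable]: "\<gamma> \<in> borel_measurable (lebesgue_on {s..t})"
      by (rule continuous_imp_measurable_on_sets_lebesgue[OF abs_cont_on_continuous[OF ac]]) simp
    have [measurable]: "(\<lambda>u::real. u) \<in> borel_measurable (lebesgue_on {s..t})"
      by (rule continuous_imp_measurable_on_sets_lebesgue) (auto intro: continuous_intros)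
    have [measurable]: "g \<in> borel_measurable borel" using g by (rule borel_measurable_continuous_onI)
    have "(\<lambda>u. (u, \<gamma> u, d u)) \<in> borel_measurable (lebesgue_on {s..t})"
      by (intro borel_measurable_Pair) measurable
    then have meas: "(\<lambda>u. g (u, \<gamma> u, d u)) \<in> borel_measurable (lebesgue_on {s..t})" by measurable
    have "compact (g ` ({s..t} \<times> \<gamma> ` {s..t} \<times> cball 0 V))"
      using g abs_cont_on_continuous[OF ac]
      by (intro compact_continuous_image compact_Times) (auto intro: continuous_on_subset)
    then obtain M where M: "\<And>y. y \<in> g ` ({s..t} \<times> \<gamma> ` {s..t} \<times> cball 0 V) \<Longrightarrow> norm y \<le> M"
      using compact_imp_bounded bounded_iff by metis
    have "(\<lambda>u. g (u, \<gamma> u, d u)) integrable_on {s..t}"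
    proof (rule measurable_bounded_by_integrable_imp_integrable[OF meas])
      show "(\<lambda>u. M) integrable_on {s..t}" by (rule integrable_const_ivl)
      show "norm (g (u, \<gamma> u, d u)) \<le> M" if "u \<in> {s..t}" for u
        by (rule M, rule imageI) (use that \<open>V \<ge> 0\<close> in \<open>auto simp: d_def\<close>)
    qed simp
    then show ?thesis
      by (rule integrable_spike[OF _ N]) (use V in \<open>auto simp: d_def\<close>)
  qed
qed

text \<open>A small multiple of \<open>g2 - g1\<close> as test vector forces the two slopes to
  agree. The first conclusion also serves alone, to match a support slope with an existing
  gradient.\<close>

lemma has_derivative_of_two_sided_support:
  fixes f :: "'a::real_inner \<Rightarrow> real"
  assumes up: "\<And>e. e > 0 \<Longrightarrow> \<exists>d>0. \<forall>w. norm w < d \<longrightarrow> f (x + w) \<le> f x + g1 \<bullet> w + e * norm w"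
    and lo: "\<And>e. e > 0 \<Longrightarrow> \<exists>d>0. \<forall>w. norm w < d \<longrightarrow> f x + g2 \<bullet> w - e * norm w \<le> f (x + w)"
  shows "g1 = g2" "(f has_derivative (\<lambda>w. g1 \<bullet> w)) (at x)"
proof -
  have "norm (g2 - g1) \<le> 2 * e" if "e > 0" for e
  proof -
    obtain d1 where d1: "d1 > 0" "\<And>w. norm w < d1 \<Longrightarrow> f (x + w) \<le> f x + g1 \<bullet> w + e * norm w" using up[OF \<open>e > 0\<close>] by blast
    obtain d2 where d2: "d2 > 0" "\<And>w. norm w < d2 \<Longrightarrow> f x + g2 \<bullet> w - e * norm w \<le> f (x + w)" using lo[OF \<open>e > 0\<close>] by blast
    show ?thesis
    proof (cases "g2 = g1")
      case False
      define k where "k = min d1 d2 / (2 * norm (g2 - g1))"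
      have "k > 0" using False d1(1) d2(1) by (simp add: k_def)
      define w where "w = k *\<^sub>R (g2 - g1)"
      have nw: "norm w = k * norm (g2 - g1)" using \<open>k > 0\<close> by (simp add: w_def)
      have "norm w = min d1 d2 / 2" using False by (simp add: nw k_def)
      then have "norm w < d1" "norm w < d2" using d1(1) d2(1) by linarith+
      then have "(g2 - g1) \<bullet> w \<le> 2 * e * norm w" using d1(2)[of w] d2(2)[of w] by (simp add: inner_diff_left)
      moreover have "(g2 - g1) \<bullet> w = norm (g2 - g1) * norm w"
        by (simp add: w_def nw power2_norm_eq_inner[symmetric] power2_eq_square) (use \<open>k > 0\<close> in simp)
      ultimately have "norm (g2 - g1) * norm w \<le> 2 * e * norm w" by simp
      moreover have "norm w > 0" using \<open>k > 0\<close> False by (simp add: nw)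
      ultimately show ?thesis by simp
    qed (use that in simp)
  qed
  then have "norm (g2 - g1) \<le> 0 + e" if "e > 0" for e using that by (metis add_0 field_sum_of_halves half_gt_zero mult_2)
  then have "norm (g2 - g1) \<le> 0" by (rule field_le_epsilon)
  then show eq: "g1 = g2" by simp
  show "(f has_derivative (\<lambda>w. g1 \<bullet> w)) (at x)"
    unfolding has_derivative_at_alt
  proof (intro conjI allI impI)
    show "bounded_linear (\<lambda>w. g1 \<bullet> w)" by (rule bounded_linear_inner_right)
    fix e :: real assume "e > 0"
    obtain d1 where d1: "d1 > 0" "\<And>w. norm w < d1 \<Longrightarrow> f (x + w) \<le> f x + g1 \<bullet> w + e * norm w" using up[OF \<open>e > 0\<close>] by blast
    obtain d2 where d2: "d2 > 0" "\<And>w. norm w < d2 \<Longrightarrow> f x + g2 \<bullet> w - e * norm w \<le> f (x + w)" using lo[OF \<open>e > 0\<close>] by blast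
    show "\<exists>d>0. \<forall>y. norm (y - x) < d \<longrightarrow> norm (f y - f x - g1 \<bullet> (y - x)) \<le> e * norm (y - x)"
    proof (intro exI[of _ "min d1 d2"] conjI allI impI)
      fix y assume "norm (y - x) < min d1 d2"
      then show "norm (f y - f x - g1 \<bullet> (y - x)) \<le> e * norm (y - x)"
        using d1(2)[of "y - x"] d2(2)[of "y - x"] eq by (simp add: abs_le_iff)
    qed (use d1 d2 in simp)
  qed
qed

context weak_kam
begin

text \<open>The equality case of \<open>domination\<close>. Integrability is part of the notion
  because \<open>integral\<close> of a non-integrable function is 0 and the equation could then hold
  spuriously.\<close>

definition calibrated :: "real \<Rightarrow> real \<Rightarrow> (real \<Rightarrow> real^'n) \<Rightarrow> bool" where
  "calibrated s t \<gamma> \<longleftrightarrow> abs_cont_on s t \<gamma> \<and>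
     (\<lambda>u. Lag H (\<gamma> u) (vector_derivative \<gamma> (at u))) integrable_on {s..t} \<and>
     integral {s..t} (\<lambda>u. ell (\<gamma> u) (vector_derivative \<gamma> (at u))) = v (\<gamma> t) - v (\<gamma> s)"

text \<open>Domination on the two outer pieces and additivity of the integral leave no slack on the
  middle piece.\<close>

lemma calibrated_subinterval:
  assumes cal: "calibrated s t \<gamma>" and "s \<le> s'" "s' \<le> t'" "t' \<le> t"
  shows "calibrated s' t' \<gamma>"
proof -
  let ?L = "\<lambda>u. Lag H (\<gamma> u) (vector_derivative \<gamma> (at u))"
  let ?l = "\<lambda>u. ell (\<gamma> u) (vector_derivative \<gamma> (at u))"
  have ac: "abs_cont_on p q \<gamma>" and L: "?L integrable_on {p..q}" if "s \<le> p" "q \<le> t" for p q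
    using cal that unfolding calibrated_def
    by (auto intro: abs_cont_on_subinterval integrable_on_subinterval)
  have l: "?l integrable_on {s..t}" by (rule ell_along_integrable) (use ac L assms in auto)
  have dom: "v (\<gamma> q) - v (\<gamma> p) \<le> integral {p..q} ?l" if "s \<le> p" "p \<le> q" "q \<le> t" for p q
    by (rule domination) (use ac L that in auto)
  have "integral {s..t} ?l = integral {s..s'} ?l + integral {s'..t'} ?l + integral {t'..t} ?l"
  proof -
    have "integral {s..t'} ?l + integral {t'..t} ?l = integral {s..t} ?l"
      by (rule Henstock_Kurzweil_Integration.integral_combine) (use assms l in auto)
    moreover have "integral {s..s'} ?l + integral {s'..t'} ?l = integral {s..t'} ?l"
      by (rule Henstock_Kurzweil_Integration.integral_combine) (use assms integrable_on_subinterval[OF l] in auto)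
    ultimately show ?thesis by simp
  qed
  then have "integral {s'..t'} ?l \<le> v (\<gamma> t') - v (\<gamma> s')"
    using cal dom[of s s'] dom[of t' t] assms unfolding calibrated_def by linarith
  then have "integral {s'..t'} ?l = v (\<gamma> t') - v (\<gamma> s')" using dom[of s' t'] assms by simp
  then show ?thesis using ac[of s' t'] L[of s' t'] assms by (simp add: calibrated_def)
qed

text \<open>Equality of the integrals turns the pointwise bound into equality almost everywhere.
  Since \<open>v\<close> changes at most at rate \<open>Lv\<close> per unit distance while
  \<open>ell\<close> grows with slope \<open>Lv + 1\<close>, the speed is then at most the constant
  of \<open>ell_lower\<close>, the same for all calibrated curves.\<close>

lemma calibrated_derivative_ae:
  obtains V where "V > 0" "\<And>s t \<gamma>. calibrated s t \<gamma> \<Longrightarrow> s \<le> t \<Longrightarrow> \<exists>N. negligible N \<and>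
     (\<forall>u\<in>{s..t} - N. (\<gamma> has_vector_derivative vector_derivative \<gamma> (at u)) (at u) \<and>
        ((\<lambda>u. v (\<gamma> u)) has_real_derivative ell (\<gamma> u) (vector_derivative \<gamma> (at u))) (at u) \<and>
        norm (vector_derivative \<gamma> (at u)) \<le> V)"
proof -
  obtain C where C: "C > 0" "\<And>x \<xi>. (Lv + 1) * norm \<xi> - C \<le> ell x \<xi>" using ell_lower by blast
  show ?thesis
  proof (rule that[OF C(1)])
    fix s t \<gamma> assume cal: "calibrated s t \<gamma>" and "s \<le> t"
    let ?f = "\<lambda>u. vector_derivative (\<lambda>u. v (\<gamma> u)) (at u)"
    let ?l = "\<lambda>u. ell (\<gamma> u) (vector_derivative \<gamma> (at u))"
    have ac: "abs_cont_on s t \<gamma>" using cal by (simp add: calibrated_def)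
    obtain N where N: "negligible N" "(?f has_integral (v (\<gamma> t) - v (\<gamma> s))) {s..t}"
      "\<And>u. u \<in> {s..t} - N \<Longrightarrow> (\<gamma> has_vector_derivative vector_derivative \<gamma> (at u)) (at u)"
      "\<And>u. u \<in> {s..t} - N \<Longrightarrow> ((\<lambda>u. v (\<gamma> u)) has_real_derivative ?f u) (at u)"
      "\<And>u. u \<in> {s..t} - N \<Longrightarrow> ?f u \<le> ?l u"
      using v_along_derivative_ae[OF ac \<open>s \<le> t\<close>] by blast
    have il: "?l integrable_on {s..t}" using cal \<open>s \<le> t\<close> by (intro ell_along_integrable) (auto simp: calibrated_def)
    have "integral {s..t} ?l = v (\<gamma> t) - v (\<gamma> s)" using cal by (simp add: calibrated_def)
    then have "(?l has_integral (v (\<gamma> t) - v (\<gamma> s))) {s..t}"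
      using integrable_integral[OF il] by (simp only:)
    from has_integral_eq_imp_eq_ae[OF N(2) this N(1,5)]
    have N2: "negligible (N \<union> {u \<in> {s..t}. ?f u \<noteq> ?l u})" using N(1) by simp
    show "\<exists>N. negligible N \<and> (\<forall>u\<in>{s..t} - N. (\<gamma> has_vector_derivative vector_derivative \<gamma> (at u)) (at u) \<and>
        ((\<lambda>u. v (\<gamma> u)) has_real_derivative ell (\<gamma> u) (vector_derivative \<gamma> (at u))) (at u) \<and>
        norm (vector_derivative \<gamma> (at u)) \<le> C)"
    proof (intro exI[of _ "N \<union> {u \<in> {s..t}. ?f u \<noteq> ?l u}"] conjI N2 ballI)
      fix u assume u: "u \<in> {s..t} - (N \<union> {u \<in> {s..t}. ?f u \<noteq> ?l u})"
      then have uN: "u \<in> {s..t} - N" and fl: "?f u = ?l u" by auto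
      let ?\<xi> = "vector_derivative \<gamma> (at u)"
      show 1: "(\<gamma> has_vector_derivative ?\<xi>) (at u)" using N(3)[OF uN] .
      show 2: "((\<lambda>u. v (\<gamma> u)) has_real_derivative ?l u) (at u)" using N(4)[OF uN] fl by simp
      have "((\<lambda>h. \<bar>(v (\<gamma> (u + h)) - v (\<gamma> u)) / h\<bar>) \<longlongrightarrow> \<bar>?l u\<bar>) (at 0)"
        using 2 by (intro tendsto_rabs) (simp add: DERIV_def)
      moreover have "((\<lambda>h. Lv * norm ((\<gamma> (u + h) - \<gamma> u) /\<^sub>R h)) \<longlongrightarrow> Lv * norm ?\<xi>) (at 0)"
        by (intro tendsto_intros vector_derivative_quotient_tendsto[OF 1])
      moreover have "\<forall>\<^sub>F h in at 0. \<bar>(v (\<gamma> (u + h)) - v (\<gamma> u)) / h\<bar> \<le> Lv * norm ((\<gamma> (u + h) - \<gamma> u) /\<^sub>R h)"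
      proof (rule always_eventually, rule allI)
        fix h :: real
        have "\<bar>v (\<gamma> (u + h)) - v (\<gamma> u)\<bar> * inverse \<bar>h\<bar> \<le> Lv * norm (\<gamma> (u + h) - \<gamma> u) * inverse \<bar>h\<bar>"
          by (intro mult_right_mono v_lipschitz) auto
        then show "\<bar>(v (\<gamma> (u + h)) - v (\<gamma> u)) / h\<bar> \<le> Lv * norm ((\<gamma> (u + h) - \<gamma> u) /\<^sub>R h)"
          by (simp add: divide_inverse abs_mult ac_simps)
      qed
      ultimately have "\<bar>?l u\<bar> \<le> Lv * norm ?\<xi>"
        by (intro tendsto_le[of "at (0::real)"]) auto
      then show "norm ?\<xi> \<le> C" using C(2)[of ?\<xi> "\<gamma> u"] by (simp add: distrib_right)
    qed
  qed
qed

definition ell_grad :: "(real^'n) \<times> (real^'n) \<Rightarrow> (real^'n) \<times> (real^'n)" where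
  "ell_grad z = (- Hx (fst z) (Pm (fst z) (snd z)), Pm (fst z) (snd z) - c)"

lemma ell_has_derivative_joint:
  "((\<lambda>z. ell (fst z) (snd z)) has_derivative (\<lambda>w. ell_grad z \<bullet> w)) (at z)"
proof -
  have "((\<lambda>z. Lag H (fst z) (snd z)) has_derivative
     (\<lambda>w. - (Hx (fst z) (Pm (fst z) (snd z)) \<bullet> fst w) + Pm (fst z) (snd z) \<bullet> snd w)) (at z)"
    using Lag_has_derivative[of "fst z" "snd z"] by simp
  then have "((\<lambda>z. Lag H (fst z) (snd z) - c \<bullet> snd z + a) has_derivative
     (\<lambda>w. - (Hx (fst z) (Pm (fst z) (snd z)) \<bullet> fst w) + Pm (fst z) (snd z) \<bullet> snd w - c \<bullet> snd w)) (at z)"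
    by (auto intro!: derivative_eq_intros)
  then show ?thesis unfolding ell_def
    by (rule has_derivative_eq_rhs) (auto simp: ell_grad_def inner_prod_def inner_diff_left inner_minus_left)
qed

lemma continuous_on_ell_grad: "continuous_on UNIV ell_grad"
  unfolding ell_grad_def by (intro continuous_intros)

text \<open>
  Compare \<open>\<gamma>\<close> with \<open>\<gamma> u + (\<alpha> + \<beta> * u) *\<^sub>R w\<close>. Choosing the affine factor to vanish at one endpoint yields a
  one-sided support of \<open>v\<close> at the other endpoint.
\<close>

lemma calibrated_variation:
  fixes \<alpha> \<beta> :: real
  assumes cal: "calibrated s t \<gamma>" and "s \<le> t"
  defines "G \<equiv> integral {s..t} (\<lambda>u. \<beta> *\<^sub>R (Pm (\<gamma> u) (vector_derivative \<gamma> (at u)) - c)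
      - (\<alpha> + \<beta> * u) *\<^sub>R Hx (\<gamma> u) (Pm (\<gamma> u) (vector_derivative \<gamma> (at u))))"
  assumes "e > 0"
  shows "\<exists>d>0. \<forall>w. norm w < d \<longrightarrow> v (\<gamma> t + (\<alpha> + \<beta> * t) *\<^sub>R w) - v (\<gamma> s + (\<alpha> + \<beta> * s) *\<^sub>R w)
     \<le> v (\<gamma> t) - v (\<gamma> s) + G \<bullet> w + e * norm w"
proof -
  have ac: "abs_cont_on s t \<gamma>" using cal by (simp add: calibrated_def)
  obtain V N where V: "V > 0" and N: "negligible N"
    "\<And>u. u \<in> {s..t} - N \<Longrightarrow> (\<gamma> has_vector_derivative vector_derivative \<gamma> (at u)) (at u)"
    "\<And>u. u \<in> {s..t} - N \<Longrightarrow> norm (vector_derivative \<gamma> (at u)) \<le> V"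
    using calibrated_derivative_ae cal \<open>s \<le> t\<close> by (metis (no_types, lifting))
  let ?d = "\<lambda>u. vector_derivative \<gamma> (at u)"
  note int = continuous_along_integrable[OF ac \<open>s \<le> t\<close> N(1,3)]
  \<comment> \<open>Bounds the perturbations of position and velocity together, per unit of
    \<open>norm w\<close>, at all times in the interval.\<close>
  define \<mu> where "\<mu> = \<bar>\<alpha>\<bar> + \<bar>\<beta>\<bar> * (\<bar>s\<bar> + \<bar>t\<bar>) + \<bar>\<beta>\<bar> + 1"
  have "\<mu> > 0" by (simp add: \<mu>_def add_nonneg_pos)
  have lam: "\<bar>\<alpha> + \<beta> * u\<bar> + \<bar>\<beta>\<bar> \<le> \<mu>" if "u \<in> {s..t}" for u
  proof -
    have "\<bar>\<alpha> + \<beta> * u\<bar> \<le> \<bar>\<alpha>\<bar> + \<bar>\<beta>\<bar> * \<bar>u\<bar>" by (metis abs_mult abs_triangle_ineq)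
    also have "\<bar>\<beta>\<bar> * \<bar>u\<bar> \<le> \<bar>\<beta>\<bar> * (\<bar>s\<bar> + \<bar>t\<bar>)" using that by (intro mult_left_mono) auto
    finally show ?thesis by (simp add: \<mu>_def)
  qed
  \<comment> \<open>Chosen so that the Taylor error \<open>e' * \<mu> * norm w\<close>, integrated
    over the interval, stays below \<open>e * norm w\<close>; the added 1 covers
    \<open>s = t\<close>.\<close>
  define e' where "e' = e / (\<mu> * (t - s + 1))"
  have "e' > 0" using \<open>e > 0\<close> \<open>\<mu> > 0\<close> \<open>s \<le> t\<close> by (simp add: e'_def)
  have "compact (\<gamma> ` {s..t} \<times> cball (0::real^'n) V)"
    using abs_cont_on_continuous[OF ac] by (intro compact_Times compact_continuous_image) auto
  then obtain \<delta> where \<delta>: "\<delta> > 0" "\<And>z w. z \<in> \<gamma> ` {s..t} \<times> cball 0 V \<Longrightarrow> norm w < \<delta> \<Longrightarrow>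
      \<bar>ell (fst (z + w)) (snd (z + w)) - ell (fst z) (snd z) - ell_grad z \<bullet> w\<bar> \<le> e' * norm w"
    using C1_uniform_expansion[OF ell_has_derivative_joint continuous_on_ell_grad _ \<open>e' > 0\<close>] by (metis (no_types, lifting))
  show ?thesis
  proof (intro exI[of _ "\<delta> / \<mu>"] conjI allI impI)
    show "\<delta> / \<mu> > 0" using \<delta>(1) \<open>\<mu> > 0\<close> by simp
    fix w :: "real^'n" assume w: "norm w < \<delta> / \<mu>"
    define \<eta> where "\<eta> u = \<gamma> u + (\<alpha> + \<beta> * u) *\<^sub>R w" for u
    have ac\<eta>: "abs_cont_on s t \<eta>"
    proof (rule abs_cont_on_dominated[OF ac, of _ 1 "\<bar>\<beta>\<bar> * norm w"])
      fix p q :: real assume "p \<le> q"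
      have "\<eta> q - \<eta> p = (\<gamma> q - \<gamma> p) + (\<beta> * (q - p)) *\<^sub>R w" by (simp add: \<eta>_def algebra_simps)
      then have "norm (\<eta> q - \<eta> p) \<le> norm (\<gamma> q - \<gamma> p) + norm ((\<beta> * (q - p)) *\<^sub>R w)" by (metis norm_triangle_ineq)
      then show "norm (\<eta> q - \<eta> p) \<le> 1 * norm (\<gamma> q - \<gamma> p) + \<bar>\<beta>\<bar> * norm w * (q - p)"
        using \<open>p \<le> q\<close> by (simp add: abs_mult ac_simps)
    qed auto
    have d\<eta>: "vector_derivative \<eta> (at u) = ?d u + \<beta> *\<^sub>R w" if "u \<in> {s..t} - N" for u
      unfolding \<eta>_def by (rule vector_derivative_at) (auto intro!: derivative_eq_intros N(2)[OF that])
    have intL: "(\<lambda>u. Lag H (\<eta> u) (?d u + \<beta> *\<^sub>R w)) integrable_on {s..t}"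
      proof -
        have "continuous_on UNIV (\<lambda>z. Lag H (fst (snd z) + (\<alpha> + \<beta> * fst z) *\<^sub>R w) (snd (snd z) + \<beta> *\<^sub>R w))" by (intro continuous_intros)
        from int[OF _ this] show ?thesis by (simp add: \<eta>_def)
      qed
    then have "(\<lambda>u. Lag H (\<eta> u) (vector_derivative \<eta> (at u))) integrable_on {s..t}"
      by (rule integrable_spike[OF _ N(1)]) (use d\<eta> in auto)
    from domination[OF ac\<eta> \<open>s \<le> t\<close> this]
    have dom: "v (\<eta> t) - v (\<eta> s) \<le> integral {s..t} (\<lambda>u. ell (\<eta> u) (vector_derivative \<eta> (at u)))" .
    have "integral {s..t} (\<lambda>u. ell (\<eta> u) (vector_derivative \<eta> (at u))) = integral {s..t} (\<lambda>u. ell (\<eta> u) (?d u + \<beta> *\<^sub>R w))"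
      by (rule integral_spike[OF N(1)]) (use d\<eta> in auto)
    also have "\<dots> \<le> integral {s..t} (\<lambda>u. ell (\<gamma> u) (?d u) + (\<beta> *\<^sub>R (Pm (\<gamma> u) (?d u) - c)
      - (\<alpha> + \<beta> * u) *\<^sub>R Hx (\<gamma> u) (Pm (\<gamma> u) (?d u))) \<bullet> w + e' * \<mu> * norm w)"
    proof (rule has_integral_le_ae[OF integrable_integral integrable_integral N(1)])
      show "(\<lambda>u. ell (\<eta> u) (?d u + \<beta> *\<^sub>R w)) integrable_on {s..t}"
        proof -
        have "continuous_on UNIV (\<lambda>z. ell (fst (snd z) + (\<alpha> + \<beta> * fst z) *\<^sub>R w) (snd (snd z) + \<beta> *\<^sub>R w))" by (intro continuous_intros)
        from int[OF _ this] show ?thesis by (simp add: \<eta>_def)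
      qed
      show "(\<lambda>u. ell (\<gamma> u) (?d u) + (\<beta> *\<^sub>R (Pm (\<gamma> u) (?d u) - c)
        - (\<alpha> + \<beta> * u) *\<^sub>R Hx (\<gamma> u) (Pm (\<gamma> u) (?d u))) \<bullet> w + e' * \<mu> * norm w) integrable_on {s..t}"
        proof -
        have "continuous_on UNIV (\<lambda>z. ell (fst (snd z)) (snd (snd z)) + (\<beta> *\<^sub>R (Pm (fst (snd z)) (snd (snd z)) - c)
        - (\<alpha> + \<beta> * fst z) *\<^sub>R Hx (fst (snd z)) (Pm (fst (snd z)) (snd (snd z)))) \<bullet> w + e' * \<mu> * norm w)" by (intro continuous_intros)
        from int[OF _ this] show ?thesis by simp
      qed
      fix u assume u: "u \<in> {s..t} - N"
      define y where "y = ((\<alpha> + \<beta> * u) *\<^sub>R w, \<beta> *\<^sub>R w)"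
      have "norm y \<le> (\<bar>\<alpha> + \<beta> * u\<bar> + \<bar>\<beta>\<bar>) * norm w"
        using norm_Pair_le[of "(\<alpha> + \<beta> * u) *\<^sub>R w" "\<beta> *\<^sub>R w"] by (simp add: y_def distrib_right)
      also have "\<dots> \<le> \<mu> * norm w" using lam u by (intro mult_right_mono) auto
      finally have ny: "norm y \<le> \<mu> * norm w" .
      also have "\<dots> < \<delta>" using w \<open>\<mu> > 0\<close> by (simp add: field_simps)
      finally have "\<bar>ell (fst ((\<gamma> u, ?d u) + y)) (snd ((\<gamma> u, ?d u) + y)) - ell (\<gamma> u) (?d u) - ell_grad (\<gamma> u, ?d u) \<bullet> y\<bar> \<le> e' * norm y"
        using \<delta>(2)[of "(\<gamma> u, ?d u)" y] u N(3)[OF u] by auto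
      moreover have "e' * norm y \<le> e' * \<mu> * norm w" using ny \<open>e' > 0\<close> by (simp add: mult.assoc)
      moreover have "ell_grad (\<gamma> u, ?d u) \<bullet> y = (\<beta> *\<^sub>R (Pm (\<gamma> u) (?d u) - c) - (\<alpha> + \<beta> * u) *\<^sub>R Hx (\<gamma> u) (Pm (\<gamma> u) (?d u))) \<bullet> w"
        by (simp add: ell_grad_def y_def inner_prod_def inner_diff_left inner_minus_left)
      ultimately show "ell (\<eta> u) (?d u + \<beta> *\<^sub>R w) \<le> ell (\<gamma> u) (?d u) + (\<beta> *\<^sub>R (Pm (\<gamma> u) (?d u) - c)
        - (\<alpha> + \<beta> * u) *\<^sub>R Hx (\<gamma> u) (Pm (\<gamma> u) (?d u))) \<bullet> w + e' * \<mu> * norm w"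
        by (simp add: y_def \<eta>_def abs_le_iff)
    qed
    also have "\<dots> = integral {s..t} (\<lambda>u. ell (\<gamma> u) (?d u)) + G \<bullet> w + e' * \<mu> * norm w * (t - s)"
    proof -
      let ?g = "\<lambda>u. \<beta> *\<^sub>R (Pm (\<gamma> u) (?d u) - c) - (\<alpha> + \<beta> * u) *\<^sub>R Hx (\<gamma> u) (Pm (\<gamma> u) (?d u))"
      have ig: "?g integrable_on {s..t}"
        proof -
        have "continuous_on UNIV (\<lambda>z. \<beta> *\<^sub>R (Pm (fst (snd z)) (snd (snd z)) - c)
          - (\<alpha> + \<beta> * fst z) *\<^sub>R Hx (fst (snd z)) (Pm (fst (snd z)) (snd (snd z))))" by (intro continuous_intros)
        from int[OF _ this] show ?thesis by simp
      qed
      have il: "(\<lambda>u. ell (\<gamma> u) (?d u)) integrable_on {s..t}"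
        proof -
        have "continuous_on UNIV (\<lambda>z. ell (fst (snd z)) (snd (snd z)))" by (intro continuous_intros)
        from int[OF _ this] show ?thesis by simp
      qed
      have "((\<lambda>u. ?g u \<bullet> w) has_integral (G \<bullet> w)) {s..t}"
        using has_integral_linear[OF integrable_integral[OF ig] bounded_linear_inner_left[of w]] by (simp add: o_def G_def)
      from has_integral_add[OF has_integral_add[OF integrable_integral[OF il] this] has_integral_const_real[of "e' * \<mu> * norm w" s t]]
      show ?thesis using \<open>s \<le> t\<close> by (simp add: integral_unique ac_simps)
    qed
    also have "integral {s..t} (\<lambda>u. ell (\<gamma> u) (?d u)) = v (\<gamma> t) - v (\<gamma> s)" using cal by (simp add: calibrated_def)
    also have "e' * \<mu> * norm w * (t - s) \<le> e * norm w"
    proof -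
      have "e' * \<mu> * (t - s) \<le> e' * \<mu> * (t - s + 1)" using \<open>e' > 0\<close> \<open>\<mu> > 0\<close> by simp
      also have "\<dots> = e" using \<open>\<mu> > 0\<close> \<open>s \<le> t\<close> by (simp add: e'_def)
      finally show ?thesis using mult_right_mono[of "e' * \<mu> * (t - s)" e "norm w"] by (simp add: ac_simps)
    qed
    finally have "v (\<eta> t) - v (\<eta> s) \<le> v (\<gamma> t) - v (\<gamma> s) + G \<bullet> w + e * norm w" using dom by linarith
    then show "v (\<gamma> t + (\<alpha> + \<beta> * t) *\<^sub>R w) - v (\<gamma> s + (\<alpha> + \<beta> * s) *\<^sub>R w)
     \<le> v (\<gamma> t) - v (\<gamma> s) + G \<bullet> w + e * norm w" by (simp only: \<eta>_def)
  qed
qed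

text \<open>Test along the straight line with velocity \<open>Hp y (c + g)\<close>: the growth bound
  there, combined with Fenchel equality for this velocity, is the claim.\<close>

lemma H_le_at_differentiable:
  assumes "(v has_derivative (\<lambda>w. g \<bullet> w)) (at y)"
  shows "H y (c + g) \<le> a"
proof -
  define \<xi> where "\<xi> = Hp y (c + g)"
  have \<eta>: "((\<lambda>u. y + u *\<^sub>R \<xi>) has_vector_derivative \<xi>) (at 0)" by (auto intro!: derivative_eq_intros)
  have "((\<lambda>u. v (y + u *\<^sub>R \<xi>)) has_derivative (\<lambda>h. g \<bullet> (h *\<^sub>R \<xi>))) (at 0)"
    by (rule has_derivative_compose[where g = v]) (use assms \<eta> in \<open>auto simp: has_vector_derivative_def\<close>)
  then have "((\<lambda>u. v (y + u *\<^sub>R \<xi>)) has_real_derivative (g \<bullet> \<xi>)) (at 0)"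
    unfolding has_field_derivative_def by (rule has_derivative_eq_rhs) auto
  from derivative_along_le_ell[OF \<eta> this] have "g \<bullet> \<xi> \<le> ell y \<xi>" by simp
  then show ?thesis by (simp add: ell_def \<xi>_def Lag_Hp inner_add_left inner_add_right inner_commute)
qed

end

text \<open>The upgrade from almost everywhere to everywhere: the integrand may be changed on a null
  set into a continuous one before this is applied.\<close>

lemma indefinite_integral_derivative_at:
  fixes F k :: "real \<Rightarrow> 'a::euclidean_space"
  assumes int: "\<And>x. x \<in> {p..q} \<Longrightarrow> (k has_integral (F x - F p)) {p..x}"
    and k: "continuous_on {p..q} k" and r: "r \<in> {p<..<q}"
  shows "(F has_vector_derivative k r) (at r)"
proof -
  have "((\<lambda>u. integral {p..u} k) has_vector_derivative k r) (at r within {p..q})"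
    by (rule integral_has_vector_derivative[OF k]) (use r in auto)
  then have "((\<lambda>u. integral {p..u} k) has_vector_derivative k r) (at r)"
    using r at_within_Icc_at[of p r q] by simp
  then have "((\<lambda>u. F p + integral {p..u} k) has_vector_derivative k r) (at r)"
    by (auto intro!: derivative_eq_intros)
  then show ?thesis
    by (rule has_vector_derivative_transform_within_open[of _ _ _ "{p<..<q}"])
       (use r integral_unique[OF int] in auto)
qed

section \<open>Regularity of calibrated curves\<close>

context weak_kam
begin

text \<open>The upper support at \<open>r\<close> has slope \<open>g r\<close>, an average of the
  first variation over \<open>{s..r}\<close> and therefore continuous in \<open>r\<close>. A lower
  support exists as well, so \<open>g r\<close> is the gradient of \<open>v\<close>. Fenchel
  equality then identifies the momentum with \<open>c + g\<close> almost everywhere; substituted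
  into the integrals for \<open>\<gamma>\<close> and \<open>g\<close>, it makes the integrands
  continuous and gives the Hamiltonian equations. At \<open>t\<close> itself only the upper support
  survives.\<close>

theorem calibrated_regularity:
  assumes cal: "calibrated s t \<gamma>" and "s < t"
  shows "\<exists>p. (\<forall>r\<in>{s..t}. \<gamma> r = fst (phiH H (r - t) (\<gamma> t, p))) \<and>
    (\<forall>r\<in>{s<..<t}. (v has_derivative (\<lambda>w. (snd (phiH H (r - t) (\<gamma> t, p)) - c) \<bullet> w)) (at (\<gamma> r))) \<and>
    (\<forall>e>0. \<exists>d>0. \<forall>w. norm w < d \<longrightarrow> v (\<gamma> t + w) \<le> v (\<gamma> t) + (p - c) \<bullet> w + e * norm w)"
proof -
  have ac: "abs_cont_on s t \<gamma>" using cal by (simp add: calibrated_def)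
  have \<gamma>c: "continuous_on {s..t} \<gamma>" by (rule abs_cont_on_continuous[OF ac])
  obtain V N where V: "V > 0" and N: "negligible N"
    "\<And>u. u \<in> {s..t} - N \<Longrightarrow> (\<gamma> has_vector_derivative vector_derivative \<gamma> (at u)) (at u)"
    "\<And>u. u \<in> {s..t} - N \<Longrightarrow> ((\<lambda>u. v (\<gamma> u)) has_real_derivative ell (\<gamma> u) (vector_derivative \<gamma> (at u))) (at u)"
    "\<And>u. u \<in> {s..t} - N \<Longrightarrow> norm (vector_derivative \<gamma> (at u)) \<le> V"
    using calibrated_derivative_ae cal \<open>s < t\<close> by (metis (no_types, lifting) less_imp_le)
  define D where "D u = vector_derivative \<gamma> (at u)" for u
  define Q where "Q u = Pm (\<gamma> u) (D u)" for u
  \<comment> \<open>The integrand of the first variation for the weight \<open>u - s\<close>: the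
    velocity gradient of \<open>ell\<close> carries the derivative 1 of the weight, the position
    gradient \<open>- Hx\<close> carries the weight.\<close>
  define J where "J u = (Q u - c) - (u - s) *\<^sub>R Hx (\<gamma> u) (Q u)" for u
  define I where "I r = integral {s..r} J" for r
  have Jint: "J integrable_on {s..t}"
  proof -
    have "continuous_on UNIV (\<lambda>z. Pm (fst (snd z)) (snd (snd z)) - c - (fst z - s) *\<^sub>R Hx (fst (snd z)) (Pm (fst (snd z)) (snd (snd z))))"
      by (intro continuous_intros)
    from continuous_along_integrable[OF ac less_imp_le[OF \<open>s < t\<close>] N(1) N(4) this]
    show ?thesis unfolding J_def Q_def D_def by simp
  qed
  have Jsub: "J integrable_on {p..q}" if "s \<le> p" "q \<le> t" for p q
    using Jint that by (auto intro: integrable_on_subinterval)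
  have Ic: "continuous_on {s..t} I" unfolding I_def by (rule indefinite_integral_continuous_1[OF Jint])
  define g where "g r = I r /\<^sub>R (r - s)" for r
  have up: "\<exists>d>0. \<forall>w. norm w < d \<longrightarrow> v (\<gamma> r + w) \<le> v (\<gamma> r) + g r \<bullet> w + e * norm w" if "r \<in> {s<..t}" "e > 0" for r e
  proof -
    \<comment> \<open>The weight is \<open>(u - s) / (r - s)\<close>: the start is held fixed and
      the end at \<open>r\<close> moves by \<open>w\<close>.\<close>
    define \<beta> where "\<beta> = 1 / (r - s)"
    define \<alpha> where "\<alpha> = - \<beta> * s"
    have rs: "r - s > 0" using that by auto
    have lam: "\<alpha> + \<beta> * u = \<beta> * (u - s)" for u by (simp add: \<alpha>_def algebra_simps)
    have G: "integral {s..r} (\<lambda>u. \<beta> *\<^sub>R (Pm (\<gamma> u) (vector_derivative \<gamma> (at u)) - c)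
      - (\<alpha> + \<beta> * u) *\<^sub>R Hx (\<gamma> u) (Pm (\<gamma> u) (vector_derivative \<gamma> (at u)))) = g r"
    proof -
      have "(\<lambda>u. \<beta> *\<^sub>R (Pm (\<gamma> u) (vector_derivative \<gamma> (at u)) - c)
        - (\<alpha> + \<beta> * u) *\<^sub>R Hx (\<gamma> u) (Pm (\<gamma> u) (vector_derivative \<gamma> (at u)))) = (\<lambda>u. \<beta> *\<^sub>R J u)"
        unfolding lam by (simp add: J_def Q_def D_def scaleR_diff_right)
      then show ?thesis by (simp add: g_def I_def \<beta>_def inverse_eq_divide)
    qed
    have "calibrated s r \<gamma>" by (rule calibrated_subinterval[OF cal]) (use that in auto)
    from calibrated_variation[OF this _ that(2), where \<alpha> = \<alpha> and \<beta> = \<beta>] that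
    have "\<exists>d>0. \<forall>w. norm w < d \<longrightarrow> v (\<gamma> r + (\<alpha> + \<beta> * r) *\<^sub>R w) - v (\<gamma> s + (\<alpha> + \<beta> * s) *\<^sub>R w)
       \<le> v (\<gamma> r) - v (\<gamma> s) + g r \<bullet> w + e * norm w" unfolding G by simp
    moreover have "\<alpha> + \<beta> * r = 1" "\<alpha> + \<beta> * s = 0" unfolding lam using rs by (auto simp: \<beta>_def)
    ultimately have "\<exists>d>0. \<forall>w. norm w < d \<longrightarrow> v (\<gamma> r + w) - v (\<gamma> s) \<le> v (\<gamma> r) - v (\<gamma> s) + g r \<bullet> w + e * norm w" by simp
    then show ?thesis by (simp add: algebra_simps)
  qed
  have lo: "\<exists>h. \<forall>e>0. \<exists>d>0. \<forall>w. norm w < d \<longrightarrow> v (\<gamma> r) + h \<bullet> w - e * norm w \<le> v (\<gamma> r + w)" if "r \<in> {s..<t}" for r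
  proof -
    \<comment> \<open>The weight is \<open>(u - t) / (r - t)\<close>: now the end is fixed and the
      start at \<open>r\<close> moves. As \<open>v\<close> at the start enters negatively, this is a
      lower support with slope \<open>- G\<close>.\<close>
    define \<beta> where "\<beta> = 1 / (r - t)"
    define \<alpha> where "\<alpha> = - \<beta> * t"
    have "t - r > 0" using that by auto
    then have "\<beta> * (r - t) = 1" by (simp add: \<beta>_def)
    then have ab: "\<alpha> + \<beta> * t = 0" "\<alpha> + \<beta> * r = 1" by (auto simp: \<alpha>_def algebra_simps)
    define G where "G = integral {r..t} (\<lambda>u. \<beta> *\<^sub>R (Pm (\<gamma> u) (vector_derivative \<gamma> (at u)) - c)
      - (\<alpha> + \<beta> * u) *\<^sub>R Hx (\<gamma> u) (Pm (\<gamma> u) (vector_derivative \<gamma> (at u))))"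
    have cr: "calibrated r t \<gamma>" by (rule calibrated_subinterval[OF cal]) (use that in auto)
    have "\<exists>d>0. \<forall>w. norm w < d \<longrightarrow> v (\<gamma> r) + (- G) \<bullet> w - e * norm w \<le> v (\<gamma> r + w)" if "e > 0" for e
    proof -
      obtain d where d: "d > 0" "\<And>w. norm w < d \<Longrightarrow> v (\<gamma> t + (\<alpha> + \<beta> * t) *\<^sub>R w) - v (\<gamma> r + (\<alpha> + \<beta> * r) *\<^sub>R w)
         \<le> v (\<gamma> t) - v (\<gamma> r) + G \<bullet> w + e * norm w"
        using calibrated_variation[OF cr _ \<open>e > 0\<close>, where \<alpha> = \<alpha> and \<beta> = \<beta>] \<open>t - r > 0\<close> unfolding G_def by auto
      show ?thesis
        by (rule exI[of _ d]) (use d ab in \<open>auto simp: inner_minus_left algebra_simps\<close>)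
    qed
    then show ?thesis by blast
  qed
  have deriv: "(v has_derivative (\<lambda>w. g r \<bullet> w)) (at (\<gamma> r))" if r: "r \<in> {s<..<t}" for r
  proof -
    obtain h where h: "\<And>e. e > 0 \<Longrightarrow> \<exists>d>0. \<forall>w. norm w < d \<longrightarrow> v (\<gamma> r) + h \<bullet> w - e * norm w \<le> v (\<gamma> r + w)"
      using lo[of r] r by auto
    show ?thesis by (rule has_derivative_of_two_sided_support(2)[OF up h]) (use r in auto)
  qed
  define P where "P r = c + g r" for r
  have gc: "continuous_on {s<..t} g"
    unfolding g_def by (intro continuous_intros continuous_on_subset[OF Ic]) auto
  then have Pc: "continuous_on {s<..t} P" unfolding P_def by (intro continuous_intros)
  \<comment> \<open>The chain rule gives \<open>g u \<bullet> D u = ell (\<gamma> u) (D u)\<close>.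
    Together with energy at most \<open>a\<close> this is the reverse Fenchel inequality, whose
    equality case determines the momentum.\<close>
  have QP: "Q u = P u" if u: "u \<in> {s<..<t} - N" for u
  proof -
    have u': "u \<in> {s..t} - N" "u \<in> {s<..<t}" using u by auto
    have "((\<lambda>u. v (\<gamma> u)) has_derivative (\<lambda>h. g u \<bullet> (h *\<^sub>R D u))) (at u)"
      by (rule has_derivative_compose[where g = v])
         (use N(2)[OF u'(1)] deriv[OF u'(2)] in \<open>auto simp: has_vector_derivative_def D_def\<close>)
    then have "((\<lambda>u. v (\<gamma> u)) has_real_derivative (g u \<bullet> D u)) (at u)"
      unfolding has_field_derivative_def by (rule has_derivative_eq_rhs) auto
    then have "g u \<bullet> D u = ell (\<gamma> u) (D u)" using N(3)[OF u'(1)] DERIV_unique unfolding D_def by blast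
    moreover have "H (\<gamma> u) (P u) \<le> a" unfolding P_def by (rule H_le_at_differentiable[OF deriv[OF u'(2)]])
    ultimately have "Lag H (\<gamma> u) (D u) + H (\<gamma> u) (P u) \<le> D u \<bullet> P u"
      by (simp add: ell_def P_def inner_add_right inner_commute)
    then show ?thesis using fenchel_eq_imp unfolding Q_def by metis
  qed
  have sub: "{p..q} \<subseteq> {s<..<t}" if "s < p" "q < t" for p q using that by auto
  have d\<gamma>: "(\<gamma> has_vector_derivative Hp (\<gamma> r) (P r)) (at r)" and dI: "(I has_vector_derivative ((P r - c) - (r - s) *\<^sub>R Hx (\<gamma> r) (P r))) (at r)"
    if r: "r \<in> {s<..<t}" for r
  proof -
    define p where "p = (s + r) / 2"
    define q where "q = (r + t) / 2"
    have pq: "s < p" "p < r" "r < q" "q < t" using r by (auto simp: p_def q_def)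
    have cont: "continuous_on {p..q} \<gamma>" "continuous_on {p..q} P"
      using pq by (auto intro: continuous_on_subset[OF \<gamma>c] continuous_on_subset[OF Pc])
    show "(\<gamma> has_vector_derivative Hp (\<gamma> r) (P r)) (at r)"
    proof (rule indefinite_integral_derivative_at[where F = \<gamma> and k = "\<lambda>u. Hp (\<gamma> u) (P u)"])
      fix x assume x: "x \<in> {p..q}"
      have "(D has_integral (\<gamma> x - \<gamma> p)) {p..x}" unfolding D_def
        by (rule abs_cont_fundamental_theorem[OF abs_cont_on_subinterval[OF ac]]) (use x pq in auto)
      then show "((\<lambda>u. Hp (\<gamma> u) (P u)) has_integral (\<gamma> x - \<gamma> p)) {p..x}"
      proof (rule has_integral_spike[OF N(1), rotated])
        fix u assume "u \<in> {p..x} - N"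
        then have "Q u = P u" using QP[of u] x pq by auto
        then show "Hp (\<gamma> u) (P u) = D u" unfolding Q_def using Hp_Pm by metis
      qed
    qed (use pq in \<open>auto intro!: continuous_intros cont\<close>)
    show "(I has_vector_derivative ((P r - c) - (r - s) *\<^sub>R Hx (\<gamma> r) (P r))) (at r)"
    proof (rule indefinite_integral_derivative_at[where F = I and k = "\<lambda>u. (P u - c) - (u - s) *\<^sub>R Hx (\<gamma> u) (P u)"])
      fix x assume x: "x \<in> {p..q}"
      have "I p + integral {p..x} J = I x" unfolding I_def
        by (rule Henstock_Kurzweil_Integration.integral_combine) (use x pq Jsub in auto)
      then have "integral {p..x} J = I x - I p" by (simp add: eq_diff_eq add.commute)
      then have "(J has_integral (I x - I p)) {p..x}"
        using integrable_integral[OF Jsub[of p x]] x pq by simp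
      then show "((\<lambda>u. (P u - c) - (u - s) *\<^sub>R Hx (\<gamma> u) (P u)) has_integral (I x - I p)) {p..x}"
      proof (rule has_integral_spike[OF N(1), rotated])
        fix u assume "u \<in> {p..x} - N"
        then show "(P u - c) - (u - s) *\<^sub>R Hx (\<gamma> u) (P u) = J u" using QP[of u] x pq by (simp add: J_def)
      qed
    qed (use pq in \<open>auto intro!: continuous_intros cont\<close>)
  qed
  \<comment> \<open>In the quotient rule the terms with \<open>P r - c\<close> cancel, because
    \<open>I r\<close> equals \<open>r - s\<close> times \<open>P r - c\<close>; only
    \<open>- Hx\<close> is left.\<close>
  have dP: "(P has_vector_derivative - Hx (\<gamma> r) (P r)) (at r)" if r: "r \<in> {s<..<t}" for r
  proof -
    have rs: "r - s \<noteq> 0" using r by auto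
    have "((\<lambda>x. inverse (x - s)) has_real_derivative - (1 / (r - s)\<^sup>2)) (at r)"
      using rs by (auto intro!: derivative_eq_intros simp: power2_eq_square inverse_eq_divide)
    from has_vector_derivative_scaleR[OF this dI[OF r]]
    have "((\<lambda>x. I x /\<^sub>R (x - s)) has_vector_derivative
       (inverse (r - s) *\<^sub>R ((P r - c) - (r - s) *\<^sub>R Hx (\<gamma> r) (P r)) + (- (1 / (r - s)\<^sup>2)) *\<^sub>R I r)) (at r)" .
    moreover have "inverse (r - s) *\<^sub>R ((P r - c) - (r - s) *\<^sub>R Hx (\<gamma> r) (P r)) + (- (1 / (r - s)\<^sup>2)) *\<^sub>R I r = - Hx (\<gamma> r) (P r)"
    proof -
      have "inverse (r - s) *\<^sub>R (P r - c) = (1 / (r - s)\<^sup>2) *\<^sub>R I r"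
        by (simp add: P_def g_def power2_eq_square inverse_eq_divide)
      then show ?thesis using rs by (simp add: scaleR_diff_right)
    qed
    ultimately have "((\<lambda>x. I x /\<^sub>R (x - s)) has_vector_derivative - Hx (\<gamma> r) (P r)) (at r)" by metis
    from has_vector_derivative_add[OF has_vector_derivative_const this]
    have "((\<lambda>x. c + I x /\<^sub>R (x - s)) has_vector_derivative - Hx (\<gamma> r) (P r)) (at r)" by simp
    then show ?thesis by (simp add: P_def[abs_def] g_def)
  qed
  define z where "z r = (\<gamma> r, P r)" for r
  have dz: "(z has_vector_derivative vf (z r)) (at r)" if "r \<in> {s<..<t}" for r
    using d\<gamma>[OF that] dP[OF that] unfolding z_def vf_def by (auto intro!: has_vector_derivative_Pair)
  define r0 where "r0 = (s + t) / 2"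
  have r0: "r0 \<in> {s<..<t}" using \<open>s < t\<close> by (auto simp: r0_def)
  \<comment> \<open>A global orbit through an interior point. Continuity extends its agreement with
    \<open>z\<close> to both ends for positions, but for momenta only to \<open>t\<close>, since
    \<open>g\<close> divides by \<open>r - s\<close>.\<close>
  define W where "W r = phiH H (r - r0) (z r0)" for r
  have zW: "z r = W r" if "r \<in> {s<..<t}" for r
    unfolding W_def by (rule ham_on_interval_phiH[OF dz that r0])
  have Wc: "continuous_on S W" for S unfolding W_def by (intro continuous_intros)
  have \<gamma>W: "\<gamma> r = fst (W r)" if "r \<in> {s..t}" for r
  proof -
    have "\<gamma> r - fst (W r) = 0"
    proof (rule continuous_constant_on_closure[where S = "{s<..<t}"])
      show "continuous_on (closure {s<..<t}) (\<lambda>r. \<gamma> r - fst (W r))"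
        using \<open>s < t\<close> by (auto intro!: continuous_intros \<gamma>c Wc)
      show "\<gamma> r - fst (W r) = 0" if "r \<in> {s<..<t}" for r using zW[OF that] by (simp add: z_def prod_eq_iff)
    qed (use that \<open>s < t\<close> in auto)
    then show ?thesis by simp
  qed
  have PW: "P t = snd (W t)"
  proof -
    have "P t - snd (W t) = 0"
    proof (rule continuous_constant_on_closure[where S = "{r0<..<t}"])
      show "continuous_on (closure {r0<..<t}) (\<lambda>r. P r - snd (W r))"
        using r0 by (auto intro!: continuous_intros continuous_on_subset[OF Pc] Wc)
      show "P r - snd (W r) = 0" if "r \<in> {r0<..<t}" for r using zW[of r] that r0 by (auto simp: z_def prod_eq_iff)
    qed (use r0 in auto)
    then show ?thesis by simp
  qed
  have Wt: "W t = (\<gamma> t, P t)" using \<gamma>W[of t] PW \<open>s < t\<close> by (simp add: prod_eq_iff)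
  have W: "phiH H (r - t) (\<gamma> t, P t) = W r" for r
    unfolding Wt[symmetric] by (simp add: W_def phiH_add)
  show ?thesis
  proof (intro exI[of _ "P t"] conjI ballI allI impI)
    fix r assume r: "r \<in> {s<..<t}"
    have "snd (W r) - c = g r" using zW[OF r] by (simp add: z_def P_def prod_eq_iff[symmetric]) (metis P_def add_diff_cancel_left' snd_conv)
    then show "(v has_derivative (\<lambda>w. (snd (phiH H (r - t) (\<gamma> t, P t)) - c) \<bullet> w)) (at (\<gamma> r))"
      unfolding W using deriv[OF r] by simp
  next
    fix e :: real assume "e > 0"
    then show "\<exists>d>0. \<forall>w. norm w < d \<longrightarrow> v (\<gamma> t + w) \<le> v (\<gamma> t) + (P t - c) \<bullet> w + e * norm w"
      using up[of t e] \<open>s < t\<close> by (simp add: P_def)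
  qed (use W \<gamma>W in simp)
qed

section \<open>Calibrated Hamiltonian orbits\<close>

definition flow_ell :: "(real^'n) \<times> (real^'n) \<Rightarrow> real \<Rightarrow> real" where
  "flow_ell z u = ell (fst (phiH H u z)) (Hp (fst (phiH H u z)) (snd (phiH H u z)))"

text \<open>Along an orbit, absolute continuity and integrability are automatic, so the equation
  alone expresses calibration. Both sides are continuous in \<open>z\<close>, which makes the
  condition closed.\<close>

definition flow_calibrated :: "(real^'n) \<times> (real^'n) \<Rightarrow> real \<Rightarrow> real \<Rightarrow> bool" where
  "flow_calibrated z s t \<longleftrightarrow> integral {s..t} (flow_ell z) = v (fst (phiH H t z)) - v (fst (phiH H s z))"

lemma flow_vector_derivative: "vector_derivative (\<lambda>u. fst (phiH H u z)) (at u) = Hp (fst (phiH H u z)) (snd (phiH H u z))"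
  by (rule vector_derivative_at[OF ham_fst[OF ham_phiH]])

lemma flow_abs_cont: "abs_cont_on s t (\<lambda>u. fst (phiH H u z))"
proof -
  obtain R where R: "R > 0" "\<And>x p. H x p \<le> H (fst z) (snd z) \<Longrightarrow> norm p < R" using sublevel_bounded[where E = "H (fst z) (snd z)"] by blast
  obtain B where B: "B > 0" "\<And>x p. norm p \<le> R \<Longrightarrow> norm (Hp x p) \<le> B" using Hp_bounded[where R = R] by blast
  have bd: "norm (Hp (fst (phiH H u z)) (snd (phiH H u z))) \<le> B" for u
  proof (rule B(2), rule less_imp_le, rule R(2))
    show "H (fst (phiH H u z)) (snd (phiH H u z)) \<le> H (fst z) (snd z)"
      using energy_conserved[OF ham_phiH[of z], of u] by simp
  qed
  have lip: "norm (fst (phiH H q z) - fst (phiH H p z)) \<le> B * norm (q - p)" for p q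
  proof (rule differentiable_bound[of UNIV "\<lambda>u. fst (phiH H u z)" "\<lambda>u h. h *\<^sub>R Hp (fst (phiH H u z)) (snd (phiH H u z))"])
    show "onorm (\<lambda>h. h *\<^sub>R Hp (fst (phiH H u z)) (snd (phiH H u z))) \<le> B" for u
      by (rule onorm_bound) (use B(1) mult_right_mono[OF bd[of u] abs_ge_zero] in \<open>auto simp: mult.commute\<close>)
  qed (use ham_fst[OF ham_phiH[of z]] in \<open>auto simp: has_vector_derivative_def\<close>)
  show ?thesis
  proof (rule abs_cont_on_lipschitz[where M = B])
    show "norm (fst (phiH H q z) - fst (phiH H p z)) \<le> B * (q - p)" if "p \<le> q" for p q
      using lip[of q p] that by simp
  qed (use B(1) in simp)
qed

lemma continuous_on_flow_ell: "continuous_on UNIV (\<lambda>(z,u). flow_ell z u)"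
  unfolding flow_ell_def case_prod_beta by (intro continuous_intros)

lemma flow_calibrated_iff: "flow_calibrated z s t \<longleftrightarrow> calibrated s t (\<lambda>u. fst (phiH H u z))"
proof -
  have "(\<lambda>u. Lag H (fst (phiH H u z)) (Hp (fst (phiH H u z)) (snd (phiH H u z)))) integrable_on {s..t}"
    by (intro integrable_continuous_real continuous_intros)
  then show ?thesis
    unfolding calibrated_def flow_vector_derivative flow_calibrated_def flow_ell_def[abs_def]
    by (simp add: flow_abs_cont)
qed

lemma flow_calibrated_subinterval:
  "flow_calibrated z s t \<Longrightarrow> s \<le> s' \<Longrightarrow> s' \<le> t' \<Longrightarrow> t' \<le> t \<Longrightarrow> flow_calibrated z s' t'"
  unfolding flow_calibrated_iff by (rule calibrated_subinterval)

lemma flow_calibrated_shift: "flow_calibrated (phiH H \<tau> z) s t \<longleftrightarrow> flow_calibrated z (s + \<tau>) (t + \<tau>)"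
proof -
  have "flow_ell (phiH H \<tau> z) = flow_ell z \<circ> ((+) \<tau>)"
    by (auto simp: flow_ell_def phiH_add add.commute)
  then show ?thesis
    unfolding flow_calibrated_def by (simp add: integral_shift_Icc_real phiH_add)
qed

lemma flow_calibrated_lattice:
  assumes "k \<in> lattice"
  shows "flow_calibrated (x + k, p) s t \<longleftrightarrow> flow_calibrated (x, p) s t"
proof -
  have "flow_ell (x + k, p) = flow_ell (x, p)"
    by (auto simp: flow_ell_def phiH_lattice[OF assms] Hp_periodic[OF assms] ell_def Lag_periodic[OF assms])
  then show ?thesis
    unfolding flow_calibrated_def by (simp add: phiH_lattice[OF assms] v_periodic[OF assms])
qed

lemma flow_calibrated_limit:
  assumes "Z \<longlonglongrightarrow> z" "\<forall>\<^sub>F j in sequentially. flow_calibrated (Z j) s t"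
  shows "flow_calibrated z s t"
proof -
  define D where "D z = integral (cbox s t) (flow_ell z) - (v (fst (phiH H t z)) - v (fst (phiH H s z)))" for z
  have "continuous_on UNIV (\<lambda>z. integral (cbox s t) (flow_ell z))"
    by (rule integral_continuous_on_param) (rule continuous_on_subset[OF continuous_on_flow_ell], simp)
  then have "continuous_on UNIV D"
    unfolding D_def by (intro continuous_intros continuous_on_compose2[OF v_continuous]) auto
  then have "(\<lambda>j. D (Z j)) \<longlonglongrightarrow> D z"
    by (rule continuous_on_tendsto_compose[OF _ assms(1)]) auto
  moreover have "(\<lambda>j. D (Z j)) \<longlonglongrightarrow> 0"
  proof (rule tendsto_eventually)
    show "\<forall>\<^sub>F j in sequentially. D (Z j) = 0"
      using assms(2) by eventually_elim (simp add: D_def flow_calibrated_def)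
  qed
  ultimately have "D z = 0" by (rule LIMSEQ_unique)
  then show ?thesis by (simp add: D_def flow_calibrated_def)
qed

text \<open>Equal positions on an open interval have equal velocities, and a velocity determines its
  momentum because \<open>Hp x\<close> is injective. The shifts accommodate orbits parametrised from
  their end time.\<close>

lemma flow_fst_eq_imp_snd_eq:
  assumes eq: "\<And>r. r \<in> {s<..<t} \<Longrightarrow> fst (phiH H (r - \<sigma>) z) = fst (phiH H (r - \<tau>) w)" and r: "r \<in> {s<..<t}"
  shows "phiH H (r - \<sigma>) z = phiH H (r - \<tau>) w"
proof -
  have dz: "((\<lambda>r. fst (phiH H (r - \<sigma>) z)) has_vector_derivative Hp (fst (phiH H (r - \<sigma>) z)) (snd (phiH H (r - \<sigma>) z))) (at r)"
    for \<sigma> z using ham_fst[OF ham_shift[OF ham_phiH[of z], of "- \<sigma>"], of r] by simp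
  have "((\<lambda>r. fst (phiH H (r - \<tau>) w)) has_vector_derivative Hp (fst (phiH H (r - \<sigma>) z)) (snd (phiH H (r - \<sigma>) z))) (at r)"
    by (rule has_vector_derivative_transform_within_open[OF dz[of \<sigma> z], of "{s<..<t}"]) (use r eq in auto)
  from vector_derivative_unique_at[OF this dz[of \<tau> w]]
  have "Hp (fst (phiH H (r - \<sigma>) z)) (snd (phiH H (r - \<sigma>) z)) = Hp (fst (phiH H (r - \<sigma>) z)) (snd (phiH H (r - \<tau>) w))"
    using eq[OF r] by simp
  then have "snd (phiH H (r - \<sigma>) z) = snd (phiH H (r - \<tau>) w)" by (rule Hp_inj)
  then show ?thesis using eq[OF r] by (simp add: prod_eq_iff)
qed

text \<open>The regularity theorem yields some momentum at the end time; comparing positions shows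
  that it belongs to the given orbit.\<close>

lemma flow_calibrated_derivative:
  assumes cal: "flow_calibrated z s t" and r: "r \<in> {s<..<t}"
  shows "(v has_derivative (\<lambda>w. (snd (phiH H r z) - c) \<bullet> w)) (at (fst (phiH H r z)))"
proof -
  let ?\<gamma> = "\<lambda>u. fst (phiH H u z)"
  have "s < t" using r by simp
  obtain p where p: "\<forall>r\<in>{s..t}. ?\<gamma> r = fst (phiH H (r - t) (?\<gamma> t, p))"
    "\<forall>r\<in>{s<..<t}. (v has_derivative (\<lambda>w. (snd (phiH H (r - t) (?\<gamma> t, p)) - c) \<bullet> w)) (at (?\<gamma> r))"
    using calibrated_regularity[OF cal[unfolded flow_calibrated_iff] \<open>s < t\<close>] by blast
  have "fst (phiH H (u - 0) z) = fst (phiH H (u - t) (?\<gamma> t, p))" if "u \<in> {s<..<t}" for u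
  proof -
    have "u \<in> {s..t}" using that by auto
    from bspec[OF p(1) this] show ?thesis by (simp only: diff_zero)
  qed
  from flow_fst_eq_imp_snd_eq[OF this r] have "snd (phiH H r z) = snd (phiH H (r - t) (?\<gamma> t, p))"
    by (simp only: diff_zero)
  then show ?thesis using bspec[OF p(2) r] by (simp only:)
qed

lemma flow_calibrated_energy:
  assumes "flow_calibrated z s t" "s < t"
  shows "H (fst z) (snd z) \<le> a"
proof -
  define r where "r = (s + t) / 2"
  have "r \<in> {s<..<t}" using assms by (auto simp: r_def)
  from H_le_at_differentiable[OF flow_calibrated_derivative[OF assms(1) this]]
  have "H (fst (phiH H r z)) (snd (phiH H r z)) \<le> a" by simp
  then show ?thesis using energy_conserved[OF ham_phiH[of z], of r] by simp
qed

section \<open>Existence of calibrated curves\<close>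

text \<open>A discrete Jensen inequality: replacing \<open>ell y\<close> by its supporting affine
  function at \<open>\<xi>\<close> makes the cost linear in the velocity, so displacements telescope
  and only the two end vertices remain. \<open>E\<close> pays for freezing the base point at
  \<open>y\<close>, and \<open>C * h\<close> per unit time for the step errors.\<close>

lemma discrete_chain_bound:
  fixes \<xi> y :: "real^'n" and X :: "nat \<Rightarrow> real^'n"
  assumes "h > 0" "CL \<ge> 0"
    and vel: "\<And>i. norm (X i - X (Suc i)) \<le> V * h"
    and step: "\<And>i. v (X (Suc i)) + h * ell (X i) ((X i - X (Suc i)) /\<^sub>R h) \<le> v (X i) + C * h\<^sup>2"
    and CL: "\<And>x y \<xi>. norm \<xi> \<le> V \<Longrightarrow> \<bar>Lag H x \<xi> - Lag H y \<xi>\<bar> \<le> CL * norm (x - y)"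
    and near: "\<And>k. k < m \<Longrightarrow> norm (X (i + k) - y) \<le> E"
  defines "q \<equiv> Pm y \<xi> - c"
  shows "v (X (i + m)) - v (X i) \<le> - (h * real m) * ell y \<xi> - q \<bullet> (X i - X (i + m))
     + (h * real m) * (q \<bullet> \<xi>) + (h * real m) * (CL * E) + C * h * (h * real m)"
  using near
proof (induction m)
  case (Suc m)
  let ?\<xi> = "(X (i + m) - X (i + Suc m)) /\<^sub>R h"
  have IH: "v (X (i + m)) - v (X i) \<le> - (h * real m) * ell y \<xi> - q \<bullet> (X i - X (i + m))
     + (h * real m) * (q \<bullet> \<xi>) + (h * real m) * (CL * E) + C * h * (h * real m)"
    by (rule Suc.IH) (use Suc.prems in auto)
  have "norm ?\<xi> \<le> V" using vel[of "i + m"] \<open>h > 0\<close> by (simp add: norm_divideR pos_divide_le_eq del: norm_scaleR)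
  then have "ell y ?\<xi> - CL * norm (X (i + m) - y) \<le> ell (X (i + m)) ?\<xi>"
    using CL[of ?\<xi> "X (i + m)" y] by (simp add: ell_def abs_le_iff)
  moreover have "CL * norm (X (i + m) - y) \<le> CL * E" using Suc.prems[of m] \<open>CL \<ge> 0\<close> by (intro mult_left_mono) auto
  moreover have "ell y \<xi> + q \<bullet> (?\<xi> - \<xi>) \<le> ell y ?\<xi>" unfolding q_def by (rule ell_subgradient)
  ultimately have "ell y \<xi> + q \<bullet> (?\<xi> - \<xi>) - CL * E \<le> ell (X (i + m)) ?\<xi>" by linarith
  then have "h * (ell y \<xi> + q \<bullet> (?\<xi> - \<xi>) - CL * E) \<le> h * ell (X (i + m)) ?\<xi>" using \<open>h > 0\<close> by simp
  moreover have "h * (q \<bullet> ?\<xi>) = q \<bullet> (X (i + m) - X (i + Suc m))" using \<open>h > 0\<close> by simp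
  ultimately have "h * ell y \<xi> + q \<bullet> (X (i + m) - X (i + Suc m)) - h * (q \<bullet> \<xi>) - h * (CL * E) \<le> h * ell (X (i + m)) ?\<xi>"
    by (simp only: distrib_left right_diff_distrib inner_diff_right)
  moreover have "v (X (i + Suc m)) + h * ell (X (i + m)) ?\<xi> \<le> v (X (i + m)) + C * h\<^sup>2" using step[of "i + m"] by simp
  ultimately have "v (X (i + Suc m)) \<le> v (X (i + m)) + C * h\<^sup>2 - (h * ell y \<xi> + q \<bullet> (X (i + m) - X (i + Suc m)) - h * (q \<bullet> \<xi>) - h * (CL * E))"
    by linarith
  with IH show ?case
    by (simp add: inner_diff_right power2_eq_square algebra_simps)
qed simp

text \<open>Backward chains of almost optimal steps of length \<open>h N\<close> are Lipschitz up to
  an error of one step. A subsequence converging at all rational times converges everywhere to a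
  Lipschitz curve, along which the discrete inequality survives and gives the bound opposite to
  domination.\<close>

lemma calibrated_exists:
  assumes "T > 0"
  shows "\<exists>\<gamma>. \<gamma> 0 = x \<and> calibrated (- T) 0 \<gamma>"
proof -
  obtain C V where C: "C > 0" "V > 0" "\<And>x t. 0 < t \<Longrightarrow>
    \<exists>y. norm (x - y) \<le> V * t \<and> v y + t * ell x ((x - y) /\<^sub>R t) \<le> v x + C * t\<^sup>2" using step_lower_bound by blast
  obtain CL where CL: "CL > 0" "\<And>x y \<xi>. norm \<xi> \<le> V \<Longrightarrow> \<bar>Lag H x \<xi> - Lag H y \<xi>\<bar> \<le> CL * norm (x - y)"
    using Lag_lipschitz_x[where R = V] by blast
  define nx where "nx x t = (SOME y. norm (x - y) \<le> V * t \<and> v y + t * ell x ((x - y) /\<^sub>R t) \<le> v x + C * t\<^sup>2)" for x t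
  have nx: "norm (x - nx x t) \<le> V * t" "v (nx x t) + t * ell x ((x - nx x t) /\<^sub>R t) \<le> v x + C * t\<^sup>2"
    if "0 < t" for x t
    using someI_ex[OF C(3)[OF that, of x]] unfolding nx_def by blast+
  define h where "h N = 1 / real (Suc N)" for N
  have h: "h N > 0" "h N \<le> 1" for N by (auto simp: h_def)
  define X where "X N i = ((\<lambda>y. nx y (h N)) ^^ i) x" for N i
  have X0: "X N 0 = x" and XS: "X N (Suc i) = nx (X N i) (h N)" for N i by (auto simp: X_def)
  have vel: "norm (X N i - X N (Suc i)) \<le> V * h N" for N i unfolding XS by (rule nx(1)[OF h(1)])
  have step: "v (X N (Suc i)) + h N * ell (X N i) ((X N i - X N (Suc i)) /\<^sub>R h N) \<le> v (X N i) + C * (h N)\<^sup>2" for N i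
    unfolding XS by (rule nx(2)[OF h(1)])
  have Xlip: "norm (X N i - X N (i + m)) \<le> V * (h N * real m)" for N i m
  proof (induction m)
    case (Suc m)
    have "norm (X N i - X N (i + Suc m)) \<le> norm (X N i - X N (i + m)) + norm (X N (i + m) - X N (i + Suc m))"
      using norm_triangle_ineq[of "X N i - X N (i + m)" "X N (i + m) - X N (i + Suc m)"] by simp
    then show ?case using Suc vel[of N "i + m"] by (simp add: algebra_simps)
  qed simp
  \<comment> \<open>The number of whole steps of length \<open>h N\<close> in time
    \<open>\<sigma>\<close>; rounding down loses at most one step, hence the term \<open>h N\<close>
    in the estimates.\<close>
  define ix where "ix N \<sigma> = nat \<lfloor>\<sigma> * real (Suc N)\<rfloor>" for N \<sigma>
  have ix: "h N * real (ix N \<sigma>) \<le> \<sigma>" "\<sigma> \<le> h N * real (ix N \<sigma>) + h N" if "\<sigma> \<ge> 0" for N \<sigma>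
  proof -
    have e: "real (ix N \<sigma>) = of_int \<lfloor>\<sigma> * real (Suc N)\<rfloor>" using that by (simp add: ix_def)
    have "real (ix N \<sigma>) \<le> \<sigma> * real (Suc N)" unfolding e by (rule of_int_floor_le)
    moreover have "\<sigma> * real (Suc N) \<le> real (ix N \<sigma>) + 1" unfolding e by (rule real_of_int_floor_add_one_ge)
    ultimately show "h N * real (ix N \<sigma>) \<le> \<sigma>" "\<sigma> \<le> h N * real (ix N \<sigma>) + h N"
      by (auto simp: h_def field_simps)
  qed
  have ixm: "ix N \<sigma> \<le> ix N \<sigma>'" if "\<sigma> \<le> \<sigma>'" for N \<sigma> \<sigma>'
    unfolding ix_def using that by (intro nat_mono floor_mono mult_right_mono) auto
  define g where "g N \<sigma> = X N (ix N \<sigma>)" for N \<sigma>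
  have glip: "norm (g N \<sigma> - g N \<sigma>') \<le> V * (\<sigma>' - \<sigma> + h N)" if "0 \<le> \<sigma>" "\<sigma> \<le> \<sigma>'" for N \<sigma> \<sigma>'
  proof -
    define m where "m = ix N \<sigma>' - ix N \<sigma>"
    have m: "ix N \<sigma>' = ix N \<sigma> + m" using ixm[OF that(2)] by (simp add: m_def)
    have "h N * real m = h N * real (ix N \<sigma>') - h N * real (ix N \<sigma>)" unfolding m by (simp add: algebra_simps)
    also have "\<dots> \<le> \<sigma>' - \<sigma> + h N" using ix(1)[of \<sigma>' N] ix(2)[of \<sigma> N] that by linarith
    finally have "V * (h N * real m) \<le> V * (\<sigma>' - \<sigma> + h N)" using C(2) by simp
    then show ?thesis using Xlip[of N "ix N \<sigma>" m] unfolding g_def m by linarith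
  qed
  have g0: "g N 0 = x" for N by (simp add: g_def ix_def X0)
  have gb: "norm (g N \<sigma>) \<le> norm x + V * (T + 1)" if "\<sigma> \<in> \<rat> \<inter> {0..T}" for N \<sigma>
  proof -
    have "norm (x - g N \<sigma>) \<le> V * (\<sigma> - 0 + h N)" using glip[of 0 \<sigma> N] that by (simp add: g0)
    also have "\<dots> \<le> V * (T + 1)" using that h(2)[of N] C(2) by (intro mult_left_mono) auto
    finally show ?thesis using norm_triangle_ineq2[of "g N \<sigma>" x] by (simp add: norm_minus_commute)
  qed
  have "countable (\<rat> \<inter> {0..T})" using countable_rat by blast
  then obtain k :: "nat \<Rightarrow> nat" where k: "strict_mono k" "\<And>\<sigma>. \<sigma> \<in> \<rat> \<inter> {0..T} \<Longrightarrow> \<exists>l. (\<lambda>n. g (k n) \<sigma>) \<longlonglongrightarrow> l"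
    using function_convergent_subsequence[of "\<rat> \<inter> {0..T}" g "norm x + V * (T + 1)"] gb by blast
  have hlim: "(\<lambda>n. h (k n)) \<longlonglongrightarrow> 0"
  proof -
    have "h \<longlonglongrightarrow> 0" unfolding h_def[abs_def] using LIMSEQ_inverse_real_of_nat by (simp add: inverse_eq_divide)
    from LIMSEQ_subseq_LIMSEQ[OF this k(1)] show ?thesis by (simp add: o_def)
  qed
  have "\<exists>l. (\<lambda>n. g (k n) \<sigma>) \<longlonglongrightarrow> l" if \<sigma>: "\<sigma> \<in> {0..T}" for \<sigma>
  proof -
    have "Cauchy (\<lambda>n. g (k n) \<sigma>)"
    proof (rule metric_CauchyI)
      fix e :: real assume "e > 0"
      \<comment> \<open>Replacing \<open>\<sigma>\<close> by a nearby rational costs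
        \<open>V * (2 * \<delta>)\<close>, which is \<open>e / 6\<close>, twice; the convergence at
        the rational costs \<open>e / 3\<close>.\<close>
      define \<delta> where "\<delta> = e / (12 * V)"
      have "\<delta> > 0" using \<open>e > 0\<close> C(2) by (simp add: \<delta>_def)
      have "\<exists>q\<in>\<rat> \<inter> {0..T}. q \<le> \<sigma> \<and> \<sigma> - q < \<delta>"
      proof (cases "\<sigma> = 0")
        case True
        then show ?thesis using \<open>\<delta> > 0\<close> \<sigma> by (intro bexI[of _ 0]) auto
      next
        case False
        then have "max 0 (\<sigma> - \<delta>) < \<sigma>" using \<sigma> \<open>\<delta> > 0\<close> by auto
        from Rats_dense_in_real[OF this] obtain q where "q \<in> \<rat>" "max 0 (\<sigma> - \<delta>) < q" "q < \<sigma>" by auto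
        then show ?thesis using \<sigma> by (intro bexI[of _ q]) auto
      qed
      then obtain q where q: "q \<in> \<rat> \<inter> {0..T}" "q \<le> \<sigma>" "\<sigma> - q < \<delta>" by blast
      have "\<forall>\<^sub>F n in sequentially. h (k n) < \<delta>" using hlim \<open>\<delta> > 0\<close> by (rule order_tendstoD(2))
      then obtain N1 where N1: "\<And>n. n \<ge> N1 \<Longrightarrow> h (k n) < \<delta>" by (auto simp: eventually_sequentially)
      have "Cauchy (\<lambda>n. g (k n) q)" using k(2)[OF q(1)] convergent_def convergent_Cauchy by blast
      then obtain N2 where N2: "\<And>m n. m \<ge> N2 \<Longrightarrow> n \<ge> N2 \<Longrightarrow> dist (g (k m) q) (g (k n) q) < e / 3"
        using \<open>e > 0\<close> unfolding Cauchy_def by (metis divide_pos_pos zero_less_numeral)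
      have near: "dist (g (k n) q) (g (k n) \<sigma>) \<le> e / 6" if "n \<ge> N1" for n
      proof -
        have "norm (g (k n) q - g (k n) \<sigma>) \<le> V * (\<sigma> - q + h (k n))" using glip[of q \<sigma> "k n"] q by auto
        also have "\<dots> \<le> V * (2 * \<delta>)" using N1[OF that] q(3) C(2) by (intro mult_left_mono) auto
        also have "\<dots> = e / 6" using C(2) by (simp add: \<delta>_def)
        finally show ?thesis by (simp add: dist_norm)
      qed
      show "\<exists>M. \<forall>m\<ge>M. \<forall>n\<ge>M. dist (g (k m) \<sigma>) (g (k n) \<sigma>) < e"
      proof (intro exI[of _ "max N1 N2"] allI impI)
        fix m n assume mn: "m \<ge> max N1 N2" "n \<ge> max N1 N2"
        have "dist (g (k m) \<sigma>) (g (k n) \<sigma>) \<le> dist (g (k m) q) (g (k m) \<sigma>) + dist (g (k m) q) (g (k n) q) + dist (g (k n) q) (g (k n) \<sigma>)"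
          by metric
        then show "dist (g (k m) \<sigma>) (g (k n) \<sigma>) < e"
          using near[of m] near[of n] N2[of m n] mn \<open>e > 0\<close> by simp
      qed
    qed
    then show ?thesis using Cauchy_convergent convergent_def by blast
  qed
  then obtain G where glim: "\<And>\<sigma>. \<sigma> \<in> {0..T} \<Longrightarrow> (\<lambda>n. g (k n) \<sigma>) \<longlonglongrightarrow> G \<sigma>" by metis
  have G0: "G 0 = x" using glim[of 0] \<open>T > 0\<close> LIMSEQ_unique[of "\<lambda>n. x"] by (simp add: g0)
  have Glip: "norm (G \<sigma> - G \<sigma>') \<le> V * (\<sigma>' - \<sigma>)" if "0 \<le> \<sigma>" "\<sigma> \<le> \<sigma>'" "\<sigma>' \<le> T" for \<sigma> \<sigma>'
  proof (rule LIMSEQ_le)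
    show "(\<lambda>n. norm (g (k n) \<sigma> - g (k n) \<sigma>')) \<longlonglongrightarrow> norm (G \<sigma> - G \<sigma>')"
      by (intro tendsto_intros glim) (use that in auto)
    have "(\<lambda>n. V * (\<sigma>' - \<sigma> + h (k n))) \<longlonglongrightarrow> V * (\<sigma>' - \<sigma> + 0)" by (intro tendsto_intros hlim)
    then show "(\<lambda>n. V * (\<sigma>' - \<sigma> + h (k n))) \<longlonglongrightarrow> V * (\<sigma>' - \<sigma>)" by simp
  qed (use glip that in auto)
  have ixlim: "(\<lambda>n. h (k n) * real (ix (k n) \<sigma>)) \<longlonglongrightarrow> \<sigma>" if "\<sigma> \<ge> 0" for \<sigma>
  proof (rule tendsto_sandwich)
    show "\<forall>\<^sub>F n in sequentially. \<sigma> - h (k n) \<le> h (k n) * real (ix (k n) \<sigma>)"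
      using ix(2)[OF that] by (intro always_eventually allI) (simp add: algebra_simps)
    show "\<forall>\<^sub>F n in sequentially. h (k n) * real (ix (k n) \<sigma>) \<le> \<sigma>" using ix(1)[OF that] by simp
    show "(\<lambda>n. \<sigma> - h (k n)) \<longlonglongrightarrow> \<sigma>" using tendsto_diff[OF tendsto_const hlim, of \<sigma>] by simp
  qed simp
  \<comment> \<open>The supporting affine function is taken at the mean velocity of the limit curve,
    so that its two linear terms cancel in the limit.\<close>
  have key: "v (G \<sigma>') - v (G \<sigma>) \<le> - (\<sigma>' - \<sigma>) * ell (G \<sigma>) ((G \<sigma> - G \<sigma>') /\<^sub>R (\<sigma>' - \<sigma>)) + CL * V * (\<sigma>' - \<sigma>)\<^sup>2"
    if \<sigma>: "0 \<le> \<sigma>" "\<sigma> < \<sigma>'" "\<sigma>' \<le> T" for \<sigma> \<sigma>'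
  proof -
    define y where "y = G \<sigma>"
    define \<Delta> where "\<Delta> = \<sigma>' - \<sigma>"
    define \<xi> where "\<xi> = (y - G \<sigma>') /\<^sub>R \<Delta>"
    define q where "q = Pm y \<xi> - c"
    define \<tau> where "\<tau> n = h (k n) * real (ix (k n) \<sigma>') - h (k n) * real (ix (k n) \<sigma>)" for n
    have "\<Delta> > 0" using \<sigma> by (simp add: \<Delta>_def)
    have \<tau>: "\<tau> \<longlonglongrightarrow> \<Delta>" unfolding \<tau>_def \<Delta>_def by (intro tendsto_diff ixlim) (use \<sigma> in auto)
    have gs: "(\<lambda>n. g (k n) \<sigma>) \<longlonglongrightarrow> y" "(\<lambda>n. g (k n) \<sigma>') \<longlonglongrightarrow> G \<sigma>'"
      unfolding y_def by (intro glim; use \<sigma> in auto)+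
    have vc: "isCont v z" for z using v_continuous by (simp add: continuous_on_eq_continuous_at)
    \<comment> \<open>The right-hand side is the literal limit of the discrete bound;
      \<open>norm (y - y)\<close> and \<open>C * 0\<close> mark the errors that disappear.\<close>
    have "v (G \<sigma>') - v y \<le> - \<Delta> * ell y \<xi> - q \<bullet> (y - G \<sigma>') + \<Delta> * (q \<bullet> \<xi>) + \<Delta> * (CL * (norm (y - y) + V * \<Delta>)) + C * 0 * \<Delta>"
    proof (rule LIMSEQ_le)
      show "(\<lambda>n. v (g (k n) \<sigma>') - v (g (k n) \<sigma>)) \<longlonglongrightarrow> v (G \<sigma>') - v y"
        by (intro tendsto_diff isCont_tendsto_compose[OF vc] gs)
      show "(\<lambda>n. - \<tau> n * ell y \<xi> - q \<bullet> (g (k n) \<sigma> - g (k n) \<sigma>') + \<tau> n * (q \<bullet> \<xi>)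
         + \<tau> n * (CL * (norm (g (k n) \<sigma> - y) + V * \<tau> n)) + C * h (k n) * \<tau> n)
         \<longlonglongrightarrow> - \<Delta> * ell y \<xi> - q \<bullet> (y - G \<sigma>') + \<Delta> * (q \<bullet> \<xi>) + \<Delta> * (CL * (norm (y - y) + V * \<Delta>)) + C * 0 * \<Delta>"
        by (intro tendsto_intros gs \<tau> hlim)
      show "\<exists>N. \<forall>n\<ge>N. v (g (k n) \<sigma>') - v (g (k n) \<sigma>) \<le> - \<tau> n * ell y \<xi> - q \<bullet> (g (k n) \<sigma> - g (k n) \<sigma>') + \<tau> n * (q \<bullet> \<xi>)
         + \<tau> n * (CL * (norm (g (k n) \<sigma> - y) + V * \<tau> n)) + C * h (k n) * \<tau> n"
      proof (intro exI[of _ 0] allI impI)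
        fix n
        define i where "i = ix (k n) \<sigma>"
        define m where "m = ix (k n) \<sigma>' - i"
        have m: "ix (k n) \<sigma>' = i + m" using ixm[of \<sigma> \<sigma>' "k n"] \<sigma> by (simp add: m_def i_def)
        have hm: "h (k n) * real m = \<tau> n" unfolding \<tau>_def m by (simp add: i_def algebra_simps)
        have "norm (X (k n) (i + j) - y) \<le> norm (X (k n) i - y) + V * \<tau> n" if "j < m" for j
        proof -
          have "norm (X (k n) i - X (k n) (i + j)) \<le> V * (h (k n) * real j)" by (rule Xlip)
          also have "\<dots> \<le> V * \<tau> n" unfolding hm[symmetric] using that C(2) h(1)[of "k n"] by (intro mult_left_mono) auto
          finally show ?thesis
            using norm_triangle_ineq[of "X (k n) i - y" "X (k n) (i + j) - X (k n) i"] by (simp add: norm_minus_commute)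
        qed
        from discrete_chain_bound[where \<xi> = \<xi> and m = m and i = i and y = y, OF h(1) less_imp_le[OF CL(1)] vel step CL(2) this, folded q_def, unfolded hm]
        show "v (g (k n) \<sigma>') - v (g (k n) \<sigma>) \<le> - \<tau> n * ell y \<xi> - q \<bullet> (g (k n) \<sigma> - g (k n) \<sigma>') + \<tau> n * (q \<bullet> \<xi>)
         + \<tau> n * (CL * (norm (g (k n) \<sigma> - y) + V * \<tau> n)) + C * h (k n) * \<tau> n"
          unfolding g_def m i_def[symmetric] by simp
      qed
    qed
    moreover have "q \<bullet> (y - G \<sigma>') = \<Delta> * (q \<bullet> \<xi>)" using \<open>\<Delta> > 0\<close> by (simp add: \<xi>_def)
    ultimately show ?thesis by (simp add: y_def[symmetric] \<Delta>_def[symmetric] \<xi>_def[symmetric] power2_eq_square ac_simps)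
  qed
  define \<gamma> where "\<gamma> u = G (- u)" for u
  have ac: "abs_cont_on (- T) 0 \<gamma>"
  proof (rule abs_cont_on_lipschitz[where M = V])
    show "norm (\<gamma> t - \<gamma> s) \<le> V * (t - s)" if "- T \<le> s" "s \<le> t" "t \<le> 0" for s t
      unfolding \<gamma>_def using Glip[of "- t" "- s"] that by simp
  qed (use C(2) in simp)
  have T0: "- T \<le> 0" using \<open>T > 0\<close> by simp
  let ?f = "\<lambda>u. vector_derivative (\<lambda>u. v (\<gamma> u)) (at u)"
  let ?l = "\<lambda>u. ell (\<gamma> u) (vector_derivative \<gamma> (at u))"
  obtain N where N: "negligible N" "(?f has_integral (v (\<gamma> 0) - v (\<gamma> (- T)))) {- T..0}"
    "\<And>u. u \<in> {- T..0} - N \<Longrightarrow> (\<gamma> has_vector_derivative vector_derivative \<gamma> (at u)) (at u)"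
    "\<And>u. u \<in> {- T..0} - N \<Longrightarrow> ((\<lambda>u. v (\<gamma> u)) has_real_derivative ?f u) (at u)"
    "\<And>u. u \<in> {- T..0} - N \<Longrightarrow> ?f u \<le> ?l u"
    using v_along_derivative_ae[OF ac T0] by blast
  \<comment> \<open>\<open>key\<close> compares a time with earlier ones, hence quotients from the
    left; \<open>- T\<close> has no earlier time and joins the null set.\<close>
  have ge: "?l u \<le> ?f u" if u: "u \<in> {- T..0} - (N \<union> {- T})" for u
  proof -
    have u': "u \<in> {- T..0} - N" "- T < u" "u \<le> 0" using u by auto
    have "((\<lambda>h. (v (\<gamma> (u + h)) - v (\<gamma> u)) / h) \<longlongrightarrow> ?f u) (at 0)"
      using N(4)[OF u'(1)] by (simp add: DERIV_def)
    then have 1: "((\<lambda>h. (v (\<gamma> (u + h)) - v (\<gamma> u)) / h) \<longlongrightarrow> ?f u) (at_left 0)" by (simp add: filterlim_at_split)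
    have "((\<lambda>h. (\<gamma> (u + h) - \<gamma> u) /\<^sub>R h) \<longlongrightarrow> vector_derivative \<gamma> (at u)) (at_left 0)"
      using vector_derivative_quotient_tendsto[OF N(3)[OF u'(1)]] by (simp add: filterlim_at_split)
    moreover have "isCont (ell (\<gamma> u)) (vector_derivative \<gamma> (at u))" by (rule has_derivative_continuous[OF ell_has_derivative])
    ultimately have "((\<lambda>h. ell (\<gamma> u) ((\<gamma> (u + h) - \<gamma> u) /\<^sub>R h)) \<longlongrightarrow> ?l u) (at_left 0)"
      by (rule isCont_tendsto_compose[rotated])
    then have "((\<lambda>h. ell (\<gamma> u) ((\<gamma> (u + h) - \<gamma> u) /\<^sub>R h) + CL * V * h) \<longlongrightarrow> ?l u + CL * V * 0) (at_left 0)"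
      by (intro tendsto_intros)
    then have 2: "((\<lambda>h. ell (\<gamma> u) ((\<gamma> (u + h) - \<gamma> u) /\<^sub>R h) + CL * V * h) \<longlongrightarrow> ?l u) (at_left 0)" by simp
    have "\<forall>\<^sub>F h in at_left 0. ell (\<gamma> u) ((\<gamma> (u + h) - \<gamma> u) /\<^sub>R h) + CL * V * h \<le> (v (\<gamma> (u + h)) - v (\<gamma> u)) / h"
      unfolding eventually_at_left_field
    proof (intro exI[of _ "- T - u"] conjI allI impI)
      fix d :: real assume d: "- T - u < d" "d < 0"
      have e1: "(\<gamma> u - \<gamma> (u + d)) /\<^sub>R (- d) = (\<gamma> (u + d) - \<gamma> u) /\<^sub>R d"
      proof -
        have "(\<gamma> u - \<gamma> (u + d)) /\<^sub>R (- d) = (- inverse d) *\<^sub>R (- (\<gamma> (u + d) - \<gamma> u))" by (simp add: inverse_minus_eq)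
        then show ?thesis by (simp only: scaleR_minus_left scaleR_minus_right minus_minus)
      qed
      have "v (\<gamma> (u + d)) - v (\<gamma> u) \<le> d * ell (\<gamma> u) ((\<gamma> u - \<gamma> (u + d)) /\<^sub>R (- d)) + CL * V * (- d)\<^sup>2"
        using key[of "- u" "- u - d"] d u' by (simp add: \<gamma>_def)
      then have "v (\<gamma> (u + d)) - v (\<gamma> u) \<le> d * ell (\<gamma> u) ((\<gamma> (u + d) - \<gamma> u) /\<^sub>R d) + CL * V * d\<^sup>2"
        unfolding e1 by simp
      then show "ell (\<gamma> u) ((\<gamma> (u + d) - \<gamma> u) /\<^sub>R d) + CL * V * d \<le> (v (\<gamma> (u + d)) - v (\<gamma> u)) / d"
        using d(2) by (simp add: neg_le_divide_eq power2_eq_square algebra_simps)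
    qed (use u' in simp)
    then show ?thesis by (rule tendsto_le[OF trivial_limit_at_left_real 1 2])
  qed
  have "(?l has_integral (v (\<gamma> 0) - v (\<gamma> (- T)))) {- T..0}"
  proof (rule has_integral_spike[OF _ _ N(2)])
    show "negligible (N \<union> {- T})" using N(1) by simp
    show "?l u = ?f u" if "u \<in> {- T..0} - (N \<union> {- T})" for u using ge[OF that] N(5)[of u] that by auto
  qed
  then have l: "?l integrable_on {- T..0}" "integral {- T..0} ?l = v (\<gamma> 0) - v (\<gamma> (- T))"
    by (auto simp: integral_unique has_integral_integrable)
  \<comment> \<open>\<open>calibrated\<close> asks for integrability of the Lagrangian itself, which
    is regained from \<open>ell\<close> by adding the linear term and removing the constant.\<close>
  have "(\<lambda>u. vector_derivative \<gamma> (at u)) integrable_on {- T..0}"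
    using abs_cont_fundamental_theorem[OF ac T0] by blast
  then have "(\<lambda>u. c \<bullet> vector_derivative \<gamma> (at u)) integrable_on {- T..0}"
    using integrable_linear[OF _ bounded_linear_inner_right, of _ _ c] by (simp add: o_def)
  then have "(\<lambda>u. ?l u + c \<bullet> vector_derivative \<gamma> (at u) - a) integrable_on {- T..0}"
    using l(1) by (intro integrable_add integrable_diff integrable_const_ivl)
  then have "(\<lambda>u. Lag H (\<gamma> u) (vector_derivative \<gamma> (at u))) integrable_on {- T..0}" by (simp add: ell_def)
  then have "calibrated (- T) 0 \<gamma>" using ac l(2) by (simp add: calibrated_def)
  then show ?thesis using G0 by (intro exI[of _ \<gamma>]) (simp add: \<gamma>_def)
qed

section \<open>Backward orbits and their limit sets\<close>

lemma calibrated_flow: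
  assumes cal: "calibrated s t \<gamma>" and "s < t" and eq: "\<And>r. r \<in> {s..t} \<Longrightarrow> \<gamma> r = fst (phiH H r z)"
  shows "flow_calibrated z s t"
proof -
  have "vector_derivative \<gamma> (at u) = Hp (fst (phiH H u z)) (snd (phiH H u z))" if u: "u \<in> {s<..<t}" for u
  proof (rule vector_derivative_at)
    show "(\<gamma> has_vector_derivative Hp (fst (phiH H u z)) (snd (phiH H u z))) (at u)"
      by (rule has_vector_derivative_transform_within_open[OF ham_fst[OF ham_phiH], of "{s<..<t}"])
         (use u eq in auto)
  qed
  then have "ell (\<gamma> u) (vector_derivative \<gamma> (at u)) = flow_ell z u" if "u \<in> {s..t} - {s,t}" for u
    using eq[of u] that by (simp add: flow_ell_def)
  then have "integral {s..t} (flow_ell z) = integral {s..t} (\<lambda>u. ell (\<gamma> u) (vector_derivative \<gamma> (at u)))"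
    by (intro integral_spike[of "{s,t}"]) auto
  also have "\<dots> = v (\<gamma> t) - v (\<gamma> s)" using cal by (simp add: calibrated_def)
  finally show ?thesis using eq[of s] eq[of t] \<open>s < t\<close> by (simp add: flow_calibrated_def)
qed

lemma calibrated_imp_flow:
  assumes cal: "calibrated (- T) 0 \<gamma>" and "T > 0"
  shows "\<exists>p. (\<forall>r\<in>{- T..0}. \<gamma> r = fst (phiH H r (\<gamma> 0, p))) \<and> flow_calibrated (\<gamma> 0, p) (- T) 0 \<and>
    (\<forall>e>0. \<exists>d>0. \<forall>w. norm w < d \<longrightarrow> v (\<gamma> 0 + w) \<le> v (\<gamma> 0) + (p - c) \<bullet> w + e * norm w)"
proof -
  have "- T < 0" using \<open>T > 0\<close> by simp
  from calibrated_regularity[OF cal this] obtain p where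
    p: "\<forall>r\<in>{- T..0}. \<gamma> r = fst (phiH H (r - 0) (\<gamma> 0, p))"
    "\<forall>e>0. \<exists>d>0. \<forall>w. norm w < d \<longrightarrow> v (\<gamma> 0 + w) \<le> v (\<gamma> 0) + (p - c) \<bullet> w + e * norm w" by blast
  have eq: "\<gamma> r = fst (phiH H r (\<gamma> 0, p))" if "r \<in> {- T..0}" for r
    using bspec[OF p(1) that] by (simp only: diff_zero)
  have "flow_calibrated (\<gamma> 0, p) (- T) 0" by (rule calibrated_flow[OF cal \<open>- T < 0\<close> eq])
  then show ?thesis using eq p(2) by blast
qed

lemma flow_eq_of_fst_eq:
  assumes "\<And>r. r \<in> {- T<..<0} \<Longrightarrow> fst (phiH H r z) = fst (phiH H r w)" "T > 0"
  shows "z = w"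
proof -
  define r where "r = - T / 2"
  have r: "r \<in> {- T<..<0}" using \<open>T > 0\<close> by (auto simp: r_def)
  have "phiH H (r - 0) z = phiH H (r - 0) w"
    by (rule flow_fst_eq_imp_snd_eq[OF _ r]) (use assms(1) in \<open>simp only: diff_zero\<close>)
  then have "phiH H (- r) (phiH H r z) = phiH H (- r) (phiH H r w)" by simp
  then show ?thesis by (simp add: phiH_add)
qed

section \<open>Orbits calibrated on the negative half-line and on the whole line\<close>

definition backward :: "(real^'n) \<times> (real^'n) \<Rightarrow> bool" where
  "backward z \<longleftrightarrow> (\<forall>T>0. flow_calibrated z (- T) 0)"

text \<open>Time 0 is interior here, so \<open>v\<close> is differentiable at the base point with
  gradient \<open>snd z - c\<close>; a backward orbit ensures this only at negative times.\<close>

definition full :: "(real^'n) \<times> (real^'n) \<Rightarrow> bool" where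
  "full z \<longleftrightarrow> (\<forall>T>0. flow_calibrated z (- T) T)"

lemma backward_subinterval:
  assumes "backward z" "s \<le> t" "t \<le> 0"
  shows "flow_calibrated z s t"
proof -
  have "1 - s > 0" using assms by simp
  then have "flow_calibrated z (- (1 - s)) 0" using assms(1) unfolding backward_def by blast
  then show ?thesis by (rule flow_calibrated_subinterval) (use assms in auto)
qed

text \<open>Calibration on any non-trivial interval forces energy at most \<open>a\<close>, and
  hence, by conservation, one momentum ball for all orbits and times.\<close>

lemma energy_momentum_bound: obtains R where "R > 0" "\<And>z s t u. flow_calibrated z s t \<Longrightarrow> s < t \<Longrightarrow> norm (snd (phiH H u z)) \<le> R"
proof -
  obtain R where R: "R > 0" "\<And>x p. H x p \<le> a \<Longrightarrow> norm p < R" using sublevel_bounded[where E = a] by blast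
  show ?thesis
  proof (rule that[OF R(1)])
    fix z s t u assume "flow_calibrated z s t" "s < t"
    from flow_calibrated_energy[OF this] have "H (fst (phiH H u z)) (snd (phiH H u z)) \<le> a"
      using energy_conserved[OF ham_phiH[of z], of u] by simp
    then show "norm (snd (phiH H u z)) \<le> R" using R(2) less_imp_le by blast
  qed
qed

text \<open>Where \<open>v\<close> is not differentiable, the momenta found for different horizons
  may differ, so the curves need not extend each other. An accumulation point of the bounded momenta
  is calibrated on every horizon.\<close>

lemma backward_exists: "\<exists>p. backward (x, p)"
proof -
  have "\<exists>p. flow_calibrated (x, p) (- real (Suc n)) 0" for n
  proof -
    obtain \<gamma> where \<gamma>: "\<gamma> 0 = x" "calibrated (- real (Suc n)) 0 \<gamma>" using calibrated_exists[of "real (Suc n)" x] by auto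
    then show ?thesis using calibrated_imp_flow[OF \<gamma>(2)] by auto
  qed
  then obtain p where p: "\<And>n. flow_calibrated (x, p n) (- real (Suc n)) 0" by metis
  obtain R where R: "R > 0" "\<And>z s t u. flow_calibrated z s t \<Longrightarrow> s < t \<Longrightarrow> norm (snd (phiH H u z)) \<le> R"
    using energy_momentum_bound by blast
  have "norm (p n) \<le> R" for n using R(2)[OF p[of n], of 0] by simp
  then have "\<forall>n. p n \<in> cball 0 R" by simp
  then obtain q k where qk: "strict_mono (k::nat \<Rightarrow> nat)" "(p \<circ> k) \<longlonglongrightarrow> q"
    using compact_cball[of 0 R] unfolding compact_def by metis
  have "flow_calibrated (x, q) (- T) 0" if "T > 0" for T
  proof (rule flow_calibrated_limit[where Z = "\<lambda>n. (x, p (k n))"])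
    show "(\<lambda>n. (x, p (k n))) \<longlonglongrightarrow> (x, q)" using qk(2) by (auto intro!: tendsto_Pair simp: o_def)
    obtain M :: nat where M: "T \<le> real M" using real_arch_simple by blast
    show "\<forall>\<^sub>F j in sequentially. flow_calibrated (x, p (k j)) (- T) 0"
      unfolding eventually_sequentially
    proof (intro exI[of _ M] allI impI)
      fix j assume "M \<le> j"
      then have "real M \<le> real (k j)" using seq_suble[OF qk(1), of j] by simp
      then show "flow_calibrated (x, p (k j)) (- T) 0"
        using M that by (intro flow_calibrated_subinterval[OF p[of "k j"]]) auto
    qed
  qed
  then show ?thesis unfolding backward_def by blast
qed

lemma action_ell: "action H c T \<gamma> = integral {- T..0} (\<lambda>u. ell (\<gamma> u) (vector_derivative \<gamma> (at u)))"
  by (simp add: action_def ell_def)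

lemma action_lower_bound:
  assumes "admissible H T \<eta>" "T > 0"
  shows "v (\<eta> 0) \<le> action H c T \<eta> + v (\<eta> (- T))"
  using domination[of "- T" 0 \<eta>] assms by (simp add: action_ell admissible_def)

lemma backward_minimizing:
  assumes "backward (x, p)"
  shows "minimizing_curve H c v x (\<lambda>u. fst (phiH H u (x, p)))"
  unfolding minimizing_curve_def
proof (intro conjI allI impI)
  let ?\<gamma> = "\<lambda>u. fst (phiH H u (x, p))"
  fix T :: real assume "T > 0"
  then have cal: "calibrated (- T) 0 ?\<gamma>" using assms by (simp add: backward_def flow_calibrated_iff)
  then show "admissible H T ?\<gamma>" by (simp add: calibrated_def admissible_def)
  fix \<eta> assume \<eta>: "admissible H T \<eta> \<and> \<eta> 0 = x"
  have "action H c T ?\<gamma> + v (?\<gamma> (- T)) = v x" using cal by (simp add: action_ell calibrated_def)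
  then show "action H c T ?\<gamma> + v (?\<gamma> (- T)) \<le> action H c T \<eta> + v (\<eta> (- T))"
    using action_lower_bound[of T \<eta>] \<eta> \<open>T > 0\<close> by simp
qed simp

text \<open>A backward orbit from \<open>x\<close> attains the value \<open>v x\<close>, so a
  minimiser cannot exceed it; domination gives the other inequality, and the minimiser is
  calibrated. The momenta obtained on different horizons agree because they produce the same
  positions near time 0.\<close>

lemma minimizing_imp_backward:
  assumes min: "minimizing_curve H c v x \<gamma>"
  shows "\<exists>p. backward (x, p) \<and> (\<forall>s\<le>0. \<gamma> s = fst (phiH H s (x, p)))"
proof -
  have \<gamma>0: "\<gamma> 0 = x" using min by (simp add: minimizing_curve_def)
  obtain p0 where p0: "backward (x, p0)" using backward_exists by blast
  have cal: "calibrated (- T) 0 \<gamma>" if "T > 0" for T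
  proof -
    let ?\<eta> = "\<lambda>u. fst (phiH H u (x, p0))"
    have adm: "admissible H T \<gamma>" using min that by (simp add: minimizing_curve_def)
    have cal: "calibrated (- T) 0 ?\<eta>" using p0 that by (simp add: backward_def flow_calibrated_iff)
    then have "admissible H T ?\<eta>" "?\<eta> 0 = x" by (simp_all add: calibrated_def admissible_def)
    then have "action H c T \<gamma> + v (\<gamma> (- T)) \<le> action H c T ?\<eta> + v (?\<eta> (- T))"
      using min that unfolding minimizing_curve_def by blast
    also have "\<dots> = v x" using cal by (simp add: action_ell calibrated_def)
    finally have "action H c T \<gamma> + v (\<gamma> (- T)) = v (\<gamma> 0)"
      using action_lower_bound[OF adm that] \<gamma>0 by simp
    then show ?thesis using adm by (simp add: calibrated_def admissible_def action_ell)
  qed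
  have "\<exists>p. (\<forall>r\<in>{- T..0}. \<gamma> r = fst (phiH H r (x, p))) \<and> flow_calibrated (x, p) (- T) 0" if "T > 0" for T
    using calibrated_imp_flow[OF cal[OF that] that] \<gamma>0 by auto
  then obtain P where P: "\<And>T r. T > 0 \<Longrightarrow> r \<in> {- T..0} \<Longrightarrow> \<gamma> r = fst (phiH H r (x, P T))"
    "\<And>T. T > 0 \<Longrightarrow> flow_calibrated (x, P T) (- T) 0" by metis
  have "(x, P T) = (x, P 1)" if "T > 0" for T
  proof (rule flow_eq_of_fst_eq[where T = "min T 1"])
    show "fst (phiH H r (x, P T)) = fst (phiH H r (x, P 1))" if "r \<in> {- min T 1<..<0}" for r
    proof -
      have "r \<in> {- T..0}" "r \<in> {- 1..0}" using that by auto
      with P(1)[OF \<open>T > 0\<close>] P(1)[of 1] show ?thesis by (metis zero_less_one)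
    qed
  qed (use that in simp)
  then have PT: "P T = P 1" if "T > 0" for T using that by blast
  have "backward (x, P 1)" unfolding backward_def using P(2) PT by metis
  moreover have "\<gamma> s = fst (phiH H s (x, P 1))" if "s \<le> 0" for s
    using P(1)[of "1 - s" s] PT[of "1 - s"] that by simp
  ultimately show ?thesis by blast
qed

text \<open>At its end the orbit provides only an upper support with slope \<open>p - c\<close>; the
  assumed differentiability contributes the lower one.\<close>

lemma backward_gradient:
  assumes "backward (x, p)" "v differentiable (at x)"
  shows "p = c + grad v x"
proof -
  have "calibrated (- 1) 0 (\<lambda>u. fst (phiH H u (x, p)))"
    using assms(1) unfolding backward_def flow_calibrated_iff by simp
  from calibrated_imp_flow[OF this zero_less_one] obtain p' where
    p': "\<forall>r\<in>{- 1..0}. fst (phiH H r (x, p)) = fst (phiH H r (x, p'))"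
    "\<forall>e>0. \<exists>d>0. \<forall>w. norm w < d \<longrightarrow> v (x + w) \<le> v x + (p' - c) \<bullet> w + e * norm w" by auto
  have "(x, p) = (x, p')" by (rule flow_eq_of_fst_eq[where T = 1]) (use p'(1) in auto)
  then have pp: "p' = p" by simp
  have d: "(v has_derivative (\<lambda>w. grad v x \<bullet> w)) (at x)" by (rule differentiable_grad[OF assms(2)])
  have "p' - c = grad v x"
  proof (rule has_derivative_of_two_sided_support(1))
    show "\<exists>d>0. \<forall>w. norm w < d \<longrightarrow> v (x + w) \<le> v x + (p' - c) \<bullet> w + e * norm w" if "e > 0" for e
      using p'(2) that by blast
    fix e :: real assume "e > 0"
    then obtain \<delta> where \<delta>: "\<delta> > 0" "\<And>y. norm (y - x) < \<delta> \<Longrightarrow> norm (v y - v x - grad v x \<bullet> (y - x)) \<le> e * norm (y - x)"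
      using d unfolding has_derivative_at_alt by blast
    show "\<exists>d>0. \<forall>w. norm w < d \<longrightarrow> v x + grad v x \<bullet> w - e * norm w \<le> v (x + w)"
    proof (intro exI[of _ \<delta>] conjI allI impI \<delta>(1))
      fix w :: "real^'n" assume "norm w < \<delta>"
      then show "v x + grad v x \<bullet> w - e * norm w \<le> v (x + w)" using \<delta>(2)[of "x + w"] by (simp add: abs_le_iff)
    qed
  qed
  then show ?thesis using pp by (simp add: algebra_simps)
qed

lemma graph_gradI:
  assumes "(v has_derivative (\<lambda>w. (p - c) \<bullet> w)) (at x)"
  shows "(x, p) \<in> graph_grad c v" "p = c + grad v x"
proof -
  show p: "p = c + grad v x" using grad_eqI[OF assms] by simp
  have "v differentiable (at x)" using assms by (auto simp: differentiable_def)
  then show "(x, p) \<in> graph_grad c v" unfolding graph_grad_def using p by blast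
qed

lemma backward_in_graph:
  assumes "backward z" "s < 0"
  shows "phiH H s z \<in> graph_grad c v"
proof -
  have "flow_calibrated z (s - 1) 0" by (rule backward_subinterval[OF assms(1)]) (use assms in auto)
  from flow_calibrated_derivative[OF this, of s] assms(2)
  have "(v has_derivative (\<lambda>w. (snd (phiH H s z) - c) \<bullet> w)) (at (fst (phiH H s z)))" by simp
  from graph_gradI(1)[OF this] show ?thesis by simp
qed

lemma full_gradient:
  assumes "full z"
  shows "(v has_derivative (\<lambda>w. (snd z - c) \<bullet> w)) (at (fst z))"
proof -
  have "flow_calibrated z (- 1) 1" using assms by (simp add: full_def)
  from flow_calibrated_derivative[OF this, of 0] show ?thesis by simp
qed

lemma full_flow:
  assumes "full z"
  shows "full (phiH H \<tau> z)"
  unfolding full_def flow_calibrated_shift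
proof (intro allI impI)
  fix T :: real assume "T > 0"
  have "flow_calibrated z (- (T + \<bar>\<tau>\<bar>)) (T + \<bar>\<tau>\<bar>)"
    using assms add_pos_nonneg[OF \<open>T > 0\<close> abs_ge_zero[of \<tau>]] unfolding full_def by blast
  then show "flow_calibrated z (- T + \<tau>) (T + \<tau>)"
    by (rule flow_calibrated_subinterval) (use \<open>T > 0\<close> in auto)
qed

lemma full_limit:
  assumes "Z \<longlonglongrightarrow> z" "\<And>j. full (Z j)"
  shows "full z"
  unfolding full_def
proof (intro allI impI)
  fix T :: real assume "T > 0"
  then show "flow_calibrated z (- T) T"
    using assms(2) by (intro flow_calibrated_limit[OF assms(1)] always_eventually) (simp add: full_def)
qed

text \<open>Shifting time by \<open>\<tau> j\<close> turns calibration on the negative half-line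
  into calibration on \<open>{- T..T}\<close> once \<open>\<tau> j\<close> is at most
  \<open>- T\<close>; the lattice translations do not affect it.\<close>

lemma phase_limit_full:
  assumes z: "backward z" and "filterlim \<tau> at_bot sequentially" "\<And>j. k j \<in> lattice"
    and lim: "(\<lambda>j. (fst (phiH H (\<tau> j) z) + k j, snd (phiH H (\<tau> j) z))) \<longlonglongrightarrow> w"
  shows "full w"
  unfolding full_def
proof (intro allI impI, rule flow_calibrated_limit[OF lim])
  fix T :: real assume "T > 0"
  have "\<forall>\<^sub>F j in sequentially. \<tau> j \<le> - T" using assms(2) unfolding filterlim_at_bot by blast
  then show "\<forall>\<^sub>F j in sequentially. flow_calibrated (fst (phiH H (\<tau> j) z) + k j, snd (phiH H (\<tau> j) z)) (- T) T"
  proof eventually_elim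
    case (elim j)
    have "flow_calibrated z (- T + \<tau> j) (T + \<tau> j)"
      by (rule backward_subinterval[OF z]) (use elim \<open>T > 0\<close> in auto)
    then show ?case by (simp add: flow_calibrated_lattice[OF assms(3)] flow_calibrated_shift)
  qed
qed

text \<open>The shifted times \<open>s + \<tau> j\<close> still tend to minus infinity, and the flow
  commutes with lattice translations, so the orbit of a limit point stays in the limit set.\<close>

lemma phase_limit_flow:
  assumes "filterlim \<tau> at_bot sequentially" "\<And>j. k j \<in> lattice"
    and lim: "(\<lambda>j. (fst (phiH H (\<tau> j) z) + k j, snd (phiH H (\<tau> j) z))) \<longlonglongrightarrow> w"
  shows "fst (phiH H s w) \<in> torus_alpha_limits (\<lambda>u. fst (phiH H u z))"
proof -
  have "continuous_on UNIV (\<lambda>w. phiH H s w)" by (intro continuous_intros)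
  from continuous_on_tendsto_compose[OF this lim]
  have "(\<lambda>j. phiH H s (fst (phiH H (\<tau> j) z) + k j, snd (phiH H (\<tau> j) z))) \<longlonglongrightarrow> phiH H s w" by simp
  then have "(\<lambda>j. phiH H (s + \<tau> j) z + (k j, 0)) \<longlonglongrightarrow> phiH H s w"
    by (simp add: phiH_lattice[OF assms(2)] phiH_add)
  from tendsto_fst[OF this] have "(\<lambda>j. fst (phiH H (s + \<tau> j) z) + k j) \<longlonglongrightarrow> fst (phiH H s w)" by simp
  moreover have "filterlim (\<lambda>j. s + \<tau> j) at_bot sequentially"
    using filterlim_tendsto_add_at_bot_iff[OF tendsto_const[of s]] assms(1) by blast
  ultimately show ?thesis using assms(2) unfolding torus_alpha_limits_def by blast
qed

abbreviation alpha_points :: "(real^'n) set" where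
  "alpha_points \<equiv> \<Union> {torus_alpha_limits \<gamma> | \<gamma> x. minimizing_curve H c v x \<gamma>}"

lemma backward_alpha_points:
  assumes "backward z"
  shows "torus_alpha_limits (\<lambda>u. fst (phiH H u z)) \<subseteq> alpha_points"
  using backward_minimizing[of "fst z" "snd z"] assms by auto

text \<open>An \<open>\<alpha>\<close>-limit point records convergence of positions only.
  Boundedness of the momenta supplies a subsequence along which the phase points converge
  too.\<close>

lemma alpha_point_full:
  assumes "y \<in> alpha_points"
  shows "full (y, c + grad v y) \<and> (\<forall>s. fst (phiH H s (y, c + grad v y)) \<in> alpha_points)"
proof -
  obtain \<gamma> x where min: "minimizing_curve H c v x \<gamma>" and y: "y \<in> torus_alpha_limits \<gamma>" using assms by blast
  obtain p where p: "backward (x, p)" "\<And>s. s \<le> 0 \<Longrightarrow> \<gamma> s = fst (phiH H s (x, p))"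
    using minimizing_imp_backward[OF min] by blast
  obtain \<tau> k where \<tau>: "filterlim \<tau> at_bot sequentially" "\<And>j. k j \<in> lattice" "(\<lambda>j. \<gamma> (\<tau> j) + k j) \<longlonglongrightarrow> y"
    using y unfolding torus_alpha_limits_def by blast
  have "\<forall>\<^sub>F j in sequentially. \<tau> j \<le> 0" using \<tau>(1) unfolding filterlim_at_bot by blast
  then have "\<forall>\<^sub>F j in sequentially. \<gamma> (\<tau> j) + k j = fst (phiH H (\<tau> j) (x, p)) + k j"
    by eventually_elim (simp add: p(2))
  then have lim1: "(\<lambda>j. fst (phiH H (\<tau> j) (x, p)) + k j) \<longlonglongrightarrow> y"
    using \<tau>(3) by (rule Lim_transform_eventually[rotated])
  obtain R where R: "R > 0" "\<And>z s t u. flow_calibrated z s t \<Longrightarrow> s < t \<Longrightarrow> norm (snd (phiH H u z)) \<le> R"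
    using energy_momentum_bound by blast
  have "flow_calibrated (x, p) (- 1) 0" using p(1) by (simp add: backward_def)
  then have "\<forall>j. snd (phiH H (\<tau> j) (x, p)) \<in> cball 0 R" using R(2) by simp
  then obtain q m where qm: "strict_mono (m::nat \<Rightarrow> nat)" "((\<lambda>j. snd (phiH H (\<tau> j) (x, p))) \<circ> m) \<longlonglongrightarrow> q"
    using compact_cball[of 0 R] unfolding compact_def by metis
  have \<tau>m: "filterlim (\<tau> \<circ> m) at_bot sequentially"
    using filterlim_compose[OF \<tau>(1) filterlim_subseq[OF qm(1)]] by (simp add: o_def)
  have lim: "(\<lambda>j. (fst (phiH H ((\<tau> \<circ> m) j) (x, p)) + (k \<circ> m) j, snd (phiH H ((\<tau> \<circ> m) j) (x, p)))) \<longlonglongrightarrow> (y, q)"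
    using LIMSEQ_subseq_LIMSEQ[OF lim1 qm(1)] qm(2) by (intro tendsto_Pair) (auto simp: o_def)
  have km: "(k \<circ> m) j \<in> lattice" for j using \<tau>(2) by simp
  have full: "full (y, q)" by (rule phase_limit_full[OF p(1) \<tau>m km lim])
  \<comment> \<open>Fullness makes \<open>v\<close> differentiable at \<open>y\<close>, so the limit
    momentum is the gradient one, whatever the subsequence.\<close>
  have q: "q = c + grad v y" using graph_gradI(2)[of q y] full_gradient[OF full] by simp
  show ?thesis
    using full phase_limit_flow[OF \<tau>m km lim] backward_alpha_points[OF p(1)] unfolding q by blast
qed

text \<open>The closure is handled without assuming the gradient continuous: the momenta are
  bounded, a limit of full orbits is full, and fullness identifies the limit momentum with the
  gradient one.\<close>

lemma M_alpha_full:
  assumes "y \<in> M_alpha H c v"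
  shows "full (y, c + grad v y) \<and> (\<forall>s. fst (phiH H s (y, c + grad v y)) \<in> M_alpha H c v)"
proof -
  obtain Y where Y: "\<And>j. Y j \<in> alpha_points" "Y \<longlonglongrightarrow> y"
    using assms unfolding M_alpha_def closure_sequential by blast
  define Q where "Q j = c + grad v (Y j)" for j
  have f: "full (Y j, Q j)" "\<And>s. fst (phiH H s (Y j, Q j)) \<in> alpha_points" for j
    using alpha_point_full[OF Y(1)[of j]] unfolding Q_def by blast+
  obtain R where R: "R > 0" "\<And>z s t u. flow_calibrated z s t \<Longrightarrow> s < t \<Longrightarrow> norm (snd (phiH H u z)) \<le> R"
    using energy_momentum_bound by blast
  have "norm (Q j) \<le> R" for j
  proof -
    have "flow_calibrated (Y j, Q j) (- 1) 1" using f(1)[of j] by (simp add: full_def)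
    from R(2)[OF this, of 0] show ?thesis by simp
  qed
  then have "\<forall>j. Q j \<in> cball 0 R" by simp
  then obtain q m where qm: "strict_mono (m::nat \<Rightarrow> nat)" "(Q \<circ> m) \<longlonglongrightarrow> q"
    using compact_cball[of 0 R] unfolding compact_def by metis
  have lim: "(\<lambda>j. (Y (m j), Q (m j))) \<longlonglongrightarrow> (y, q)"
    using LIMSEQ_subseq_LIMSEQ[OF Y(2) qm(1)] qm(2) by (intro tendsto_Pair) (auto simp: o_def)
  have full: "full (y, q)" by (rule full_limit[OF lim f(1)])
  have q: "q = c + grad v y" using graph_gradI(2)[of q y] full_gradient[OF full] by simp
  have "fst (phiH H s (y, q)) \<in> M_alpha H c v" for s
    unfolding M_alpha_def closure_sequential
  proof (intro exI conjI allI)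
    have "continuous_on UNIV (\<lambda>w. phiH H s w)" by (intro continuous_intros)
    from tendsto_fst[OF continuous_on_tendsto_compose[OF this lim]]
    show "(\<lambda>j. fst (phiH H s (Y (m j), Q (m j)))) \<longlonglongrightarrow> fst (phiH H s (y, q))" by simp
  qed (rule f(2))
  then show ?thesis using full q by blast
qed

lemma Mstar_full:
  assumes "z \<in> Mstar_alpha H c v"
  shows "full z" "fst z \<in> M_alpha H c v" "snd z = c + grad v (fst z)"
  using assms M_alpha_full unfolding Mstar_alpha_def by auto

lemma Mstar_flow:
  assumes "z \<in> Mstar_alpha H c v"
  shows "phiH H s z \<in> Mstar_alpha H c v"
proof -
  have z: "z = (fst z, c + grad v (fst z))" using Mstar_full(3)[OF assms] by (simp add: prod_eq_iff)
  have "fst (phiH H s z) \<in> M_alpha H c v" using M_alpha_full[OF Mstar_full(2)[OF assms]] z by metis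
  moreover have "snd (phiH H s z) = c + grad v (fst (phiH H s z))"
    by (rule graph_gradI(2)[OF full_gradient[OF full_flow[OF Mstar_full(1)[OF assms]]]])
  ultimately show ?thesis unfolding Mstar_alpha_def by (metis (mono_tags, lifting) mem_Collect_eq prod.collapse)
qed

section \<open>Invariance and attraction, for momenta and for velocities\<close>

lemma Mt_iff: "(x, \<xi>) \<in> Mt_alpha H c v \<longleftrightarrow> (\<exists>p. (x, p) \<in> Mstar_alpha H c v \<and> \<xi> = Hp x p)"
  unfolding Mt_alpha_def Mstar_alpha_def Hp_def by auto

lemma Mt_flow:
  assumes "(x, p) \<in> Mstar_alpha H c v"
  shows "phiL H s (x, Hp x p) \<in> Mt_alpha H c v"
  unfolding phiL_phiH Mt_iff using Mstar_flow[OF assms, of s] by (intro exI[of _ "snd (phiH H s (x, p))"]) simp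

lemma phase_limits_phiH:
  assumes "backward z"
  shows "phase_alpha_limits (\<lambda>s. phiH H s z) \<subseteq> Mstar_alpha H c v"
proof
  fix w assume "w \<in> phase_alpha_limits (\<lambda>s. phiH H s z)"
  then obtain \<tau> k where \<tau>: "filterlim \<tau> at_bot sequentially" "\<And>j. k j \<in> lattice"
    "(\<lambda>j. (fst (phiH H (\<tau> j) z) + k j, snd (phiH H (\<tau> j) z))) \<longlonglongrightarrow> w"
    unfolding phase_alpha_limits_def by blast
  have "full w" by (rule phase_limit_full[OF assms \<tau>])
  then have "snd w = c + grad v (fst w)" by (rule graph_gradI(2)[OF full_gradient])
  moreover have "fst w \<in> alpha_points"
    using subsetD[OF backward_alpha_points[OF assms] phase_limit_flow[OF \<tau>, of 0]] by (simp only: phiH_0)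
  then have "fst w \<in> M_alpha H c v" unfolding M_alpha_def by (rule subsetD[OF closure_subset])
  ultimately show "w \<in> Mstar_alpha H c v" by (cases w) (simp add: Mstar_alpha_def)
qed

text \<open>The continuous map replacing a velocity by its dual momentum carries limits of the
  Euler-Lagrange orbit to limits of the Hamiltonian one; periodicity of \<open>Pm\<close> absorbs
  the lattice vectors.\<close>

lemma phase_limits_phiL:
  assumes "backward (x, p)"
  shows "phase_alpha_limits (\<lambda>s. phiL H s (x, Hp x p)) \<subseteq> Mt_alpha H c v"
proof
  fix w assume "w \<in> phase_alpha_limits (\<lambda>s. phiL H s (x, Hp x p))"
  then obtain \<tau> k where \<tau>: "filterlim \<tau> at_bot sequentially" "\<And>j. k j \<in> lattice"
    and lim: "(\<lambda>j. (fst (phiL H (\<tau> j) (x, Hp x p)) + k j, snd (phiL H (\<tau> j) (x, Hp x p)))) \<longlonglongrightarrow> w"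
    unfolding phase_alpha_limits_def by blast
  let ?z = "\<lambda>j. phiH H (\<tau> j) (x, p)"
  have "continuous_on UNIV (\<lambda>u. (fst u, Pm (fst u) (snd u)))" by (intro continuous_intros)
  from continuous_on_tendsto_compose[OF this lim]
  have "(\<lambda>j. (fst (?z j) + k j, Pm (fst (?z j) + k j) (Hp (fst (?z j)) (snd (?z j))))) \<longlonglongrightarrow> (fst w, Pm (fst w) (snd w))"
    by (simp add: phiL_phiH)
  then have "(\<lambda>j. (fst (?z j) + k j, snd (?z j))) \<longlonglongrightarrow> (fst w, Pm (fst w) (snd w))"
    by (simp add: Pm_periodic[OF \<tau>(2)])
  then have "(fst w, Pm (fst w) (snd w)) \<in> phase_alpha_limits (\<lambda>s. phiH H s (x, p))"
    unfolding phase_alpha_limits_def using \<tau> by blast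
  then have "(fst w, Pm (fst w) (snd w)) \<in> Mstar_alpha H c v" using phase_limits_phiH[OF assms] by blast
  then have "(fst w, snd w) \<in> Mt_alpha H c v" unfolding Mt_iff by (metis Hp_Pm)
  then show "w \<in> Mt_alpha H c v" by simp
qed

lemma phiL_image_Mt: "phiL H s ` Mt_alpha H c v = Mt_alpha H c v"
proof (intro equalityI subsetI)
  fix w assume "w \<in> phiL H s ` Mt_alpha H c v"
  then obtain x p where "(x, p) \<in> Mstar_alpha H c v" "w = phiL H s (x, Hp x p)" using Mt_iff by auto
  then show "w \<in> Mt_alpha H c v" using Mt_flow by simp
next
  fix w assume "w \<in> Mt_alpha H c v"
  then obtain p where "(fst w, p) \<in> Mstar_alpha H c v" "snd w = Hp (fst w) p" using Mt_iff[of "fst w" "snd w"] by auto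
  then obtain x where xp: "(x, p) \<in> Mstar_alpha H c v" "w = (x, Hp x p)" by (metis prod.collapse)
  \<comment> \<open>The preimage is found on the Hamiltonian side, by flowing back for time
    \<open>s\<close>.\<close>
  obtain y q where yq: "phiH H (- s) (x, p) = (y, q)" by (cases "phiH H (- s) (x, p)")
  then have "(y, q) \<in> Mstar_alpha H c v" using Mstar_flow[OF xp(1), of "- s"] by simp
  then have "(y, Hp y q) \<in> Mt_alpha H c v" using Mt_iff by blast
  moreover have "phiH H s (y, q) = (x, p)" unfolding yq[symmetric] by (simp add: phiH_add)
  then have "phiL H s (y, Hp y q) = w" by (simp add: phiL_phiH xp(2))
  ultimately show "w \<in> phiL H s ` Mt_alpha H c v" by (metis imageI)
qed

lemma phiH_image_Mstar: "phiH H s ` Mstar_alpha H c v = Mstar_alpha H c v"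
proof (intro equalityI subsetI)
  fix w assume "w \<in> phiH H s ` Mstar_alpha H c v"
  then show "w \<in> Mstar_alpha H c v" using Mstar_flow by auto
next
  fix w assume "w \<in> Mstar_alpha H c v"
  then have "phiH H (- s) w \<in> Mstar_alpha H c v" by (rule Mstar_flow)
  moreover have "phiH H s (phiH H (- s) w) = w" by (simp add: phiH_add)
  ultimately show "w \<in> phiH H s ` Mstar_alpha H c v" by (metis imageI)
qed

lemma Mstar_subset_graph: "Mstar_alpha H c v \<subseteq> graph_grad c v"
proof
  fix z assume z: "z \<in> Mstar_alpha H c v"
  from graph_gradI(1)[OF full_gradient[OF Mstar_full(1)[OF z]]] show "z \<in> graph_grad c v" by simp
qed

end

theorem theorem2p4:
  fixes H :: "real^'n \<Rightarrow> real^'n \<Rightarrow> real" and c :: "real^'n" and v :: "real^'n \<Rightarrow> real"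
  assumes "tonelli H"
    and "viscosity_solution H c (crit_value H c) v"
  shows "(\<forall>x. (\<exists>\<xi>. phase_alpha_limits (\<lambda>s. phiL H s (x, \<xi>)) \<subseteq> Mt_alpha H c v) \<and>
              (v differentiable (at x) \<longrightarrow>
                 phase_alpha_limits (\<lambda>s. phiL H s (x, grad (H x) (c + grad v x))) \<subseteq> Mt_alpha H c v))
       \<and> (\<forall>s. phiL H s ` Mt_alpha H c v = Mt_alpha H c v)
       \<and> (\<forall>x. (\<exists>p. (\<forall>s<0. phiH H s (x, p) \<in> graph_grad c v) \<and>
                   phase_alpha_limits (\<lambda>s. phiH H s (x, p)) \<subseteq> Mstar_alpha H c v) \<and>
              (v differentiable (at x) \<longrightarrow>
                 (\<forall>s<0. phiH H s (x, c + grad v x) \<in> graph_grad c v) \<and>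
                 phase_alpha_limits (\<lambda>s. phiH H s (x, c + grad v x)) \<subseteq> Mstar_alpha H c v))
       \<and> Mstar_alpha H c v \<subseteq> graph_grad c v
       \<and> (\<forall>s. phiH H s ` Mstar_alpha H c v = Mstar_alpha H c v)"
proof -
  interpret weak_kam H c v by unfold_locales (use assms in auto)
  \<comment> \<open>Where \<open>v\<close> is differentiable, every backward momentum is the
    gradient one, so the existence of some backward momentum settles this case.\<close>
  have b: "backward (x, c + grad v x)" if "v differentiable (at x)" for x
    using backward_exists[of x] backward_gradient[OF _ that] by blast
  have "\<exists>\<xi>. phase_alpha_limits (\<lambda>s. phiL H s (x, \<xi>)) \<subseteq> Mt_alpha H c v" for x
    using backward_exists[of x] phase_limits_phiL by blast
  moreover have "phase_alpha_limits (\<lambda>s. phiL H s (x, grad (H x) (c + grad v x))) \<subseteq> Mt_alpha H c v"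
    if "v differentiable (at x)" for x
    using phase_limits_phiL[OF b[OF that]] unfolding Hp_def .
  moreover have "\<exists>p. (\<forall>s<0. phiH H s (x, p) \<in> graph_grad c v) \<and>
      phase_alpha_limits (\<lambda>s. phiH H s (x, p)) \<subseteq> Mstar_alpha H c v" for x
    using backward_exists[of x] backward_in_graph phase_limits_phiH by blast
  moreover have "(\<forall>s<0. phiH H s (x, c + grad v x) \<in> graph_grad c v) \<and>
      phase_alpha_limits (\<lambda>s. phiH H s (x, c + grad v x)) \<subseteq> Mstar_alpha H c v"
    if "v differentiable (at x)" for x
    using b[OF that] backward_in_graph phase_limits_phiH by blast
  ultimately show ?thesis using phiL_image_Mt phiH_image_Mstar Mstar_subset_graph by blast
qed

end
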